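(* Let $H\ne0$ be a Hermitian positive semidefinite matrix, $\alpha>0$, $T>0$, $0<\epsilon<1/4$, and let $S=2H/\|H\|-I$. Let $d$ be a positive integer and let $P_{2d}$ be the even Poisson-compiled polynomial (see context), of degree at most $2d$, for the scalar target $e^{-T\|H\|^{\alpha}|y|^{2\alpha}}$, with uniform error at most $\epsilon/2$ on $[-1,1]$. Then $$P_{2d}\!\left(\sqrt{\tfrac{1+s}{2}}\right)$$ is a polynomial of degree at most $d$ in $s$ and satisfies $$\max_{s\in[-1,1]}\left|P_{2d}\!\left(\sqrt{\tfrac{1+s}{2}}\right)-e^{-T\|H\|^{\alpha}[(1+s)/2]^{\alpha}}\right|\le\frac{\epsilon}{2}.$$ Moreover, after multiplying this polynomial by $\frac{1}{2(1+\epsilon/2)}$ and decomposing it into its even and odd parts in $s$, coherently selecting the two ordinary-QSVT circuits for these parts gives a constant-normalization block encoding of $e^{-TH^\alpha}$ (with error at most $\epsilon$) that uses $O(d)$ calls to $U_S$ and $U_S^\dagger$, where $U_S$ is a unitary with designated block exactly $S$.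
   Context: $\|\cdot\|$ is the operator norm; $H^\alpha$ is defined by spectral calculus. A block encoding of a contraction $M$ is a unitary $U$ with $(\langle 0^b|\otimes I)U(|0^b\rangle\otimes I)=M$; $U_S$ is such a unitary for $M=S$. A constant-normalization block encoding of $X$ with error $\epsilon$ is a unitary with designated block $B$ such that $\|cB-X\|\le\epsilon$, with $c$ a universal constant (independent of $d$, $T$, $H$, $\epsilon$). Ordinary QSVT: a real polynomial of definite parity, degree at most $d$ and modulus at most one on $[-1,1]$, applied to $S$, is (up to a constant normalization) the designated block of a circuit making $d$ calls to $U_S,U_S^\dagger$. Poisson-compiled polynomial for this target: let $$f(y)=\int_{\mathbb R}e^{-T\|H\|^{\alpha}|\xi|^{2\alpha}}e^{2\pi i y\xi}\,d\xi ,$$ and, for parameters $h>0$, $N\in\mathbb N$, with $J_n$ Bessel functions of the first kind and $T_n$ (subscripted) Chebyshev polynomials of the first kind, $$P_{2d}(y)=h f(0)+2h\sum_{k=1}^{N}f(kh)\Big[J_0(2\pi kh)+2\sum_{j=1}^{d}(-1)^jJ_{2j}(2\pi kh)\,T_{2j}(y)\Big],$$ where $h,N,d$ are such that $\max_{y\in[-1,1]}|P_{2d}(y)-e^{-T\|H\|^{\alpha}|y|^{2\alpha}}|\le\epsilon/2$. *)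

theory Defs
  imports
    "HOL-Analysis.Analysis"
    "HOL-Computational_Algebra.Polynomial"
    "Jordan_Normal_Form.Schur_Decomposition"
begin

hide_const (open) Finite_Cartesian_Product.mat Finite_Cartesian_Product.vec Module.smult
unbundle no vec_syntax

section \<open>Matrices\<close>

definition hermitian_mat :: "nat \<Rightarrow> complex mat \<Rightarrow> bool" where
  "hermitian_mat n A \<longleftrightarrow> A \<in> carrier_mat n n \<and> mat_adjoint A = A"

definition psd_mat :: "nat \<Rightarrow> complex mat \<Rightarrow> bool" where
  "psd_mat n A \<longleftrightarrow> hermitian_mat n A \<and> (\<forall>v\<in>carrier_vec n. 0 \<le> Re ((A *\<^sub>v v) \<bullet>c v))"

definition unitary_mat :: "nat \<Rightarrow> complex mat \<Rightarrow> bool" where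
  "unitary_mat n U \<longleftrightarrow>
     U \<in> carrier_mat n n \<and> mat_adjoint U * U = 1\<^sub>m n \<and> U * mat_adjoint U = 1\<^sub>m n"

definition l2norm :: "complex vec \<Rightarrow> real" where
  "l2norm v = sqrt (\<Sum>i<dim_vec v. (cmod (vec_index v i))\<^sup>2)"

definition opnorm :: "complex mat \<Rightarrow> real" where
  "opnorm A = Sup {l2norm (A *\<^sub>v v) |v. v \<in> carrier_vec (dim_col A) \<and> l2norm v \<le> 1}"

text \<open>Spectral calculus: \<open>f (V D V\<^sup>*) = V f(D) V\<^sup>*\<close> for Hermitian matrices; the result does not
  depend on the chosen unitary diagonalization.\<close>

definition spectral_calculus :: "(real \<Rightarrow> real) \<Rightarrow> complex mat \<Rightarrow> complex mat" where
  "spectral_calculus f A = (THE B. \<exists>V ev. let n = dim_row A in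
     unitary_mat n V \<and>
     A = V * mat_diag n (\<lambda>i. complex_of_real (ev i)) * mat_adjoint V \<and>
     B = V * mat_diag n (\<lambda>i. complex_of_real (f (ev i))) * mat_adjoint V)"

definition mat_powr :: "complex mat \<Rightarrow> real \<Rightarrow> complex mat" where
  "mat_powr A \<alpha> = spectral_calculus (\<lambda>x. x powr \<alpha>) A"

definition mat_exp :: "complex mat \<Rightarrow> complex mat" where
  "mat_exp A = mat (dim_row A) (dim_row A) (\<lambda>(i, j). \<Sum>k. (A ^\<^sub>m k) $$ (i, j) / fact k)"

definition poly_mat :: "real poly \<Rightarrow> complex mat \<Rightarrow> complex mat" where
  "poly_mat p A = mat (dim_row A) (dim_row A)
     (\<lambda>(i, j). \<Sum>k\<le>degree p. complex_of_real (coeff p k) * (A ^\<^sub>m k) $$ (i, j))"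

text \<open>Kronecker product; the left factor is the most significant index.\<close>

definition kron :: "complex mat \<Rightarrow> complex mat \<Rightarrow> complex mat" (infixr \<open>\<otimes>\<^sub>m\<close> 72) where
  "A \<otimes>\<^sub>m B = mat (dim_row A * dim_row B) (dim_col A * dim_col B)
     (\<lambda>(i, j). A $$ (i div dim_row B, j div dim_col B) * B $$ (i mod dim_row B, j mod dim_col B))"

definition basis_proj :: "nat \<Rightarrow> nat set \<Rightarrow> complex mat" where
  "basis_proj m A = mat_diag m (\<lambda>i. if i \<in> A then 1 else 0)"

section \<open>Block encodings\<close>

definition ket0 :: "nat \<Rightarrow> complex mat" where
  "ket0 k = mat (2 ^ k) 1 (\<lambda>(i, j). if i = 0 then 1 else 0)"

definition block :: "nat \<Rightarrow> nat \<Rightarrow> complex mat \<Rightarrow> complex mat" where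
  "block k n U = (mat_adjoint (ket0 k) \<otimes>\<^sub>m 1\<^sub>m n) * U * (ket0 k \<otimes>\<^sub>m 1\<^sub>m n)"

definition block_encoding :: "nat \<Rightarrow> nat \<Rightarrow> complex mat \<Rightarrow> complex mat \<Rightarrow> bool" where
  "block_encoding k n M U \<longleftrightarrow> unitary_mat (2 ^ k * n) U \<and> block k n U = M"

definition scaled_block_encoding ::
  "real \<Rightarrow> nat \<Rightarrow> nat \<Rightarrow> complex mat \<Rightarrow> real \<Rightarrow> complex mat \<Rightarrow> bool" where
  "scaled_block_encoding c k n X \<epsilon> W \<longleftrightarrow>
     unitary_mat (2 ^ k * n) W \<and> opnorm (complex_of_real c \<cdot>\<^sub>m block k n W - X) \<le> \<epsilon>"

section \<open>Query circuits\<close>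

text \<open>A circuit acts on \<open>a\<close> work qubits, the \<open>b\<close> qubits of the block register of the oracle, and the
  \<open>n\<close>-dimensional system, in this order of significance. Local gates act as the identity on the
  system, and a circuit is a syntactic object that mentions neither the oracle nor the encoded
  matrix; both can be accessed through queries only. A query is applied conditionally on the work
  register being in one of the basis states in the given set, so that uncontrolled calls (the set
  of all basis states) and (multiply) controlled calls are covered; each counts as one call.\<close>

datatype gate = Local "complex mat" | Query "nat set" | Query_Adj "nat set"

definition controlled_oracle :: "nat \<Rightarrow> nat set \<Rightarrow> complex mat \<Rightarrow> complex mat" where
  "controlled_oracle a A U =
     basis_proj (2 ^ a) A \<otimes>\<^sub>m U + basis_proj (2 ^ a) (- A) \<otimes>\<^sub>m 1\<^sub>m (dim_row U)"

fun gate_mat :: "nat \<Rightarrow> nat \<Rightarrow> complex mat \<Rightarrow> gate \<Rightarrow> complex mat" where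
  "gate_mat a n U (Local G) = G \<otimes>\<^sub>m 1\<^sub>m n"
| "gate_mat a n U (Query A) = controlled_oracle a A U"
| "gate_mat a n U (Query_Adj A) = controlled_oracle a A (mat_adjoint U)"

text \<open>The head of the list is applied first.\<close>

fun circuit_mat :: "nat \<Rightarrow> nat \<Rightarrow> nat \<Rightarrow> complex mat \<Rightarrow> gate list \<Rightarrow> complex mat" where
  "circuit_mat a b n U [] = 1\<^sub>m (2 ^ (a + b) * n)"
| "circuit_mat a b n U (g # gs) = circuit_mat a b n U gs * gate_mat a n U g"

definition valid_circuit :: "nat \<Rightarrow> nat \<Rightarrow> gate list \<Rightarrow> bool" where
  "valid_circuit a b gs \<longleftrightarrow> (\<forall>G. Local G \<in> set gs \<longrightarrow> unitary_mat (2 ^ (a + b)) G)"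

definition num_calls :: "gate list \<Rightarrow> nat" where
  "num_calls gs = length (filter (\<lambda>g. \<not> (\<exists>G. g = Local G)) gs)"

section \<open>Ordinary QSVT and coherent selection\<close>

definition definite_parity :: "real poly \<Rightarrow> bool" where
  "definite_parity p \<longleftrightarrow> pcompose p [:0, -1:] = p \<or> pcompose p [:0, -1:] = - p"

text \<open>The Hermitian block-encoded matrices considered here are automatically contractions, since a
  block of a unitary has norm at most one.\<close>

definition ordinary_qsvt :: "real \<Rightarrow> nat \<Rightarrow> real poly \<Rightarrow> nat \<Rightarrow> nat \<Rightarrow> gate list \<Rightarrow> bool" where
  "ordinary_qsvt \<kappa> d p a b gs \<longleftrightarrow>
     definite_parity p \<and> degree p \<le> d \<and> (\<forall>x\<in>{-1..1}. \<bar>poly p x\<bar> \<le> 1) \<and>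
     valid_circuit a b gs \<and> num_calls gs \<le> d \<and>
     (\<forall>n S U. hermitian_mat n S \<longrightarrow> block_encoding b n S U \<longrightarrow>
        complex_of_real \<kappa> \<cdot>\<^sub>m block (a + b) n (circuit_mat a b n U gs) = poly_mat p S)"

definition even_part :: "real poly \<Rightarrow> real poly" where
  "even_part p = smult (1/2) (p + pcompose p [:0, -1:])"

definition odd_part :: "real poly \<Rightarrow> real poly" where
  "odd_part p = smult (1/2) (p - pcompose p [:0, -1:])"

definition hadamard :: "complex mat" where
  "hadamard = mat 2 2 (\<lambda>(i, j). (if i = 1 \<and> j = 1 then -1 else 1) / complex_of_real (sqrt 2))"

text \<open>\<open>control_gate a b v g\<close> acts on \<open>a + 1\<close> work qubits and performs \<open>g\<close> if the new, most
  significant qubit is in the state \<open>v\<close>.\<close>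

fun control_gate :: "nat \<Rightarrow> nat \<Rightarrow> nat \<Rightarrow> gate \<Rightarrow> gate" where
  "control_gate a b v (Local G) =
     Local (basis_proj 2 {v} \<otimes>\<^sub>m G + basis_proj 2 (- {v}) \<otimes>\<^sub>m 1\<^sub>m (2 ^ (a + b)))"
| "control_gate a b v (Query A) = Query ((\<lambda>x. v * 2 ^ a + x) ` (A \<inter> {..<2 ^ a}))"
| "control_gate a b v (Query_Adj A) = Query_Adj ((\<lambda>x. v * 2 ^ a + x) ` (A \<inter> {..<2 ^ a}))"

text \<open>\<open>(Had \<otimes> I) (|0><0| \<otimes> W\<^sub>0 + |1><1| \<otimes> W\<^sub>1) (Had \<otimes> I)\<close>, whose designated block is the average
  of those of \<open>W\<^sub>0\<close> and \<open>W\<^sub>1\<close>.\<close>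

definition coherent_select :: "nat \<Rightarrow> nat \<Rightarrow> gate list \<Rightarrow> gate list \<Rightarrow> gate list" where
  "coherent_select a b gs0 gs1 =
     [Local (hadamard \<otimes>\<^sub>m 1\<^sub>m (2 ^ (a + b)))]
     @ map (control_gate a b 0) gs0 @ map (control_gate a b 1) gs1
     @ [Local (hadamard \<otimes>\<^sub>m 1\<^sub>m (2 ^ (a + b)))]"

section \<open>Poisson-compiled polynomial\<close>

definition bessel_J :: "nat \<Rightarrow> real \<Rightarrow> real" where
  "bessel_J n x = (\<Sum>m. (-1) ^ m / (fact m * fact (m + n)) * (x / 2) ^ (2 * m + n))"

fun cheb_poly :: "nat \<Rightarrow> real poly" where
  "cheb_poly 0 = 1"
| "cheb_poly (Suc 0) = [:0, 1:]"
| "cheb_poly (Suc (Suc n)) = [:0, 2:] * cheb_poly (Suc n) - cheb_poly n"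

text \<open>Below, \<open>\<nu>\<close> stands for the norm of \<open>H\<close>.\<close>

definition poisson_f :: "real \<Rightarrow> real \<Rightarrow> real \<Rightarrow> real \<Rightarrow> complex" where
  "poisson_f T \<nu> \<alpha> y =
     (LINT \<xi>|lborel. complex_of_real (exp (- T * \<nu> powr \<alpha> * \<bar>\<xi>\<bar> powr (2 * \<alpha>)))
        * exp (2 * complex_of_real pi * \<i> * complex_of_real (y * \<xi>)))"

lemma poisson_f_real: "poisson_f T \<nu> \<alpha> y \<in> \<real>"
proof -
  let ?g = "\<lambda>\<xi>. complex_of_real (exp (- T * \<nu> powr \<alpha> * \<bar>\<xi>\<bar> powr (2 * \<alpha>)))
        * exp (2 * complex_of_real pi * \<i> * complex_of_real (y * \<xi>))"
  have "cnj (poisson_f T \<nu> \<alpha> y) = (LINT \<xi>|lborel. cnj (?g \<xi>))"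
    unfolding poisson_f_def by (rule Bochner_Integration.integral_cnj[symmetric])
  also have "\<dots> = (LINT \<xi>|lborel. ?g (- \<xi>))"
    by (rule Bochner_Integration.integral_cong) (simp_all add: exp_cnj)
  also have "\<dots> = (LINT \<xi>|lborel. ?g \<xi>)"
    using lborel_integral_real_affine[of "-1" ?g 0] by simp
  finally show ?thesis
    unfolding poisson_f_def by (simp add: Reals_cnj_iff)
qed

text \<open>By \<open>poisson_f_real\<close>, taking real parts only changes the type of the coefficients.\<close>

definition poisson_poly :: "real \<Rightarrow> real \<Rightarrow> real \<Rightarrow> real \<Rightarrow> nat \<Rightarrow> nat \<Rightarrow> real poly" where
  "poisson_poly T \<nu> \<alpha> h N d =
     [:h * Re (poisson_f T \<nu> \<alpha> 0):]
     + smult (2 * h) (\<Sum>k=1..N. smult (Re (poisson_f T \<nu> \<alpha> (real k * h)))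
         ([:bessel_J 0 (2 * pi * real k * h):]
          + smult 2 (\<Sum>j=1..d. smult ((-1) ^ j * bessel_J (2 * j) (2 * pi * real k * h))
                                    (cheb_poly (2 * j)))))"

end

theory Submission
  imports Defs
begin

text \<open>Since \<open>T\<^sub>2\<^sub>j(y) = T\<^sub>j(2 y\<^sup>2 - 1)\<close>, the substitution \<open>y\<^sup>2 = (1 + s) / 2\<close> halves the degree, and
  \<open>s = 2 \<lambda> / \<nu> - 1\<close> turns the scalar target into \<open>exp (- T \<lambda>\<^sup>\<alpha>)\<close> on the eigenvalues \<open>\<lambda>\<close> of \<open>H\<close>.

  A circuit for a real polynomial \<open>p\<close> with \<open>\<bar>p\<bar> < 1\<close> on \<open>[-1, 1]\<close> is found with one work qubit and without
  complex phases. Write \<open>1 - p\<^sup>2 = A\<^sup>2 + (1 - x\<^sup>2) B\<^sup>2\<close>: such representations are multiplicative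
  (Brahmagupta's identity), so that it is enough to represent the linear and the quadratic factors of
  \<open>1 - p\<^sup>2\<close> as a polynomial in \<open>x\<^sup>2\<close>. A query maps the pair \<open>(P, Q)\<close> of coefficient vectors to
  \<open>(x P + (1 - x\<^sup>2) Q, P - x Q)\<close>, which is an involution. The normalization
  \<open>\<bar>P\<bar>\<^sup>2 + (1 - x\<^sup>2) \<bar>Q\<bar>\<^sup>2 = 1\<close> forces the leading coefficient vectors of \<open>P\<close> and \<open>Q\<close> to have equal length;
  rotating them onto each other makes the next query lower the degree, down to a constant.\<close>

text \<open>The obstacle is the weight sqrt(1 - x^2) of signal processing, which is not a polynomial
  and vanishes at the eigenvalues 1 and -1 of \<open>S\<close>. It is avoided by leaving
  \<open>L = W K - K S\<close> unnormalized: its Gram matrix is 1 - S^2, exactly the weight of the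
  norm form, so all coefficients stay polynomials, eigenvalues 1 and -1 are no special case, and the
  oracle itself may be non-Hermitian. As the columns of \<open>L\<close> are orthogonal to the
  designated subspace, the block register tells the \<open>P\<close> part from the \<open>Q\<close>
  part, and the work qubit can be rotated by a different real angle on each. This freedom replaces
  the complex phases. The other half of the work qubit stores the complement \<open>A\<close>, so
  that the block is the real polynomial itself. The strict bound on \<open>p\<close> keeps the roots
  of 1 - p^2 away from [-1, 1], so that roots of even multiplicity there never have to be treated.
  It is supplied by the factor 1/2 in the scaling of \<open>q\<close> together with
  \<open>\<kappa> \<ge> 1\<close>. The final statement concerns every pair of circuits that meets
  the QSVT specification; the construction shows that such pairs exist.\<close>

section \<open>Polynomials of definite parity and the norm form \<open>A\<^sup>2 + (1 - x\<^sup>2) B\<^sup>2\<close>\<close>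

text \<open>One index serves as degree bound and as parity. A companion \<open>B\<close> of degree
  at most k - 1 and opposite parity is expressed by \<open>has_parity k (pCons 0 B)\<close>: no
  subtraction occurs, and for k = 0 the condition forces B = 0.\<close>

definition has_parity :: "nat \<Rightarrow> real poly \<Rightarrow> bool" where
  "has_parity k p \<longleftrightarrow> (\<forall>i. coeff p i \<noteq> 0 \<longrightarrow> i \<le> k \<and> even (k + i))"

lemma has_parity_0 [simp]: "has_parity k 0"
  by (simp add: has_parity_def)

lemma has_parity_add: "has_parity k p \<Longrightarrow> has_parity k q \<Longrightarrow> has_parity k (p + q)"
  by (force simp: has_parity_def)

lemma has_parity_smult: "has_parity k p \<Longrightarrow> has_parity k (smult c p)"
  by (simp add: has_parity_def)

lemma has_parity_diff: "has_parity k p \<Longrightarrow> has_parity k q \<Longrightarrow> has_parity k (p - q)"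
  by (force simp: has_parity_def)

lemma has_parity_const: "has_parity 0 [:c:]"
  by (auto simp: has_parity_def coeff_pCons split: nat.splits)

lemma has_parity_mult:
  assumes "has_parity j p" "has_parity k q"
  shows "has_parity (j + k) (p * q)"
  unfolding has_parity_def
proof (intro allI impI)
  fix i assume "coeff (p * q) i \<noteq> 0"
  then have "(\<Sum>l\<le>i. coeff p l * coeff q (i - l)) \<noteq> 0"
    by (simp add: coeff_mult)
  then obtain l where l: "l \<le> i" "coeff p l \<noteq> 0" "coeff q (i - l) \<noteq> 0"
    by (metis (no_types, lifting) atMost_iff mult_eq_0_iff sum.neutral)
  with assms have "l \<le> j" "even (j + l)" "i - l \<le> k" "even (k + (i - l))"
    by (auto simp: has_parity_def)
  with l show "i \<le> j + k \<and> even (j + k + i)"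
    by auto
qed

lemma has_parity_pCons: "has_parity (Suc k) (pCons 0 p) \<longleftrightarrow> has_parity k p"
  unfolding has_parity_def by (force simp: coeff_pCons split: nat.splits)

lemma has_parity_pCons_lower: "has_parity k (pCons 0 (pCons 0 p)) \<Longrightarrow> has_parity k p"
  unfolding has_parity_def by (auto simp: coeff_pCons split: nat.splits)

lemma has_parity_lower:
  assumes "has_parity (Suc (Suc k)) p" "coeff p (Suc (Suc k)) = 0"
  shows "has_parity k p"
  unfolding has_parity_def
proof (intro allI impI)
  fix i assume i: "coeff p i \<noteq> 0"
  with assms have "i \<le> Suc (Suc k)" "even (Suc (Suc k) + i)" "i \<noteq> Suc (Suc k)"
    by (auto simp: has_parity_def)
  then show "i \<le> k \<and> even (k + i)"
    by (metis add_Suc even_Suc le_SucE add_Suc_right odd_add even_add)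
qed

text \<open>This is the norm of A + B sqrt(x^2 - 1), which explains the multiplicativity. The index
  \<open>k\<close> is a degree budget that adds up under products.\<close>

definition norm_form :: "nat \<Rightarrow> real poly \<Rightarrow> bool" where
  "norm_form k F \<longleftrightarrow> (\<exists>A B. has_parity k A \<and> has_parity k (pCons 0 B) \<and>
     F = A\<^sup>2 + [:1, 0, -1:] * B\<^sup>2)"

lemma norm_form_mult:
  assumes "norm_form j F" "norm_form k G"
  shows "norm_form (j + k) (F * G)"
proof -
  obtain A B where F: "has_parity j A" "has_parity j (pCons 0 B)" "F = A\<^sup>2 + [:1, 0, -1:] * B\<^sup>2"
    using assms(1) by (auto simp: norm_form_def)
  obtain C D where G: "has_parity k C" "has_parity k (pCons 0 D)" "G = C\<^sup>2 + [:1, 0, -1:] * D\<^sup>2"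
    using assms(2) by (auto simp: norm_form_def)
  \<comment> \<open>Expand (A + B w) (C + D w) with w^2 = x^2 - 1.\<close>
  let ?E = "A * C - [:1, 0, -1:] * (B * D)" and ?F = "A * D + B * C"
  have *: "has_parity (j + k) (pCons 0 (pCons 0 (B * D)))"
    using has_parity_mult[OF F(2) G(2)] by simp
  have **: "[:1, 0, -1:] * (B * D) = B * D - pCons 0 (pCons 0 (B * D))"
    by (simp add: algebra_simps)
  have "has_parity (j + k) ?E"
    unfolding ** using has_parity_mult[OF F(1) G(1)] * has_parity_pCons_lower[OF *]
    by (intro has_parity_diff)
  moreover have "has_parity (j + k) (pCons 0 ?F)"
    using has_parity_add[OF has_parity_mult[OF F(1) G(2)] has_parity_mult[OF F(2) G(1)]] by simp
  moreover have "(A\<^sup>2 + w * B\<^sup>2) * (C\<^sup>2 + w * D\<^sup>2) = (A * C - w * (B * D))\<^sup>2 + w * (A * D + B * C)\<^sup>2" for w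
    by (simp add: power2_eq_square algebra_simps)
  then have "F * G = ?E\<^sup>2 + [:1, 0, -1:] * ?F\<^sup>2"
    unfolding F(3) G(3) .
  ultimately show ?thesis
    unfolding norm_form_def by blast
qed

lemma norm_form_const: "0 \<le> c \<Longrightarrow> norm_form 0 [:c:]"
  unfolding norm_form_def
  by (intro exI[of _ "[:sqrt c:]"] exI[of _ 0]) (simp add: has_parity_const power2_eq_square)

section \<open>Norm forms of polynomials that are positive on [0, 1]\<close>

lemma degree_le_1_cases:
  fixes p :: "'a::zero poly"
  assumes "degree p \<le> 1"
  obtains a b where "p = [:a, b:]"
proof -
  obtain a q where "p = pCons a q" by (cases p)
  moreover obtain b r where "q = pCons b r" by (cases q)
  ultimately show ?thesis using assms that[of a b]
    by (auto split: if_splits)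
qed

text \<open>With y = x^2, a + b y = (a + b) y + a (1 - y) interpolates between the values at the
  endpoints, and both weights are squares of reals.\<close>

lemma norm_form_linear:
  assumes "0 \<le> poly L 0" "0 \<le> poly L 1" "degree L \<le> 1"
  shows "norm_form 1 (pcompose L [:0, 0, 1:])"
proof -
  obtain a b where L: "L = [:a, b:]"
    using assms(3) by (rule degree_le_1_cases)
  have ab: "0 \<le> a" "0 \<le> a + b"
    using assms(1,2) by (auto simp: L)
  have "has_parity 1 [:0, sqrt (a + b):]" "has_parity 1 (pCons 0 [:sqrt a:])"
    by (auto simp: has_parity_def coeff_pCons split: nat.splits)
  moreover have "pcompose L [:0, 0, 1:] = [:0, sqrt (a + b):]\<^sup>2 + [:1, 0, -1:] * [:sqrt a:]\<^sup>2"
    using ab by (simp add: L pcompose_pCons power2_eq_square)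
  ultimately show ?thesis
    unfolding norm_form_def by blast
qed

lemma norm_form_quadratic:
  assumes pos: "\<And>y. y \<in> {0..1} \<Longrightarrow> 0 < poly q y" and "degree q \<le> 2"
  shows "norm_form 2 (pcompose q [:0, 0, 1:])"
proof -
  obtain a b c where q: "q = [:a, b, c:]"
  proof -
    obtain a r where "q = pCons a r" by (cases q)
    moreover obtain b s where "r = pCons b s" by (cases r)
    moreover obtain c t where "s = pCons c t" by (cases s)
    ultimately show ?thesis using assms(2) that[of a b c]
      by (auto split: if_splits)
  qed
  define u v where "u = sqrt a" and "v = sqrt (a + b + c)"
  have u: "u > 0" "u\<^sup>2 = a" and v: "v > 0" "v\<^sup>2 = a + b + c"
    using pos[of 0] pos[of 1] by (auto simp: u_def v_def q add.assoc)
  \<comment> \<open>\<open>u (1 - y) - v y\<close> squared agrees with \<open>q\<close> at \<open>0\<close> and \<open>1\<close>; at its root in \<open>(0, 1)\<close> the remaining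
    multiple of \<open>y (1 - y)\<close> is seen to be positive.\<close>
  define \<mu> where "\<mu> = (u + v)\<^sup>2 - c"
  define y where "y = u / (u + v)"
  have "0 < y" "y < 1" and uy: "(u + v) * y = u"
    using u v by (auto simp: y_def)
  then have y: "y \<in> {0..1}" "0 < y * (1 - y)" by auto
  have "poly q y = (u - (u + v) * y)\<^sup>2 + \<mu> * (y * (1 - y))"
  proof -
    have a: "a = u\<^sup>2" and b: "b = v\<^sup>2 - u\<^sup>2 - c" using u(2) v(2) by auto
    show ?thesis
      unfolding \<mu>_def q a b by (simp add: power2_eq_square algebra_simps)
  qed
  with uy have "poly q y = \<mu> * (y * (1 - y))" by simp
  with pos[OF y(1)] y(2) have \<mu>: "0 \<le> \<mu>"
    by (metis less_eq_real_def zero_less_mult_pos2)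
  \<comment> \<open>For y = x^2, the term \<mu> y (1 - y) is (1 - x^2) times the square of sqrt
    \<mu> x.\<close>
  have "has_parity 2 [:u, 0, - (u + v):]" "has_parity 2 (pCons 0 [:0, sqrt \<mu>:])"
    by (auto simp: has_parity_def coeff_pCons split: nat.splits)
  moreover have "pcompose q [:0, 0, 1:] = [:u, 0, - (u + v):]\<^sup>2 + [:1, 0, -1:] * [:0, sqrt \<mu>:]\<^sup>2"
    using \<mu> u(2) v(2) unfolding \<mu>_def by (simp add: q pcompose_pCons power2_eq_square algebra_simps)
  ultimately show ?thesis
    unfolding norm_form_def by blast
qed

text \<open>The representation 1 = x^2 + (1 - x^2) has budget 1, so multiplying by it pads the
  budget by one and flips the parities of A and B. This adjusts both to the parity of the target
  polynomial.\<close>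

lemma norm_form_mono:
  assumes "norm_form k F" "k \<le> l"
  shows "norm_form l F"
proof -
  have one: "norm_form 1 1"
    using norm_form_linear[of 1] by (simp add: pcompose_1)
  have "norm_form (k + m) F" for m
    by (induction m) (use assms(1) norm_form_mult[OF _ one] in auto)
  with assms(2) show ?thesis
    by (metis le_add_diff_inverse)
qed

text \<open>The remainder modulo the quadratic is a real polynomial a + b x that vanishes at the
  nonreal \<open>z\<close>; comparing imaginary parts gives b = 0, hence a = 0.\<close>

lemma complex_root_quadratic_factor:
  fixes G :: "real poly"
  assumes root: "poly (map_poly complex_of_real G) z = 0" and "Im z \<noteq> 0"
  shows "[:(cmod z)\<^sup>2, -2 * Re z, 1:] dvd G"
proof -
  let ?q = "[:(cmod z)\<^sup>2, -2 * Re z, 1:]" and ?c = "map_poly complex_of_real"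
  interpret hom: map_poly_comm_ring_hom complex_of_real ..
  define R where "R = G mod ?q"
  have "degree R < 2 \<or> R = 0"
    using degree_mod_less[of ?q G] by (auto simp: R_def)
  then have "degree R \<le> 1" by auto
  then obtain a b where R: "R = [:a, b:]"
    by (rule degree_le_1_cases)
  have "poly (?c ?q) z = 0"
    unfolding cmod_power2 by (simp add: complex_eq_iff map_poly_pCons)
      (simp add: power2_eq_square algebra_simps)
  moreover have "?c G = ?c ?q * ?c (G div ?q) + ?c R"
    unfolding R_def by (metis mult_div_mod_eq hom.hom_mult hom.hom_add)
  ultimately have "poly (?c R) z = 0"
    using root by (metis add_0 mult_zero_left poly_add poly_mult)
  then have "complex_of_real a + z * complex_of_real b = 0"
    unfolding R of_real_hom.map_poly_pCons_hom by simp
  with \<open>Im z \<noteq> 0\<close> have "b = 0" "a = 0"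
    by (auto simp: complex_eq_iff)
  then have "R = 0" by (simp add: R)
  then show ?thesis
    by (auto simp: R_def)
qed

text \<open>A root of \<open>G\<close> is real and outside [0, 1], giving a linear factor whose sign
  can be chosen positive on [0, 1], or nonreal, giving a quadratic factor that is positive
  everywhere. Either way the quotient is again positive on [0, 1], and the budgets of the factors
  add up to the degree.\<close>

lemma norm_form_of_positive:
  assumes "\<And>y. y \<in> {0..1} \<Longrightarrow> 0 < poly G y"
  shows "norm_form (degree G) (pcompose G [:0, 0, 1:])"
  using assms
proof (induction "degree G" arbitrary: G rule: less_induct)
  case less
  have G0: "G \<noteq> 0" using less.prems[of 0] by auto
  have step: ?case if F: "G = Q * G'" "\<And>y. y \<in> {0..1} \<Longrightarrow> 0 < poly Q y" "degree Q > 0"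
    "norm_form (degree Q) (pcompose Q [:0, 0, 1:])" for Q G'
  proof -
    have deg: "degree G = degree Q + degree G'"
      unfolding F(1) using G0 F(1) by (intro degree_mult_eq) auto
    have "norm_form (degree G') (pcompose G' [:0, 0, 1:])"
    proof (rule less.hyps)
      show "degree G' < degree G" using deg F(3) by simp
      show "0 < poly G' y" if "y \<in> {0..1}" for y
        using less.prems[OF that] F(2)[OF that] by (simp add: F(1) zero_less_mult_iff)
    qed
    with norm_form_mult[OF F(4) this] show ?thesis
      unfolding deg by (simp add: F(1) pcompose_mult)
  qed
  show ?case
  proof (cases "degree G = 0")
    case True
    then obtain g where "G = [:g:]" by (metis degree_eq_zeroE)
    with less.prems[of 0] show ?thesis
      by (simp add: norm_form_const)
  next
    case False
    then have "\<not> constant (poly (map_poly complex_of_real G))"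
      by (simp add: constant_degree)
    then obtain z where z: "poly (map_poly complex_of_real G) z = 0"
      using fundamental_theorem_of_algebra by blast
    show ?thesis
    proof (cases "Im z = 0")
      case True
      then have "z = complex_of_real (Re z)" by (simp add: complex_eq_iff)
      with z have "poly G (Re z) = 0"
        by (metis of_real_eq_0_iff of_real_hom.poly_map_poly)
      then obtain G' where G': "G = [:- Re z, 1:] * G'"
        by (metis dvdE poly_eq_0_iff_dvd)
      have "Re z \<notin> {0..1}"
        using less.prems \<open>poly G (Re z) = 0\<close> by force
      then consider "Re z < 0" | "Re z > 1" by force
      then show ?thesis
      proof cases
        case 1
        show ?thesis
          by (rule step[OF G']) (use 1 norm_form_linear[of "[:- Re z, 1:]"] in auto)
      next
        case 2
        have "G = [:Re z, -1:] * (- G')" by (simp add: G')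
        then show ?thesis
          by (rule step) (use 2 norm_form_linear[of "[:Re z, -1:]"] in auto)
      qed
    next
      case False
      let ?q = "[:(cmod z)\<^sup>2, -2 * Re z, 1:]"
      obtain G' where G': "G = ?q * G'"
        using complex_root_quadratic_factor[OF z False] by (auto elim: dvdE)
      have "0 < poly ?q y" for y
      proof -
        have "poly ?q y = (y - Re z)\<^sup>2 + (Im z)\<^sup>2"
          unfolding cmod_power2 by (simp add: power2_eq_square algebra_simps)
        with False show ?thesis by (simp add: add_nonneg_pos)
      qed
      then show ?thesis
        by (intro step[OF G'] norm_form_quadratic) (use norm_form_quadratic[of ?q] in \<open>auto simp: numeral_2_eq_2\<close>)
    qed
  qed
qed

lemma even_poly_in_square:
  assumes "has_parity (2 * k) p"
  shows "\<exists>g. p = pcompose g [:0, 0, 1:] \<and> degree g \<le> k"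
  using assms
proof (induction k arbitrary: p)
  case 0
  then have "degree p \<le> 0"
    by (intro degree_le) (force simp: has_parity_def)
  then obtain c where "p = [:c:]"
    by (metis degree_eq_zeroE le_zero_eq)
  then show ?case
    by (intro exI[of _ "[:c:]"]) simp
next
  case (Suc k)
  obtain c r where p: "p = pCons c r" by (cases p)
  obtain e s where r: "r = pCons e s" by (cases r)
  have "e = 0"
    using Suc.prems by (auto simp: has_parity_def p r dest!: spec[of _ 1])
  have "has_parity (2 * k) s"
    unfolding has_parity_def
  proof (intro allI impI)
    fix i assume "coeff s i \<noteq> 0"
    then have "coeff p (Suc (Suc i)) \<noteq> 0" by (simp add: p r)
    with Suc.prems have "Suc (Suc i) \<le> 2 * Suc k" "even (2 * Suc k + Suc (Suc i))"
      by (auto simp: has_parity_def)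
    then show "i \<le> 2 * k \<and> even (2 * k + i)" by auto
  qed
  from Suc.IH[OF this] obtain g where "s = pcompose g [:0, 0, 1:]" "degree g \<le> k" by blast
  then show ?case
    by (intro exI[of _ "pCons c g"]) (simp add: p r \<open>e = 0\<close> pcompose_pCons)
qed

text \<open>Being even, 1 - p^2 is g(x^2) with g of degree at most \<open>k\<close>, and the strict
  bound on \<open>p\<close> makes g positive on [0, 1]. Factoring g rather than 1 - p^2 is what
  keeps \<open>A\<close> and \<open>B\<close> within the degree of \<open>p\<close>; the role is
  that of a Fejer-Riesz factorization.\<close>

lemma complementary_polynomials:
  assumes p: "has_parity k p" and bound: "\<And>x. x \<in> {-1..1} \<Longrightarrow> \<bar>poly p x\<bar> < 1"
  obtains A B where "has_parity k A" "has_parity k (pCons 0 B)"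
    "p\<^sup>2 + A\<^sup>2 + [:1, 0, -1:] * B\<^sup>2 = 1"
proof -
  have "has_parity (2 * k) (1 - p\<^sup>2)"
    using has_parity_mult[OF p p]
    by (intro has_parity_diff) (auto simp: has_parity_def power2_eq_square mult_2)
  then obtain g where g: "1 - p\<^sup>2 = pcompose g [:0, 0, 1:]" "degree g \<le> k"
    using even_poly_in_square by blast
  have "0 < poly g y" if "y \<in> {0..1}" for y
  proof -
    have "sqrt y \<in> {-1..1}"
      using that by (auto intro: order_trans[of _ 0])
    then have "(poly p (sqrt y))\<^sup>2 < 1"
      using bound by (simp add: abs_square_less_1)
    moreover have "poly (1 - p\<^sup>2) (sqrt y) = poly g y"
      unfolding g(1) using that by (simp add: poly_pcompose)
    ultimately show ?thesis by simp
  qed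
  then have "norm_form k (1 - p\<^sup>2)"
    unfolding g(1) using g(2) norm_form_mono norm_form_of_positive by blast
  then show ?thesis
    using that unfolding norm_form_def by (auto simp: algebra_simps)
qed

section \<open>Kronecker products\<close>

lemma sum_lessThan_mult_split:
  fixes f :: "nat \<Rightarrow> nat \<Rightarrow> 'a::comm_semiring_0"
  shows "(\<Sum>k<m * n. f (k div n) (k mod n)) = (\<Sum>i<m. \<Sum>j<n. f i j)"
  unfolding sum_mult_product by (intro sum.cong) auto

lemma kron_carrier [simp]: "A \<in> carrier_mat r c \<Longrightarrow> B \<in> carrier_mat r' c' \<Longrightarrow> A \<otimes>\<^sub>m B \<in> carrier_mat (r * r') (c * c')"
  by (auto simp: kron_def)

lemma dim_row_kron [simp]: "dim_row (A \<otimes>\<^sub>m B) = dim_row A * dim_row B"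
  and dim_col_kron [simp]: "dim_col (A \<otimes>\<^sub>m B) = dim_col A * dim_col B"
  by (simp_all add: kron_def)

lemma index_kron:
  "i < dim_row A * dim_row B \<Longrightarrow> j < dim_col A * dim_col B \<Longrightarrow>
   (A \<otimes>\<^sub>m B) $$ (i, j) = A $$ (i div dim_row B, j div dim_col B) * B $$ (i mod dim_row B, j mod dim_col B)"
  by (simp add: kron_def)

lemma div_mod_less_mult:
  fixes i m n :: nat
  assumes "i < m * n"
  shows "i div n < m" "i mod n < n"
  using assms by (auto simp: less_mult_imp_div_less intro!: mod_less_divisor gr0I)

lemma index_mult_mat_sum:
  assumes "i < dim_row A" "j < dim_col B" "dim_col A = dim_row B"
  shows "(A * B) $$ (i, j) = (\<Sum>k<dim_row B. A $$ (i, k) * B $$ (k, j))"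
  using assms by (simp add: scalar_prod_def atLeast0LessThan)

lemma mult_mat_assoc:
  fixes A B C :: "'a::semiring_0 mat"
  assumes "dim_col A = dim_row B" "dim_col B = dim_row C"
  shows "A * B * C = A * (B * C)"
  using assms by (intro assoc_mult_mat[of A "dim_row A" "dim_col A" B "dim_col B" C "dim_col C"]) auto

lemma add_mat_distrib:
  fixes A B C :: "'a::semiring_0 mat"
  assumes "dim_row A = dim_row B" "dim_col A = dim_col B" "dim_col A = dim_row C"
  shows "(A + B) * C = A * C + B * C"
  using assms by (intro add_mult_distrib_mat[of A "dim_row A" "dim_col A" B C "dim_col C"]) auto

lemma mult_mat_distrib:
  fixes A B C :: "'a::semiring_0 mat"
  assumes "dim_row B = dim_row C" "dim_col B = dim_col C" "dim_col A = dim_row B"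
  shows "A * (B + C) = A * B + A * C"
  using assms by (intro mult_add_distrib_mat[of A "dim_row A" "dim_col A" B "dim_col B" C]) auto

lemma kron_mult:
  assumes "dim_col A = dim_row C" "dim_col B = dim_row D"
  shows "(A \<otimes>\<^sub>m B) * (C \<otimes>\<^sub>m D) = (A * C) \<otimes>\<^sub>m (B * D)"
proof (rule eq_matI)
  fix i j assume ij: "i < dim_row ((A * C) \<otimes>\<^sub>m (B * D))" "j < dim_col ((A * C) \<otimes>\<^sub>m (B * D))"
  then have i: "i < dim_row A * dim_row B" and j: "j < dim_col C * dim_col D"
    by simp_all
  note div_mod_less_mult[OF i, simp] div_mod_less_mult[OF j, simp]
  have "((A \<otimes>\<^sub>m B) * (C \<otimes>\<^sub>m D)) $$ (i, j) =
      (\<Sum>k<dim_row C * dim_row D. (A $$ (i div dim_row B, k div dim_row D) * B $$ (i mod dim_row B, k mod dim_row D))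
         * (C $$ (k div dim_row D, j div dim_col D) * D $$ (k mod dim_row D, j mod dim_col D)))"
    using i j assms by (simp add: index_mult_mat_sum index_kron del: index_mult_mat(1))
  also have "\<dots> = (\<Sum>k<dim_row C. \<Sum>l<dim_row D. (A $$ (i div dim_row B, k) * B $$ (i mod dim_row B, l))
         * (C $$ (k, j div dim_col D) * D $$ (l, j mod dim_col D)))"
    by (rule sum_lessThan_mult_split)
  also have "\<dots> = (\<Sum>k<dim_row C. A $$ (i div dim_row B, k) * C $$ (k, j div dim_col D))
       * (\<Sum>l<dim_row D. B $$ (i mod dim_row B, l) * D $$ (l, j mod dim_col D))"
    by (simp add: sum_product ac_simps)
  also have "\<dots> = ((A * C) \<otimes>\<^sub>m (B * D)) $$ (i, j)"
    using i j assms by (simp add: index_mult_mat_sum index_kron del: index_mult_mat(1))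
  finally show "((A \<otimes>\<^sub>m B) * (C \<otimes>\<^sub>m D)) $$ (i, j) = ((A * C) \<otimes>\<^sub>m (B * D)) $$ (i, j)" .
qed simp_all

text \<open>Both sides read an index as the same three-digit mixed-radix number, so associativity is
  an equality of matrices and registers can be regrouped freely.\<close>

lemma kron_assoc: "(A \<otimes>\<^sub>m B) \<otimes>\<^sub>m C = A \<otimes>\<^sub>m (B \<otimes>\<^sub>m C)"
proof (rule eq_matI)
  fix i j assume "i < dim_row (A \<otimes>\<^sub>m (B \<otimes>\<^sub>m C))" "j < dim_col (A \<otimes>\<^sub>m (B \<otimes>\<^sub>m C))"
  then have i: "i < dim_row A * dim_row B * dim_row C" "i < dim_row A * (dim_row B * dim_row C)"
    and j: "j < dim_col A * dim_col B * dim_col C" "j < dim_col A * (dim_col B * dim_col C)"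
    by (simp_all add: mult.assoc)
  note [simp] = div_mod_less_mult[OF i(1)] div_mod_less_mult[OF i(2)]
    div_mod_less_mult[OF j(1)] div_mod_less_mult[OF j(2)]
  have *: "k div c div b = k div (b * c)" "k mod (b * c) mod c = k mod c"
    "k div c mod b = k mod (b * c) div c" for k b c :: nat
    by (simp_all add: div_mult2_eq mult.commute[of b c] mod_mult2_eq)
      (cases "c = 0"; simp)
  show "((A \<otimes>\<^sub>m B) \<otimes>\<^sub>m C) $$ (i, j) = (A \<otimes>\<^sub>m (B \<otimes>\<^sub>m C)) $$ (i, j)"
    using i j by (simp add: index_kron *)
qed simp_all

lemma kron_add_left:
  assumes "dim_row A = dim_row B" "dim_col A = dim_col B"
  shows "(A + B) \<otimes>\<^sub>m C = A \<otimes>\<^sub>m C + B \<otimes>\<^sub>m C"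
  by (rule eq_matI) (auto simp: assms index_kron div_mod_less_mult algebra_simps)

lemma kron_add_right:
  assumes "dim_row B = dim_row C" "dim_col B = dim_col C"
  shows "A \<otimes>\<^sub>m (B + C) = A \<otimes>\<^sub>m B + A \<otimes>\<^sub>m C"
  by (rule eq_matI) (auto simp: assms index_kron div_mod_less_mult algebra_simps)

lemma kron_smult_left: "(c \<cdot>\<^sub>m A) \<otimes>\<^sub>m B = c \<cdot>\<^sub>m (A \<otimes>\<^sub>m B)"
  by (rule eq_matI) (auto simp: index_kron div_mod_less_mult)

lemma kron_smult_right: "A \<otimes>\<^sub>m (c \<cdot>\<^sub>m B) = c \<cdot>\<^sub>m (A \<otimes>\<^sub>m B)"
  by (rule eq_matI) (auto simp: index_kron div_mod_less_mult)

lemma kron_zero_left: "0\<^sub>m r c \<otimes>\<^sub>m B = 0\<^sub>m (r * dim_row B) (c * dim_col B)"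
  by (rule eq_matI) (auto simp: index_kron div_mod_less_mult)

lemma kron_one: "1\<^sub>m m \<otimes>\<^sub>m 1\<^sub>m n = 1\<^sub>m (m * n)"
proof (rule eq_matI)
  fix i j assume "i < dim_row (1\<^sub>m (m * n))" "j < dim_col (1\<^sub>m (m * n))"
  then have ij: "i < m * n" "j < m * n" by simp_all
  have "i = j \<longleftrightarrow> i div n = j div n \<and> i mod n = j mod n"
    by (metis div_mult_mod_eq)
  with ij show "(1\<^sub>m m \<otimes>\<^sub>m 1\<^sub>m n) $$ (i, j) = 1\<^sub>m (m * n) $$ (i, j)"
    by (auto simp: index_kron div_mod_less_mult)
qed simp_all

lemma one_kron [simp]: "1\<^sub>m (Suc 0) \<otimes>\<^sub>m A = A"
  by (rule eq_matI) (auto simp: index_kron)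

lemma dim_adjoint [simp]: "dim_row (mat_adjoint A) = dim_col A" "dim_col (mat_adjoint A) = dim_row A"
  by (auto simp: mat_adjoint_def)

lemma adjoint_carrier [simp]: "A \<in> carrier_mat r c \<Longrightarrow> mat_adjoint A \<in> carrier_mat c r"
  by (intro carrier_matI) auto

lemma index_adjoint [simp]:
  fixes A :: "complex mat"
  shows "i < dim_col A \<Longrightarrow> j < dim_row A \<Longrightarrow> mat_adjoint A $$ (i, j) = cnj (A $$ (j, i))"
  by (simp add: mat_adjoint_def mat_of_rows_def)

lemma adjoint_kron: "mat_adjoint (A \<otimes>\<^sub>m B) = mat_adjoint A \<otimes>\<^sub>m mat_adjoint B"
  by (rule eq_matI) (auto simp: index_kron div_mod_less_mult)

lemma adjoint_mult:
  fixes A B :: "complex mat"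
  assumes "dim_col A = dim_row B"
  shows "mat_adjoint (A * B) = mat_adjoint B * mat_adjoint A"
  by (rule eq_matI) (use assms in \<open>auto simp: index_mult_mat_sum mult.commute simp del: index_mult_mat(1)\<close>)

lemma adjoint_add:
  fixes A B :: "complex mat"
  assumes "dim_row A = dim_row B" "dim_col A = dim_col B"
  shows "mat_adjoint (A + B) = mat_adjoint A + mat_adjoint B"
  by (rule eq_matI) (use assms in auto)

lemma adjoint_adjoint [simp]: "mat_adjoint (mat_adjoint A) = (A :: complex mat)"
  by (rule eq_matI) auto

lemma adjoint_one [simp]: "mat_adjoint (1\<^sub>m n :: complex mat) = 1\<^sub>m n"
  by (rule eq_matI) auto

section \<open>Unitary matrices and diagonal projections\<close>

lemma unitary_matD:
  assumes "unitary_mat n U"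
  shows "U \<in> carrier_mat n n" "dim_row U = n" "dim_col U = n"
    "mat_adjoint U * U = 1\<^sub>m n" "U * mat_adjoint U = 1\<^sub>m n"
  using assms by (auto simp: unitary_mat_def)

lemma unitary_adjoint: "unitary_mat n U \<Longrightarrow> unitary_mat n (mat_adjoint U)"
  by (auto simp: unitary_mat_def)

lemma unitary_one [simp]: "unitary_mat n (1\<^sub>m n)"
  by (simp add: unitary_mat_def)

lemma unitary_mult:
  assumes U: "unitary_mat n U" and V: "unitary_mat n V"
  shows "unitary_mat n (U * V)"
proof -
  note [simp] = unitary_matD[OF U] unitary_matD[OF V]
  have "mat_adjoint U * (U * V) = V" "V * (mat_adjoint V * mat_adjoint U) = mat_adjoint U"
    by (simp_all add: mult_mat_assoc[symmetric])
  then show ?thesis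
    by (auto intro!: carrier_matI simp: unitary_mat_def adjoint_mult mult_mat_assoc)
qed

lemma unitary_kron:
  assumes U: "unitary_mat m U" and V: "unitary_mat n V"
  shows "unitary_mat (m * n) (U \<otimes>\<^sub>m V)"
  using assms by (auto simp: unitary_mat_def adjoint_kron kron_mult kron_one)

lemma basis_proj_carrier [simp]: "basis_proj m A \<in> carrier_mat m m"
  by (simp add: basis_proj_def)

lemma dim_basis_proj [simp]: "dim_row (basis_proj m A) = m" "dim_col (basis_proj m A) = m"
  by (simp_all add: basis_proj_def mat_diag_def)

lemma adjoint_basis_proj [simp]: "mat_adjoint (basis_proj m A) = basis_proj m A"
  by (rule eq_matI) (auto simp: basis_proj_def mat_diag_def)

lemma basis_proj_mult: "basis_proj m A * basis_proj m B = basis_proj m (A \<inter> B)"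
  by (auto simp: basis_proj_def intro!: arg_cong[of _ _ "mat_diag m"])

lemma basis_proj_empty [simp]: "basis_proj m {} = 0\<^sub>m m m"
  by (rule eq_matI) (auto simp: basis_proj_def mat_diag_def)

lemma basis_proj_UNIV [simp]: "basis_proj m UNIV = 1\<^sub>m m"
  by (simp add: basis_proj_def)

lemma basis_proj_add: "A \<inter> B = {} \<Longrightarrow> basis_proj m A + basis_proj m B = basis_proj m (A \<union> B)"
  by (rule eq_matI) (auto simp: basis_proj_def mat_diag_def)

text \<open>The cross terms contain products of complementary projections and vanish, so operators
  controlled on the same set multiply branch by branch.\<close>

lemma two_projections_mult:
  assumes "A \<in> carrier_mat n n" "A' \<in> carrier_mat n n" "B \<in> carrier_mat n n" "B' \<in> carrier_mat n n"
  shows "(basis_proj m P \<otimes>\<^sub>m A + basis_proj m (- P) \<otimes>\<^sub>m B) * (basis_proj m P \<otimes>\<^sub>m A' + basis_proj m (- P) \<otimes>\<^sub>m B')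
    = basis_proj m P \<otimes>\<^sub>m (A * A') + basis_proj m (- P) \<otimes>\<^sub>m (B * B')"
proof -
  let ?p = "basis_proj m P" and ?q = "basis_proj m (- P)"
  have c: "X \<otimes>\<^sub>m Y \<in> carrier_mat (m * n) (m * n)" if "X \<in> carrier_mat m m" "Y \<in> carrier_mat n n" for X Y
    using that by simp
  have "(?p \<otimes>\<^sub>m A + ?q \<otimes>\<^sub>m B) * (?p \<otimes>\<^sub>m A' + ?q \<otimes>\<^sub>m B') =
    (?p \<otimes>\<^sub>m A) * (?p \<otimes>\<^sub>m A') + (?q \<otimes>\<^sub>m B) * (?p \<otimes>\<^sub>m A') + ((?p \<otimes>\<^sub>m A) * (?q \<otimes>\<^sub>m B') + (?q \<otimes>\<^sub>m B) * (?q \<otimes>\<^sub>m B'))"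
    using assms by (simp add: add_mat_distrib mult_mat_distrib)
  also have "\<dots> = ?p \<otimes>\<^sub>m (A * A') + 0\<^sub>m (m * n) (m * n) + (0\<^sub>m (m * n) (m * n) + ?q \<otimes>\<^sub>m (B * B'))"
    using assms by (auto simp: kron_mult basis_proj_mult kron_zero_left)
  finally show ?thesis
    using assms by simp
qed

lemma unitary_two_projections:
  assumes U: "unitary_mat n U" and V: "unitary_mat n V"
  shows "unitary_mat (m * n) (basis_proj m P \<otimes>\<^sub>m U + basis_proj m (- P) \<otimes>\<^sub>m V)"
proof -
  note [simp] = unitary_matD[OF U] unitary_matD[OF V]
  have "basis_proj m P \<otimes>\<^sub>m 1\<^sub>m n + basis_proj m (- P) \<otimes>\<^sub>m 1\<^sub>m n = 1\<^sub>m (m * n)"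
    by (simp add: kron_add_left[symmetric] basis_proj_add kron_one)
  then show ?thesis
    using two_projections_mult[of U n "mat_adjoint U" V "mat_adjoint V" m P]
      two_projections_mult[of "mat_adjoint U" n U "mat_adjoint V" V m P]
    by (simp add: unitary_mat_def adjoint_add adjoint_kron)
qed

section \<open>Polynomials of matrices\<close>

lemma dim_poly_mat [simp]: "dim_row (poly_mat p A) = dim_row A" "dim_col (poly_mat p A) = dim_row A"
  by (simp_all add: poly_mat_def)

lemma index_poly_mat:
  assumes "i < dim_row A" "j < dim_row A" "degree p \<le> m"
  shows "poly_mat p A $$ (i, j) = (\<Sum>k\<le>m. complex_of_real (coeff p k) * (A ^\<^sub>m k) $$ (i, j))"
proof -
  have "(\<Sum>k\<le>m. complex_of_real (coeff p k) * (A ^\<^sub>m k) $$ (i, j)) =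
    (\<Sum>k\<le>degree p. complex_of_real (coeff p k) * (A ^\<^sub>m k) $$ (i, j))"
    using assms(3) by (intro sum.mono_neutral_right) (auto simp: coeff_eq_0)
  then show ?thesis
    using assms by (simp add: poly_mat_def)
qed

lemma poly_mat_add:
  assumes "A \<in> carrier_mat n n"
  shows "poly_mat (p + q) A = poly_mat p A + poly_mat q A"
proof (rule eq_matI)
  fix i j assume "i < dim_row (poly_mat p A + poly_mat q A)" "j < dim_col (poly_mat p A + poly_mat q A)"
  then have ij: "i < dim_row A" "j < dim_row A" by simp_all
  show "poly_mat (p + q) A $$ (i, j) = (poly_mat p A + poly_mat q A) $$ (i, j)"
    using ij index_poly_mat[OF ij, of _ "max (degree p) (degree q)"]
    by (simp add: degree_add_le_max distrib_right sum.distrib)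
qed auto

lemma poly_mat_smult: "poly_mat (smult c p) A = complex_of_real c \<cdot>\<^sub>m poly_mat p A"
proof (rule eq_matI)
  fix i j assume "i < dim_row (complex_of_real c \<cdot>\<^sub>m poly_mat p A)" "j < dim_col (complex_of_real c \<cdot>\<^sub>m poly_mat p A)"
  then have ij: "i < dim_row A" "j < dim_row A" by simp_all
  show "poly_mat (smult c p) A $$ (i, j) = (complex_of_real c \<cdot>\<^sub>m poly_mat p A) $$ (i, j)"
    using ij index_poly_mat[OF ij, of _ "degree p"]
    by (simp add: degree_smult_le sum_distrib_left mult.assoc)
qed auto

lemma poly_mat_diff:
  assumes "A \<in> carrier_mat n n"
  shows "poly_mat (p - q) A = poly_mat p A - poly_mat q A"
proof -
  have "poly_mat (p + smult (-1) q) A = poly_mat p A - poly_mat q A"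
    unfolding poly_mat_add[OF assms] poly_mat_smult
    by (rule eq_matI) auto
  then show ?thesis by simp
qed

lemma poly_mat_zero [simp]: "poly_mat 0 A = 0\<^sub>m (dim_row A) (dim_row A)"
  by (rule eq_matI) (auto simp: poly_mat_def)

lemma poly_mat_one [simp]: "poly_mat 1 A = 1\<^sub>m (dim_row A)"
  by (rule eq_matI) (auto simp: poly_mat_def)

lemma pow_mat_Suc_left:
  assumes "A \<in> carrier_mat n n"
  shows "A ^\<^sub>m Suc k = A * A ^\<^sub>m k"
proof (induction k)
  case 0
  then show ?case using assms by auto
next
  case (Suc k)
  have "A ^\<^sub>m Suc (Suc k) = A * A ^\<^sub>m k * A"
    using Suc by simp
  also have "\<dots> = A * A ^\<^sub>m Suc k"
    using assms by (subst mult_mat_assoc) auto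
  finally show ?case .
qed

lemma poly_mat_pCons_0:
  assumes A: "A \<in> carrier_mat n n"
  shows "poly_mat (pCons 0 p) A = A * poly_mat p A"
proof (rule eq_matI)
  fix i j assume "i < dim_row (A * poly_mat p A)" "j < dim_col (A * poly_mat p A)"
  then have ij: "i < dim_row A" "j < dim_row A" by simp_all
  have n: "dim_row A = n" "dim_col A = n" using A by auto
  have "poly_mat (pCons 0 p) A $$ (i, j) =
      (\<Sum>k\<le>Suc (degree p). complex_of_real (coeff (pCons 0 p) k) * (A ^\<^sub>m k) $$ (i, j))"
    using ij by (intro index_poly_mat) (auto simp: degree_pCons_le)
  also have "\<dots> = (\<Sum>k\<le>degree p. complex_of_real (coeff p k) * (A * A ^\<^sub>m k) $$ (i, j))"
    by (subst sum.atMost_Suc_shift) (simp add: pow_mat_Suc_left[OF A, symmetric])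
  also have "\<dots> = (\<Sum>k\<le>degree p. \<Sum>l<n. A $$ (i, l) * (complex_of_real (coeff p k) * (A ^\<^sub>m k) $$ (l, j)))"
    using ij n by (intro sum.cong refl, subst index_mult_mat_sum)
      (auto simp: sum_distrib_left intro!: sum.cong)
  also have "\<dots> = (\<Sum>l<n. A $$ (i, l) * (\<Sum>k\<le>degree p. complex_of_real (coeff p k) * (A ^\<^sub>m k) $$ (l, j)))"
    by (subst sum.swap) (simp add: sum_distrib_left)
  also have "\<dots> = (\<Sum>l<n. A $$ (i, l) * poly_mat p A $$ (l, j))"
    using ij n by (intro sum.cong refl) (simp add: index_poly_mat[of _ _ _ _ "degree p"])
  also have "\<dots> = (A * poly_mat p A) $$ (i, j)"
    using ij n by (simp add: index_mult_mat_sum del: index_mult_mat(1))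
  finally show "poly_mat (pCons 0 p) A $$ (i, j) = (A * poly_mat p A) $$ (i, j)" .
qed (use A in auto)

section \<open>Alternating query circuits\<close>

lemma dim_ket0 [simp]: "dim_row (ket0 k) = 2 ^ k" "dim_col (ket0 k) = 1"
  by (simp_all add: ket0_def)

lemma ket0_orthonormal [simp]: "mat_adjoint (ket0 k) * ket0 k = 1\<^sub>m 1"
proof (rule eq_matI)
  fix i j assume "i < dim_row (1\<^sub>m 1 :: complex mat)" "j < dim_col (1\<^sub>m 1 :: complex mat)"
  moreover have "(\<Sum>l<2 ^ k. cnj (if l = (0::nat) then 1 else 0) * (if l = 0 then 1 else 0)) = (1 :: complex)"
    by (subst sum.remove[of _ 0]) (auto intro!: sum.neutral)
  ultimately show "(mat_adjoint (ket0 k) * ket0 k) $$ (i, j) = 1\<^sub>m 1 $$ (i, j)"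
    by (simp add: index_mult_mat_sum ket0_def del: index_mult_mat(1))
qed simp_all

lemma ket0_projection: "ket0 k * mat_adjoint (ket0 k) = basis_proj (2 ^ k) {0}"
  by (rule eq_matI) (auto simp: index_mult_mat_sum ket0_def basis_proj_def mat_diag_def simp del: index_mult_mat(1))

lemma ket0_add: "ket0 (a + b) = ket0 a \<otimes>\<^sub>m ket0 b"
proof (rule eq_matI)
  fix i j assume ij: "i < dim_row (ket0 a \<otimes>\<^sub>m ket0 b)" "j < dim_col (ket0 a \<otimes>\<^sub>m ket0 b)"
  have "i = 0 \<longleftrightarrow> i div 2 ^ b = 0 \<and> i mod 2 ^ b = 0"
    by (metis div_mult_mod_eq div_0 mod_0 add_0 mult_0)
  with ij show "ket0 (a + b) $$ (i, j) = (ket0 a \<otimes>\<^sub>m ket0 b) $$ (i, j)"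
    by (auto simp: index_kron ket0_def power_add less_mult_imp_div_less)
qed (simp_all add: power_add)

definition ket_block :: "nat \<Rightarrow> nat \<Rightarrow> complex mat" where
  "ket_block b n = ket0 b \<otimes>\<^sub>m 1\<^sub>m n"

lemma dim_ket_block [simp]: "dim_row (ket_block b n) = 2 ^ b * n" "dim_col (ket_block b n) = n"
  by (simp_all add: ket_block_def)

lemma ket_block_orthonormal [simp]: "mat_adjoint (ket_block b n) * ket_block b n = 1\<^sub>m n"
  by (simp add: ket_block_def adjoint_kron kron_mult)

lemma ket_block_add: "ket_block (a + b) n = ket0 a \<otimes>\<^sub>m ket_block b n"
  by (simp add: ket_block_def ket0_add kron_assoc)

lemma block_eq: "block b n U = mat_adjoint (ket_block b n) * U * ket_block b n"
  by (simp add: block_def ket_block_def adjoint_kron)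

text \<open>With \<open>W\<close> the unitary of the next or the previous query, \<open>K = ket_block b n\<close> and
  \<open>L = W K - K S\<close>, the columns of \<open>L\<close> are orthogonal to those of \<open>K\<close>. Between two queries, the two
  halves of the first block column are of the form \<open>K p(S) + L q(S)\<close>.\<close>

definition walk_block :: "nat \<Rightarrow> nat \<Rightarrow> complex mat \<Rightarrow> complex mat \<Rightarrow> real poly \<Rightarrow> real poly \<Rightarrow> complex mat" where
  "walk_block b n W S p q =
     ket_block b n * poly_mat p S + (W * ket_block b n - ket_block b n * S) * poly_mat q S"

lemma zero_add_mat:
  fixes A :: "'a::monoid_add mat"
  shows "dim_row A = r \<Longrightarrow> dim_col A = c \<Longrightarrow> 0\<^sub>m r c + A = A"
  by (intro eq_matI) auto

lemma add_zero_mat: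
  fixes A :: "'a::monoid_add mat"
  shows "dim_row A = r \<Longrightarrow> dim_col A = c \<Longrightarrow> A + 0\<^sub>m r c = A"
  by (intro eq_matI) auto

lemma minus_mat_distrib:
  fixes A B C :: "'a::ring mat"
  assumes "dim_row A = dim_row B" "dim_col A = dim_col B" "dim_col A = dim_row C"
  shows "(A - B) * C = A * C - B * C"
  using assms by (intro minus_mult_distrib_mat[of A "dim_row A" "dim_col A" B C "dim_col C"]) auto

lemma mult_mat_minus_distrib:
  fixes A B C :: "'a::ring mat"
  assumes "dim_row B = dim_row C" "dim_col B = dim_col C" "dim_col A = dim_row B"
  shows "A * (B - C) = A * B - A * C"
  using assms by (intro mult_minus_distrib_mat[of A "dim_row A" "dim_col A" B "dim_col B" C]) auto

lemma dim_walk_block [simp]: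
  "S \<in> carrier_mat n n \<Longrightarrow> dim_row (walk_block b n W S p q) = 2 ^ b * n"
  "S \<in> carrier_mat n n \<Longrightarrow> dim_col (walk_block b n W S p q) = n"
  by (simp_all add: walk_block_def)

text \<open>Write \<open>L'\<close> for the block of \<open>mat_adjoint W\<close>. Then W L' = K - W
  K S and W K = L + K S; it remains to collect the terms in \<open>K\<close> and in
  \<open>L\<close>. A query by \<open>W\<close> thus trades the complement belonging to the adjoint
  of \<open>W\<close> for its own, which is why queries to \<open>U\<close> and to its adjoint
  alternate.\<close>

lemma walk_block_query:
  assumes S: "S \<in> carrier_mat n n" and W: "unitary_mat (2 ^ b * n) W"
  shows "W * walk_block b n (mat_adjoint W) S p q =
    walk_block b n W S (pCons 0 p + q - pCons 0 (pCons 0 q)) (p - pCons 0 q)"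
proof -
  note [simp] = unitary_matD(2,3)[OF W]
  have dS [simp]: "dim_row S = n" "dim_col S = n" using S by auto
  define K where "K = ket_block b n"
  define T where "T = W * K"
  define P where "P = poly_mat p S"
  define Q where "Q = poly_mat q S"
  have [simp]: "dim_row K = 2 ^ b * n" "dim_col K = n" "dim_row T = 2 ^ b * n" "dim_col T = n"
    "dim_row P = n" "dim_col P = n" "dim_row Q = n" "dim_col Q = n"
    by (simp_all add: K_def T_def P_def Q_def)
  have WW: "W * (mat_adjoint W * X) = X" if "dim_row X = 2 ^ b * n" for X
    using that unitary_matD(5)[OF W] by (simp add: mult_mat_assoc[symmetric])
  have WK: "W * (K * X) = T * X" if "dim_row X = n" for X
    using that by (simp add: T_def mult_mat_assoc)
  have "W * (K * P + (mat_adjoint W * K - K * S) * Q) =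
      K * (S * P + Q - S * (S * Q)) + (T - K * S) * (P - S * Q)"
    by (simp add: mult_mat_distrib mult_mat_minus_distrib minus_mat_distrib mult_mat_assoc WW WK)
      (rule eq_matI; simp del: index_mult_mat(1))
  then show ?thesis
    unfolding walk_block_def poly_mat_diff[OF S] poly_mat_add[OF S] poly_mat_pCons_0[OF S]
    unfolding P_def[symmetric] Q_def[symmetric] K_def[symmetric] T_def[symmetric] .
qed

section \<open>The work qubit and rotations conditioned on the block register\<close>

definition ket :: "nat \<Rightarrow> complex mat" where
  "ket i = mat 2 1 (\<lambda>(r, c). if r = i then 1 else 0)"

definition stack :: "complex mat \<Rightarrow> complex mat \<Rightarrow> complex mat" where
  "stack X Y = ket 0 \<otimes>\<^sub>m X + ket 1 \<otimes>\<^sub>m Y"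

definition rot :: "real \<Rightarrow> real \<Rightarrow> complex mat" where
  "rot c s = mat 2 2 (\<lambda>(i, j). if i = j then complex_of_real c else if i = 0 then complex_of_real (- s) else complex_of_real s)"

lemma dim_ket [simp]: "dim_row (ket i) = 2" "dim_col (ket i) = 1"
  by (simp_all add: ket_def)

lemma dim_rot [simp]: "dim_row (rot c s) = 2" "dim_col (rot c s) = 2"
  by (simp_all add: rot_def)

lemma dim_stack [simp]: "dim_row (stack X Y) = 2 * dim_row Y" "dim_col (stack X Y) = dim_col Y"
  by (simp_all add: stack_def)

lemma one_kron_stack:
  assumes "dim_row X = dim_col W" "dim_row Y = dim_col W" "dim_col X = dim_col Y"
  shows "(1\<^sub>m 2 \<otimes>\<^sub>m W) * stack X Y = stack (W * X) (W * Y)"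
  using assms by (simp add: stack_def mult_mat_distrib kron_mult left_mult_one_mat')

lemma rot_ket:
  "rot c s * ket 0 = complex_of_real c \<cdot>\<^sub>m ket 0 + complex_of_real s \<cdot>\<^sub>m ket 1"
  "rot c s * ket 1 = complex_of_real (- s) \<cdot>\<^sub>m ket 0 + complex_of_real c \<cdot>\<^sub>m ket 1"
  by (rule eq_matI; auto simp: index_mult_mat_sum rot_def ket_def numeral_2_eq_2 simp del: index_mult_mat(1))+

lemma rot_kron_stack:
  assumes "dim_row X = dim_col W" "dim_row Y = dim_col W" "dim_col X = dim_col Y"
  shows "(rot c s \<otimes>\<^sub>m W) * stack X Y =
    stack (complex_of_real c \<cdot>\<^sub>m (W * X) + complex_of_real (- s) \<cdot>\<^sub>m (W * Y))
      (complex_of_real s \<cdot>\<^sub>m (W * X) + complex_of_real c \<cdot>\<^sub>m (W * Y))"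
  using assms
  by (simp add: stack_def mult_mat_distrib kron_mult rot_ket kron_add_left kron_add_right kron_smult_left kron_smult_right
      del: One_nat_def) (rule eq_matI; simp add: algebra_simps del: One_nat_def index_mult_mat(1))

lemma rot_unitary:
  assumes "c\<^sup>2 + s\<^sup>2 = 1"
  shows "unitary_mat 2 (rot c s)"
proof -
  have "complex_of_real c * complex_of_real c + complex_of_real s * complex_of_real s = 1"
    using assms by (metis of_real_1 of_real_add of_real_mult power2_eq_square)
  note cs = this this[unfolded add.commute[of "complex_of_real c * _"]]
  have "mat_adjoint (rot c s) * rot c s = 1\<^sub>m 2"
    by (rule eq_matI) (auto simp: index_mult_mat_sum rot_def numeral_2_eq_2 less_Suc_eq cs simp del: index_mult_mat(1))
  moreover have "rot c s * mat_adjoint (rot c s) = 1\<^sub>m 2"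
    by (rule eq_matI) (auto simp: index_mult_mat_sum rot_def numeral_2_eq_2 less_Suc_eq cs simp del: index_mult_mat(1))
  ultimately show ?thesis
    unfolding unitary_mat_def by (intro conjI carrier_matI) simp_all
qed

text \<open>The work qubit is rotated by \<open>A\<close> on the designated subspace, which carries
  the \<open>P\<close> part, and by \<open>B\<close> on its complement, which carries the
  \<open>Q\<close> part. Only the block register decides, so the gate is local and independent of
  the oracle.\<close>

definition rot_gate :: "nat \<Rightarrow> complex mat \<Rightarrow> complex mat \<Rightarrow> complex mat" where
  "rot_gate b A B = A \<otimes>\<^sub>m basis_proj (2 ^ b) {0} + B \<otimes>\<^sub>m basis_proj (2 ^ b) (- {0})"

lemma rot_gate_unitary:
  assumes A: "unitary_mat 2 A" and B: "unitary_mat 2 B"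
  shows "unitary_mat (2 ^ (1 + b)) (rot_gate b A B)"
proof -
  note [simp] = unitary_matD(2-)[OF A] unitary_matD(2-)[OF B]
  let ?p = "basis_proj (2 ^ b) {0}" and ?q = "basis_proj (2 ^ b) (- {0})"
  have one: "1\<^sub>m 2 \<otimes>\<^sub>m ?p + 1\<^sub>m 2 \<otimes>\<^sub>m ?q = 1\<^sub>m (2 * 2 ^ b)"
    by (simp add: kron_add_right[symmetric] basis_proj_add kron_one)
  have zero: "X \<otimes>\<^sub>m 0\<^sub>m (2 ^ b) (2 ^ b) = 0\<^sub>m (2 * 2 ^ b) (2 * 2 ^ b)" if "X \<in> carrier_mat 2 2" for X
    using that by (intro eq_matI) (auto simp: index_kron div_mod_less_mult)
  have mult: "(X \<otimes>\<^sub>m ?p + Y \<otimes>\<^sub>m ?q) * (X' \<otimes>\<^sub>m ?p + Y' \<otimes>\<^sub>m ?q) = (X * X') \<otimes>\<^sub>m ?p + (Y * Y') \<otimes>\<^sub>m ?q"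
    if [simp]: "dim_row X = 2" "dim_col X = 2" "dim_row Y = 2" "dim_col Y = 2"
       "dim_row X' = 2" "dim_col X' = 2" "dim_row Y' = 2" "dim_col Y' = 2" for X Y X' Y'
  proof -
    have z: "(X * Y') \<otimes>\<^sub>m 0\<^sub>m (2 ^ b) (2 ^ b) = 0\<^sub>m (2 * 2 ^ b) (2 * 2 ^ b)"
      "(Y * X') \<otimes>\<^sub>m 0\<^sub>m (2 ^ b) (2 ^ b) = 0\<^sub>m (2 * 2 ^ b) (2 * 2 ^ b)"
      by (intro zero carrier_matI; simp)+
    show ?thesis
      by (simp add: mult_mat_distrib add_mat_distrib kron_mult basis_proj_mult z zero_add_mat add_zero_mat)
  qed
  show ?thesis
    unfolding unitary_mat_def rot_gate_def
    by (intro conjI carrier_matI) (simp_all add: adjoint_add adjoint_kron mult one)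
qed

text \<open>The adjoint of \<open>K\<close> sends \<open>L\<close> to
  \<open>block b n W - S\<close>, which is zero. Hence the projection
  \<open>K * mat_adjoint K\<close> isolates the \<open>K\<close> part, and its complement the
  \<open>L\<close> part.\<close>

lemma walk_block_projections:
  assumes S: "S \<in> carrier_mat n n" and W: "unitary_mat (2 ^ b * n) W" and block: "block b n W = S"
  defines "P \<equiv> basis_proj (2 ^ b) {0} \<otimes>\<^sub>m 1\<^sub>m n" and "Q \<equiv> basis_proj (2 ^ b) (- {0}) \<otimes>\<^sub>m 1\<^sub>m n"
  shows "mat_adjoint (ket_block b n) * walk_block b n W S p q = poly_mat p S"
    and "P * walk_block b n W S p q = walk_block b n W S p 0"
    and "Q * walk_block b n W S p q = walk_block b n W S 0 q"
proof -
  note [simp] = unitary_matD(2,3)[OF W]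
  have dS [simp]: "dim_row S = n" "dim_col S = n" using S by auto
  define K where "K = ket_block b n"
  define L where "L = W * K - K * S"
  have [simp]: "dim_row K = 2 ^ b * n" "dim_col K = n" "dim_row L = 2 ^ b * n" "dim_col L = n"
    by (simp_all add: K_def L_def)
  have w: "walk_block b n W S p q = K * poly_mat p S + L * poly_mat q S" for p q
    by (simp add: walk_block_def K_def L_def)
  have KK: "mat_adjoint K * K = 1\<^sub>m n" by (simp add: K_def)
  have "mat_adjoint K * L = mat_adjoint K * W * K - mat_adjoint K * K * S"
    by (simp add: L_def mult_mat_minus_distrib mult_mat_assoc)
  also have "\<dots> = S - S"
    using block by (simp add: block_eq KK flip: K_def) 
  finally have KL: "mat_adjoint K * L = 0\<^sub>m n n"
    using S by (simp add: minus_r_inv_mat[of _ n n])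
  show adj: "mat_adjoint (ket_block b n) * walk_block b n W S p q = poly_mat p S" for p q
    by (simp add: w mult_mat_distrib KK KL mult_mat_assoc[symmetric] add_zero_mat flip: K_def)
  have P: "P = K * mat_adjoint K"
    by (simp add: P_def K_def ket_block_def adjoint_kron kron_mult ket0_projection)
  show Pw: "P * walk_block b n W S p q = walk_block b n W S p 0"
    using adj[of p q] by (simp add: P mult_mat_assoc w add_zero_mat flip: K_def)
  have PQ: "P + Q = 1\<^sub>m (2 ^ b * n)"
    by (simp add: P_def Q_def kron_add_left[symmetric] basis_proj_add kron_one)
  have "Q * X = X - P * X" if "dim_row X = 2 ^ b * n" for X
  proof -
    have "P * X + Q * X = (P + Q) * X"
      using that by (subst add_mat_distrib) (simp_all add: P_def Q_def)
    then have "P * X + Q * X = X"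
      using that PQ by simp
    moreover have "Q * X = (P * X + Q * X) - P * X"
      by (rule eq_matI) (simp_all add: P_def Q_def del: index_mult_mat(1))
    ultimately show ?thesis by simp
  qed
  then have "Q * walk_block b n W S p q = walk_block b n W S p q - walk_block b n W S p 0"
    using Pw S by simp
  then show "Q * walk_block b n W S p q = walk_block b n W S 0 q"
    by (intro eq_matI) (simp_all add: w add_zero_mat zero_add_mat del: index_mult_mat(1))
qed

lemma walk_block_linear:
  assumes S: "S \<in> carrier_mat n n" and "dim_row W = 2 ^ b * n" "dim_col W = 2 ^ b * n"
  shows "complex_of_real c \<cdot>\<^sub>m walk_block b n W S p 0 + complex_of_real s \<cdot>\<^sub>m walk_block b n W S p' 0 +
      (complex_of_real c' \<cdot>\<^sub>m walk_block b n W S 0 q + complex_of_real s' \<cdot>\<^sub>m walk_block b n W S 0 q') =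
    walk_block b n W S (smult c p + smult s p') (smult c' q + smult s' q')"
proof -
  have dS [simp]: "dim_row S = n" "dim_col S = n" using S by auto
  have smult: "A * (x \<cdot>\<^sub>m B) = x \<cdot>\<^sub>m (A * B)" if "dim_col A = dim_row B" for A B :: "complex mat" and x
    using that by (intro mult_smult_distrib[of A "dim_row A" "dim_col A" B "dim_col B"]) auto
  show ?thesis
    unfolding walk_block_def poly_mat_add[OF S] poly_mat_smult
    using assms(2,3)
    by (intro eq_matI) (simp_all add: mult_mat_distrib smult zero_add_mat add_zero_mat algebra_simps del: index_mult_mat(1))
qed

lemma walk_stack_query:
  assumes "S \<in> carrier_mat n n" "unitary_mat (2 ^ b * n) W"
  shows "(1\<^sub>m 2 \<otimes>\<^sub>m W) * stack (walk_block b n (mat_adjoint W) S p q) (walk_block b n (mat_adjoint W) S p' q') =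
    stack (walk_block b n W S (pCons 0 p + q - pCons 0 (pCons 0 q)) (p - pCons 0 q))
      (walk_block b n W S (pCons 0 p' + q' - pCons 0 (pCons 0 q')) (p' - pCons 0 q'))"
  using assms unitary_matD[OF assms(2)] by (subst one_kron_stack) (simp_all add: walk_block_query)

text \<open>As \<open>P\<close> and \<open>Q\<close> separate the two parts, the gate turns the pair
  (p, p') by one rotation and the pair (q, q') by another, independently.\<close>

lemma walk_stack_rot:
  assumes S: "S \<in> carrier_mat n n" and W: "unitary_mat (2 ^ b * n) W" and block: "block b n W = S"
  shows "(rot_gate b (rot c s) (rot c' s') \<otimes>\<^sub>m 1\<^sub>m n) * stack (walk_block b n W S p q) (walk_block b n W S p' q') =
    stack (walk_block b n W S (smult c p + smult (- s) p') (smult c' q + smult (- s') q'))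
      (walk_block b n W S (smult s p + smult c p') (smult s' q + smult c' q'))"
proof -
  note [simp] = unitary_matD(2,3)[OF W]
  have dS [simp]: "dim_row S = n" "dim_col S = n" using S by auto
  define P where "P = basis_proj (2 ^ b) {0} \<otimes>\<^sub>m 1\<^sub>m n"
  define Q where "Q = basis_proj (2 ^ b) (- {0}) \<otimes>\<^sub>m 1\<^sub>m n"
  have [simp]: "dim_row P = 2 ^ b * n" "dim_col P = 2 ^ b * n" "dim_row Q = 2 ^ b * n" "dim_col Q = 2 ^ b * n"
    by (simp_all add: P_def Q_def)
  note PQ = walk_block_projections[OF S W block, folded P_def Q_def]
  let ?X = "walk_block b n W S p q" and ?Y = "walk_block b n W S p' q'"
  have add: "stack X Y + stack X' Y' = stack (X + X') (Y + Y')"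
    if "dim_row X = dim_row Y" "dim_row X' = dim_row Y" "dim_row Y' = dim_row Y"
      "dim_col X = dim_col Y" "dim_col X' = dim_col Y" "dim_col Y' = dim_col Y" for X Y X' Y'
    using that by (simp add: stack_def kron_add_right) (rule eq_matI; simp)
  have gate: "rot_gate b (rot c s) (rot c' s') \<otimes>\<^sub>m 1\<^sub>m n = rot c s \<otimes>\<^sub>m P + rot c' s' \<otimes>\<^sub>m Q"
    by (simp add: rot_gate_def kron_add_left kron_assoc P_def Q_def)
  have "(rot_gate b (rot c s) (rot c' s') \<otimes>\<^sub>m 1\<^sub>m n) * stack ?X ?Y =
      (rot c s \<otimes>\<^sub>m P) * stack ?X ?Y + (rot c' s' \<otimes>\<^sub>m Q) * stack ?X ?Y"
    unfolding gate using S by (intro add_mat_distrib) simp_all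
  then show ?thesis
    using S by (simp only: rot_kron_stack PQ add walk_block_linear dim_walk_block \<open>dim_col P = 2 ^ b * n\<close> \<open>dim_col Q = 2 ^ b * n\<close> index_add_mat index_smult_mat unitary_matD(2,3)[OF W])
qed

section \<open>Quantum signal processing by layer stripping\<close>

lemma coeff_square_top:
  fixes p :: "real poly"
  assumes "degree p \<le> m"
  shows "coeff (p\<^sup>2) (2 * m) = (coeff p m)\<^sup>2"
proof -
  have "coeff (p\<^sup>2) (2 * m) = (\<Sum>i\<le>2 * m. coeff p i * coeff p (2 * m - i))"
    by (simp add: power2_eq_square coeff_mult)
  also have "\<dots> = coeff p m * coeff p (2 * m - m) + (\<Sum>i\<in>{..2 * m} - {m}. coeff p i * coeff p (2 * m - i))"
    by (intro sum.remove) auto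
  also have "(\<Sum>i\<in>{..2 * m} - {m}. coeff p i * coeff p (2 * m - i)) = 0"
  proof (intro sum.neutral ballI)
    fix i assume "i \<in> {..2 * m} - {m}"
    then have "m < i \<or> m < 2 * m - i" by auto
    with assms show "coeff p i * coeff p (2 * m - i) = 0"
      by (auto intro: coeff_eq_0)
  qed
  finally show ?thesis by (simp add: power2_eq_square)
qed

text \<open>The image depends on the length alone, so two vectors of equal length are brought to the
  same point. The zero vector is left fixed by the identity rotation.\<close>

lemma normalize_pair:
  fixes a b :: real
  obtains c s where "c\<^sup>2 + s\<^sup>2 = 1" "c * a + s * b = sqrt (a\<^sup>2 + b\<^sup>2)" "c * b - s * a = 0"
proof (cases "a\<^sup>2 + b\<^sup>2 = 0")
  case True
  then show ?thesis using that[of 1 0] by (simp add: sum_power2_eq_zero_iff)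
next
  case False
  define r where "r = sqrt (a\<^sup>2 + b\<^sup>2)"
  have r: "r \<noteq> 0" "r * r = a\<^sup>2 + b\<^sup>2"
    using False by (auto simp: r_def)
  have "(a / r)\<^sup>2 + (b / r)\<^sup>2 = (a\<^sup>2 + b\<^sup>2) / (r * r)"
    by (simp add: power_divide add_divide_distrib power2_eq_square)
  moreover have "a / r * a + b / r * b = (a\<^sup>2 + b\<^sup>2) / r"
    by (simp add: add_divide_distrib power2_eq_square)
  ultimately have "(a / r)\<^sup>2 + (b / r)\<^sup>2 = 1" "a / r * a + b / r * b = r" "a / r * b - b / r * a = 0"
    using r(1) by (simp_all add: r(2)[symmetric])
  then show ?thesis using that r_def by blast
qed

text \<open>With w = sqrt(1 - x^2) and coordinates (p, w q), the query map is the reflection with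
  rows (x, w) and (w, -x), hence orthogonal and its own inverse.\<close>

lemma signal_step_norm:
  fixes x :: "'a::comm_ring_1"
  shows "(x * p + (1 - x * x) * q)\<^sup>2 + (1 - x * x) * (p - x * q)\<^sup>2 = p\<^sup>2 + (1 - x * x) * q\<^sup>2"
  by (simp add: power2_eq_square algebra_simps)

lemma rotation_norm:
  fixes c :: "'a::comm_ring_1"
  assumes "c\<^sup>2 + s\<^sup>2 = 1"
  shows "(c * p + s * q)\<^sup>2 + (c * q - s * p)\<^sup>2 = p\<^sup>2 + q\<^sup>2"
proof -
  have "(c * p + s * q)\<^sup>2 + (c * q - s * p)\<^sup>2 = (c\<^sup>2 + s\<^sup>2) * (p\<^sup>2 + q\<^sup>2)"
    by (simp add: power2_eq_square algebra_simps)
  with assms show ?thesis by simp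
qed

lemma degree_has_parity: "has_parity k p \<Longrightarrow> degree p \<le> k"
  by (intro degree_le) (force simp: has_parity_def)

text \<open>The decomposition is found backwards: undo the two rotations that precede the current
  output, then apply the query map, which is its own inverse. The degree drops because the rotations
  are chosen to align the leading coefficients.\<close>

lemma strip_layer:
  assumes p: "has_parity (Suc k) p1" "has_parity (Suc k) p2"
    and q: "has_parity (Suc k) (pCons 0 q1)" "has_parity (Suc k) (pCons 0 q2)"
    and norm: "p1\<^sup>2 + p2\<^sup>2 + [:1, 0, -1:] * (q1\<^sup>2 + q2\<^sup>2) = 1"
  obtains c s c' s' p1' p2' q1' q2' where
    "c\<^sup>2 + s\<^sup>2 = 1" "c'\<^sup>2 + s'\<^sup>2 = 1"
    "has_parity k p1'" "has_parity k p2'" "has_parity k (pCons 0 q1')" "has_parity k (pCons 0 q2')"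
    "p1'\<^sup>2 + p2'\<^sup>2 + [:1, 0, -1:] * (q1'\<^sup>2 + q2'\<^sup>2) = 1"
    "p1 = smult c (pCons 0 p1' + q1' - pCons 0 (pCons 0 q1')) + smult (- s) (pCons 0 p2' + q2' - pCons 0 (pCons 0 q2'))"
    "p2 = smult s (pCons 0 p1' + q1' - pCons 0 (pCons 0 q1')) + smult c (pCons 0 p2' + q2' - pCons 0 (pCons 0 q2'))"
    "q1 = smult c' (p1' - pCons 0 q1') + smult (- s') (p2' - pCons 0 q2')"
    "q2 = smult s' (p1' - pCons 0 q1') + smult c' (p2' - pCons 0 q2')"
proof -
  \<comment> \<open>Multiplication by the variable and by constants is expressed by ring elements,
    so that the identities below become purely algebraic.\<close>
  define x :: "real poly" where "x = [:0, 1:]"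
  have x: "pCons 0 f = x * f" "[:1, 0, -1:] = 1 - x * x" for f
    by (simp_all add: x_def one_pCons)
  have q': "has_parity k q1" "has_parity k q2"
    using q by (simp_all add: has_parity_pCons)
  \<comment> \<open>The right-hand side of the normalization is constant, so its coefficient of
    degree 2 (k + 1) vanishes. On the left only the leading coefficients of p1, p2, x q1 and x q2
    contribute to it, the latter two with a minus sign.\<close>
  have "coeff (p1\<^sup>2 + p2\<^sup>2 + [:1, 0, -1:] * (q1\<^sup>2 + q2\<^sup>2)) (2 * Suc k) = 0"
    unfolding norm by simp
  moreover have "[:1, 0, -1:] * (q1\<^sup>2 + q2\<^sup>2) = q1\<^sup>2 + q2\<^sup>2 - (pCons 0 q1)\<^sup>2 - (pCons 0 q2)\<^sup>2"
    unfolding x(2) unfolding x(1) by (simp add: power2_eq_square algebra_simps)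
  ultimately have "coeff (p1\<^sup>2 + p2\<^sup>2 + (q1\<^sup>2 + q2\<^sup>2 - (pCons 0 q1)\<^sup>2 - (pCons 0 q2)\<^sup>2)) (2 * Suc k) = 0"
    by (simp only:)
  moreover have "coeff (q1\<^sup>2) (2 * Suc k) = 0" "coeff (q2\<^sup>2) (2 * Suc k) = 0"
    using q'[THEN degree_has_parity] coeff_square_top[of q1 "Suc k"] coeff_square_top[of q2 "Suc k"]
    by (auto simp: coeff_eq_0)
  ultimately have top: "(coeff p1 (Suc k))\<^sup>2 + (coeff p2 (Suc k))\<^sup>2 = (coeff q1 k)\<^sup>2 + (coeff q2 k)\<^sup>2"
    using p[THEN degree_has_parity, THEN coeff_square_top] q[THEN degree_has_parity, THEN coeff_square_top]
    by simp
  obtain c s where cs: "c\<^sup>2 + s\<^sup>2 = 1"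
    and cs1: "c * coeff p1 (Suc k) + s * coeff p2 (Suc k) = sqrt ((coeff p1 (Suc k))\<^sup>2 + (coeff p2 (Suc k))\<^sup>2)"
    and cs2: "c * coeff p2 (Suc k) - s * coeff p1 (Suc k) = 0"
    by (rule normalize_pair)
  obtain c' s' where cs': "c'\<^sup>2 + s'\<^sup>2 = 1"
    and cs1': "c' * coeff q1 k + s' * coeff q2 k = sqrt ((coeff q1 k)\<^sup>2 + (coeff q2 k)\<^sup>2)"
    and cs2': "c' * coeff q2 k - s' * coeff q1 k = 0"
    by (rule normalize_pair)
  define C S C' S' where CS: "C = [:c:]" "S = [:s:]" "C' = [:c':]" "S' = [:s':]"
  have unit: "C\<^sup>2 + S\<^sup>2 = 1" "C'\<^sup>2 + S'\<^sup>2 = 1"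
    using cs cs' by (auto simp: CS power2_eq_square one_pCons)
  have smult: "smult c f = C * f" "smult s f = S * f" "smult (- s) f = - S * f"
    "smult c' f = C' * f" "smult s' f = S' * f" "smult (- s') f = - S' * f" for f
    by (simp_all add: CS)
  define P1 P2 Q1 Q2 where PQ: "P1 = C * p1 + S * p2" "P2 = C * p2 - S * p1"
    "Q1 = C' * q1 + S' * q2" "Q2 = C' * q2 - S' * q1"
  \<comment> \<open>Equal leading coefficients cancel in x (P - x Q) at degree k + 2, and parity
    then skips degree k + 1, leaving degree at most k. The other component is x (P - x Q) +
    Q.\<close>
  have parity_step: "has_parity k (pCons 0 (P - x * Q)) \<and> has_parity k (x * P + (1 - x * x) * Q)"
    if P: "has_parity (Suc k) P" and Q: "has_parity k Q" and eq: "coeff P (Suc k) = coeff Q k" for P Q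
  proof -
    have step: "pCons 0 (P - x * Q) = pCons 0 P - pCons 0 (pCons 0 Q)"
      by (simp add: x_def)
    have "has_parity (Suc (Suc k)) (pCons 0 P - pCons 0 (pCons 0 Q))"
      using P Q by (intro has_parity_diff) (simp_all add: has_parity_pCons)
    then have 1: "has_parity k (pCons 0 (P - x * Q))"
      unfolding step by (rule has_parity_lower) (simp add: eq)
    have "x * P + (1 - x * x) * Q = pCons 0 (P - x * Q) + Q"
      unfolding x by (simp add: algebra_simps)
    with 1 Q show ?thesis
      by (simp add: has_parity_add)
  qed
  have parity: "has_parity (Suc k) P1" "has_parity (Suc k) P2" "has_parity k Q1" "has_parity k Q2"
    unfolding PQ CS using p q' by (auto intro!: has_parity_add has_parity_diff has_parity_smult)
  have coeffs: "coeff P1 (Suc k) = coeff Q1 k" "coeff P2 (Suc k) = coeff Q2 k"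
  proof -
    have "coeff P1 (Suc k) = c * coeff p1 (Suc k) + s * coeff p2 (Suc k)"
      "coeff P2 (Suc k) = c * coeff p2 (Suc k) - s * coeff p1 (Suc k)"
      "coeff Q1 k = c' * coeff q1 k + s' * coeff q2 k" "coeff Q2 k = c' * coeff q2 k - s' * coeff q1 k"
      by (simp_all add: PQ CS)
    then show "coeff P1 (Suc k) = coeff Q1 k" "coeff P2 (Suc k) = coeff Q2 k"
      unfolding cs1 cs2 cs1' cs2' top by simp_all
  qed
  note par = parity_step[OF parity(1,3) coeffs(1)] parity_step[OF parity(2,4) coeffs(2)]
  show ?thesis
  proof (rule that[of c s c' s' "x * P1 + (1 - x * x) * Q1" "x * P2 + (1 - x * x) * Q2" "P1 - x * Q1" "P2 - x * Q2"])
    have "1 = (P1\<^sup>2 + P2\<^sup>2) + (1 - x * x) * (Q1\<^sup>2 + Q2\<^sup>2)"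
      unfolding PQ rotation_norm[OF unit(1)] rotation_norm[OF unit(2)]
      using norm unfolding x(2) by (rule sym)
    also have "\<dots> = (P1\<^sup>2 + (1 - x * x) * Q1\<^sup>2) + (P2\<^sup>2 + (1 - x * x) * Q2\<^sup>2)"
      by (simp add: algebra_simps)
    also have "\<dots> = ((x * P1 + (1 - x * x) * Q1)\<^sup>2 + (1 - x * x) * (P1 - x * Q1)\<^sup>2) +
       ((x * P2 + (1 - x * x) * Q2)\<^sup>2 + (1 - x * x) * (P2 - x * Q2)\<^sup>2)"
      unfolding signal_step_norm ..
    finally show "(x * P1 + (1 - x * x) * Q1)\<^sup>2 + (x * P2 + (1 - x * x) * Q2)\<^sup>2 +
        [:1, 0, -1:] * ((P1 - x * Q1)\<^sup>2 + (P2 - x * Q2)\<^sup>2) = 1"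
      unfolding x(2) distrib_left by (simp only: ac_simps)
  next
    \<comment> \<open>The query map applied twice is the identity.\<close>
    have sig: "x * (x * P + (1 - x * x) * Q) + (P - x * Q) - x * (x * (P - x * Q)) = P"
      "(x * P + (1 - x * x) * Q) - x * (P - x * Q) = Q" for P Q
      by (simp_all add: algebra_simps)
    have unrot: "C * (C * f + S * g) + - S * (C * g - S * f) = (C\<^sup>2 + S\<^sup>2) * f"
      "S * (C * f + S * g) + C * (C * g - S * f) = (C\<^sup>2 + S\<^sup>2) * g"
      "C' * (C' * f + S' * g) + - S' * (C' * g - S' * f) = (C'\<^sup>2 + S'\<^sup>2) * f"
      "S' * (C' * f + S' * g) + C' * (C' * g - S' * f) = (C'\<^sup>2 + S'\<^sup>2) * g" for f g
      by (simp_all add: power2_eq_square algebra_simps)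
    let ?p1 = "x * P1 + (1 - x * x) * Q1" and ?p2 = "x * P2 + (1 - x * x) * Q2"
      and ?q1 = "P1 - x * Q1" and ?q2 = "P2 - x * Q2"
    show "p1 = smult c (pCons 0 ?p1 + ?q1 - pCons 0 (pCons 0 ?q1)) + smult (- s) (pCons 0 ?p2 + ?q2 - pCons 0 (pCons 0 ?q2))"
      "p2 = smult s (pCons 0 ?p1 + ?q1 - pCons 0 (pCons 0 ?q1)) + smult c (pCons 0 ?p2 + ?q2 - pCons 0 (pCons 0 ?q2))"
      "q1 = smult c' (?p1 - pCons 0 ?q1) + smult (- s') (?p2 - pCons 0 ?q2)"
      "q2 = smult s' (?p1 - pCons 0 ?q1) + smult c' (?p2 - pCons 0 ?q2)"
      unfolding x smult sig unfolding PQ unrot unit by simp_all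
  qed (use cs cs' par in auto)
qed

section \<open>Query circuits\<close>

lemma controlled_oracle_unitary:
  assumes "unitary_mat (2 ^ b * n) U"
  shows "unitary_mat (2 ^ (a + b) * n) (controlled_oracle a A U)"
  using unitary_two_projections[OF assms unitary_one, of "2 ^ a" A] unitary_matD(2)[OF assms]
  by (simp add: controlled_oracle_def power_add mult.assoc)

lemma gate_mat_unitary:
  assumes U: "unitary_mat (2 ^ b * n) U" and "\<And>G. g = Local G \<Longrightarrow> unitary_mat (2 ^ (a + b)) G"
  shows "unitary_mat (2 ^ (a + b) * n) (gate_mat a n U g)"
  using assms by (cases g) (auto intro: unitary_kron controlled_oracle_unitary unitary_adjoint)

lemma valid_circuit_simps [simp]:
  "valid_circuit a b []"
  "valid_circuit a b (g # gs) \<longleftrightarrow> (\<forall>G. g = Local G \<longrightarrow> unitary_mat (2 ^ (a + b)) G) \<and> valid_circuit a b gs"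
  "valid_circuit a b (gs @ hs) \<longleftrightarrow> valid_circuit a b gs \<and> valid_circuit a b hs"
  by (auto simp: valid_circuit_def)

lemma circuit_mat_unitary:
  assumes "unitary_mat (2 ^ b * n) U" "valid_circuit a b gs"
  shows "unitary_mat (2 ^ (a + b) * n) (circuit_mat a b n U gs)"
  using assms(2) by (induction gs) (auto intro!: unitary_mult gate_mat_unitary assms(1))

lemma circuit_mat_append:
  assumes U: "unitary_mat (2 ^ b * n) U" and "valid_circuit a b gs" "valid_circuit a b hs"
  shows "circuit_mat a b n U (gs @ hs) = circuit_mat a b n U hs * circuit_mat a b n U gs"
  using assms(2)
proof (induction gs)
  case Nil
  then show ?case
    using circuit_mat_unitary[OF U assms(3), THEN unitary_matD(1)] by simp
next
  case (Cons g gs)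
  have "unitary_mat (2 ^ (a + b) * n) (gate_mat a n U g)"
    using Cons.prems by (intro gate_mat_unitary[OF U]) simp
  then show ?case
    using Cons circuit_mat_unitary[OF U, of a gs] circuit_mat_unitary[OF U assms(3)]
    by (simp add: mult_mat_assoc unitary_matD)
qed

lemma num_calls_simps [simp]:
  "num_calls [] = 0"
  "num_calls (Local G # gs) = num_calls gs"
  "num_calls (Query A # gs) = Suc (num_calls gs)"
  "num_calls (Query_Adj A # gs) = Suc (num_calls gs)"
  "num_calls (gs @ hs) = num_calls gs + num_calls hs"
  by (simp_all add: num_calls_def)

section \<open>Realizing tuples of polynomials by alternating queries\<close>

lemma controlled_oracle_UNIV:
  "dim_col U = dim_row U \<Longrightarrow> controlled_oracle 1 UNIV U = 1\<^sub>m 2 \<otimes>\<^sub>m U"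
  by (simp add: controlled_oracle_def kron_zero_left add_zero_mat)

lemma block_adjoint:
  assumes "U \<in> carrier_mat (2 ^ b * n) (2 ^ b * n)"
  shows "block b n (mat_adjoint U) = mat_adjoint (block b n U)"
  using assms by (simp add: block_eq adjoint_mult mult_mat_assoc)

text \<open>For k > 0 this is the oracle used in query number \<open>k\<close>, starting with
  \<open>U\<close>. Before the first query it is the adjoint of \<open>U\<close>, so that every
  query meets blocks formed with its own adjoint, as \<open>walk_block_query\<close>
  demands.\<close>

abbreviation alternating_query :: "nat \<Rightarrow> complex mat \<Rightarrow> complex mat" where
  "alternating_query k U \<equiv> (if even k then mat_adjoint U else U)"

text \<open>Each layer removed by \<open>strip_layer\<close> is put back as one query followed by
  one local gate. Both halves of the first block column have to be tracked, because the rotations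
  mix them. The list \<open>gs\<close> is chosen before the system, the matrix and the oracle, so a
  single circuit serves them all.\<close>

lemma qsvt_circuit_exists:
  assumes "has_parity k p1" "has_parity k p2" "has_parity k (pCons 0 q1)" "has_parity k (pCons 0 q2)"
    and "p1\<^sup>2 + p2\<^sup>2 + [:1, 0, -1:] * (q1\<^sup>2 + q2\<^sup>2) = 1"
  shows "\<exists>gs. valid_circuit 1 b gs \<and> num_calls gs = k \<and>
    (\<forall>n S U. hermitian_mat n S \<longrightarrow> block_encoding b n S U \<longrightarrow>
      circuit_mat 1 b n U gs * ket_block (1 + b) n =
      stack (walk_block b n (alternating_query k U) S p1 q1) (walk_block b n (alternating_query k U) S p2 q2))"
  using assms
proof (induction k arbitrary: p1 p2 q1 q2)
  case 0
  have "q1 = 0" "q2 = 0"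
    using 0(3,4)[THEN degree_has_parity] by (auto split: if_splits)
  moreover obtain c s where "p1 = [:c:]" "p2 = [:s:]"
    using 0(1,2)[THEN degree_has_parity] by (metis degree_eq_zeroE le_zero_eq)
  ultimately have cs: "p1 = smult c 1 + smult (- s) 0" "p2 = smult s 1 + smult c 0"
    "q1 = smult 1 0 + smult (- 0) 0" "q2 = smult 0 0 + smult 1 0" and "c\<^sup>2 + s\<^sup>2 = 1"
    using 0(5) by (auto simp: one_pCons power2_eq_square)
  \<comment> \<open>Without queries there is no \<open>L\<close> part, so only the first rotation
    acts; the second is taken to be the identity.\<close>
  let ?G = "rot_gate b (rot c s) (rot 1 0)"
  have "unitary_mat (2 ^ (1 + b)) ?G"
    using \<open>c\<^sup>2 + s\<^sup>2 = 1\<close> by (intro rot_gate_unitary rot_unitary) simp_all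
  moreover have "circuit_mat 1 b n U [Local ?G] * ket_block (1 + b) n =
      stack (walk_block b n (mat_adjoint U) S p1 q1) (walk_block b n (mat_adjoint U) S p2 q2)"
    if "hermitian_mat n S" "block_encoding b n S U" for n S U
  proof -
    have S: "S \<in> carrier_mat n n" "mat_adjoint S = S" and U: "unitary_mat (2 ^ b * n) U" "block b n U = S"
      using that by (auto simp: hermitian_mat_def block_encoding_def)
    note [simp] = unitary_matD(2,3)[OF U(1)]
    have dS [simp]: "dim_row S = n" "dim_col S = n" using S by auto
    have W: "unitary_mat (2 ^ b * n) (mat_adjoint U)" "block b n (mat_adjoint U) = S"
      using U S by (auto simp: unitary_adjoint block_adjoint unitary_matD(1))
    have wb: "walk_block b n (mat_adjoint U) S 1 0 = ket_block b n"
      "walk_block b n (mat_adjoint U) S 0 0 = 0\<^sub>m (2 ^ b * n) n"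
      by (intro eq_matI; simp add: walk_block_def add_zero_mat)+
    have k: "ket 0 = ket0 1"
      by (intro eq_matI) (auto simp: ket_def ket0_def)
    have "ket_block (1 + b) n = stack (ket_block b n) (0\<^sub>m (2 ^ b * n) n)"
      unfolding ket_block_add stack_def k by (intro eq_matI) (auto simp: index_kron div_mod_less_mult)
    then have init: "ket_block (1 + b) n =
        stack (walk_block b n (mat_adjoint U) S 1 0) (walk_block b n (mat_adjoint U) S 0 0)"
      by (simp add: wb)
    have "circuit_mat 1 b n U [Local ?G] = ?G \<otimes>\<^sub>m 1\<^sub>m n"
      by (simp add: rot_gate_def left_mult_one_mat')
    then show ?thesis
      unfolding init cs using walk_stack_rot[OF S(1) W, of c s 1 0 1 0 0 0] by simp
  qed
  ultimately show ?case
    by (intro exI[of _ "[Local ?G]"]) auto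
next
  case (Suc k)
  obtain c s c' s' p1' p2' q1' q2' where cs: "c\<^sup>2 + s\<^sup>2 = 1" "c'\<^sup>2 + s'\<^sup>2 = 1"
    and par: "has_parity k p1'" "has_parity k p2'" "has_parity k (pCons 0 q1')" "has_parity k (pCons 0 q2')"
    and norm: "p1'\<^sup>2 + p2'\<^sup>2 + [:1, 0, -1:] * (q1'\<^sup>2 + q2'\<^sup>2) = 1"
    and pq: "p1 = smult c (pCons 0 p1' + q1' - pCons 0 (pCons 0 q1')) + smult (- s) (pCons 0 p2' + q2' - pCons 0 (pCons 0 q2'))"
    "p2 = smult s (pCons 0 p1' + q1' - pCons 0 (pCons 0 q1')) + smult c (pCons 0 p2' + q2' - pCons 0 (pCons 0 q2'))"
    "q1 = smult c' (p1' - pCons 0 q1') + smult (- s') (p2' - pCons 0 q2')"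
    "q2 = smult s' (p1' - pCons 0 q1') + smult c' (p2' - pCons 0 q2')"
    by (rule strip_layer[OF Suc.prems])
  obtain gs where valid: "valid_circuit 1 b gs" and calls: "num_calls gs = k"
    and gs: "\<And>n S U. hermitian_mat n S \<Longrightarrow> block_encoding b n S U \<Longrightarrow>
      circuit_mat 1 b n U gs * ket_block (1 + b) n =
      stack (walk_block b n (alternating_query k U) S p1' q1') (walk_block b n (alternating_query k U) S p2' q2')"
    using Suc.IH[OF par norm] by blast
  let ?G = "rot_gate b (rot c s) (rot c' s')"
  let ?Q = "if even k then Query UNIV else Query_Adj UNIV"
  have G: "unitary_mat (2 ^ (1 + b)) ?G"
    using cs by (intro rot_gate_unitary rot_unitary)
  have valid': "valid_circuit 1 b [?Q, Local ?G]"
    using G by simp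
  moreover have "circuit_mat 1 b n U (gs @ [?Q, Local ?G]) * ket_block (1 + b) n =
      stack (walk_block b n (alternating_query (Suc k) U) S p1 q1) (walk_block b n (alternating_query (Suc k) U) S p2 q2)"
    if hyp: "hermitian_mat n S" "block_encoding b n S U" for n S U
  proof -
    have S: "S \<in> carrier_mat n n" "mat_adjoint S = S" and U: "unitary_mat (2 ^ b * n) U" "block b n U = S"
      using that by (auto simp: hermitian_mat_def block_encoding_def)
    define W where "W = alternating_query (Suc k) U"
    have W: "unitary_mat (2 ^ b * n) W" "block b n W = S" "alternating_query k U = mat_adjoint W"
      using U S by (auto simp: W_def unitary_adjoint block_adjoint unitary_matD(1))
    note [simp] = unitary_matD(2,3)[OF W(1)] unitary_matD(2,3)[OF U(1)] 
      unitary_matD(2,3)[OF circuit_mat_unitary[OF U(1) valid]]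
      unitary_matD(2,3)[OF G[unfolded power_add power_one_right]] 
    have gate: "gate_mat 1 n U ?Q = 1\<^sub>m 2 \<otimes>\<^sub>m W"
      by (simp add: W_def controlled_oracle_UNIV del: One_nat_def)
    have "circuit_mat 1 b n U [?Q, Local ?G] = (?G \<otimes>\<^sub>m 1\<^sub>m n) * (1\<^sub>m 2 \<otimes>\<^sub>m W)"
      unfolding circuit_mat.simps gate gate_mat.simps by (simp add: left_mult_one_mat')
    then have "circuit_mat 1 b n U (gs @ [?Q, Local ?G]) =
        ((?G \<otimes>\<^sub>m 1\<^sub>m n) * (1\<^sub>m 2 \<otimes>\<^sub>m W)) * circuit_mat 1 b n U gs"
      using circuit_mat_append[OF U(1) valid valid'] by simp
    then have "circuit_mat 1 b n U (gs @ [?Q, Local ?G]) * ket_block (1 + b) n =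
        (?G \<otimes>\<^sub>m 1\<^sub>m n) * ((1\<^sub>m 2 \<otimes>\<^sub>m W) * (circuit_mat 1 b n U gs * ket_block (1 + b) n))"
    proof -
      have d: "dim_row (circuit_mat 1 b n U gs) = 2 * (2 ^ b * n)" "dim_col (circuit_mat 1 b n U gs) = 2 * (2 ^ b * n)"
        "dim_row ?G = 2 * 2 ^ b" "dim_col ?G = 2 * 2 ^ b" "dim_row (ket_block (1 + b) n) = 2 * (2 ^ b * n)"
        using unitary_matD(2,3)[OF circuit_mat_unitary[OF U(1) valid]] unitary_matD(2,3)[OF G] by simp_all
      assume eq: "circuit_mat 1 b n U (gs @ [?Q, Local ?G]) =
        ((?G \<otimes>\<^sub>m 1\<^sub>m n) * (1\<^sub>m 2 \<otimes>\<^sub>m W)) * circuit_mat 1 b n U gs"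
      show ?thesis
        unfolding eq by (subst mult_mat_assoc, simp_all add: d power_add mult.assoc del: One_nat_def)+
    qed
    also have "\<dots> = stack (walk_block b n W S p1 q1) (walk_block b n W S p2 q2)"
      unfolding gs[OF hyp] W(3) walk_stack_query[OF S(1) W(1)] walk_stack_rot[OF S(1) W(1,2)] pq ..
    finally show ?thesis unfolding W_def .
  qed
  ultimately show ?case
    using valid calls by (intro exI[of _ "gs @ [?Q, Local ?G]"]) auto
qed

text \<open>If the parity of \<open>p\<close> is opposite to that of \<open>d\<close>, the
  coefficient of degree \<open>d\<close> vanishes and d - 1 is a valid bound. For d = 0 this case
  cannot arise, since constants are even.\<close>

lemma definite_parity_has_parity:
  assumes "definite_parity p" "degree p \<le> d"
  obtains k where "k \<le> d" "has_parity k p"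
proof -
  have sgn: "coeff (pcompose p [:0, -1:]) i = (-1) ^ i * coeff p i" for i
    using coeff_pcompose_linear[of p "-1" i] by simp
  have parity: "has_parity k p" if "d = k \<or> d = Suc k" "pcompose p [:0, -1:] = smult ((-1) ^ k) p" for k
    unfolding has_parity_def
  proof (intro allI impI)
    fix i assume i: "coeff p i \<noteq> 0"
    then have "i \<le> d" using assms(2) le_degree by fastforce
    moreover have "even (k + i)"
      using sgn[of i] i that(2) by (cases "even i"; cases "even k") auto
    ultimately show "i \<le> k \<and> even (k + i)"
      using that(1) by (auto simp: le_Suc_eq)
  qed
  show ?thesis
  proof (cases "pcompose p [:0, -1:] = smult ((-1) ^ d) p")
    case True
    then show ?thesis using parity[of d] that[of d] by simp
  next
    case False
    have *: "pcompose p [:0, -1:] = smult ((-1) ^ Suc d) p"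
      using False assms(1) by (cases "even d") (auto simp: definite_parity_def)
    show ?thesis
    proof (cases d)
      case 0
      with assms(2) obtain c where "p = [:c:]" by (auto elim: degree_eq_zeroE)
      with False 0 show ?thesis by simp
    next
      case (Suc k)
      with * parity[of k] that[of k] show ?thesis by simp
    qed
  qed
qed

lemma qsvt_circuit:
  assumes "definite_parity p" "degree p \<le> d" "\<And>x. x \<in> {-1..1} \<Longrightarrow> \<bar>poly p x\<bar> < 1"
  shows "\<exists>gs. valid_circuit 1 b gs \<and> num_calls gs \<le> d \<and>
    (\<forall>n S U. hermitian_mat n S \<longrightarrow> block_encoding b n S U \<longrightarrow>
      block (1 + b) n (circuit_mat 1 b n U gs) = poly_mat p S)"
proof -
  obtain k where k: "k \<le> d" "has_parity k p"
    using definite_parity_has_parity assms(1,2) by blast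
  obtain A B where AB: "has_parity k A" "has_parity k (pCons 0 B)" "p\<^sup>2 + A\<^sup>2 + [:1, 0, -1:] * B\<^sup>2 = 1"
    using complementary_polynomials[OF k(2) assms(3)] by blast
  \<comment> \<open>\<open>B\<close> is placed in the \<open>L\<close> part of the first half and
    \<open>A\<close> in the second half of the work qubit. The block sees neither: the former is
    orthogonal to the designated subspace, the latter belongs to the state 1 of the work
    qubit.\<close>
  obtain gs where gs: "valid_circuit 1 b gs" "num_calls gs = k"
    "\<And>n S U. hermitian_mat n S \<Longrightarrow> block_encoding b n S U \<Longrightarrow>
      circuit_mat 1 b n U gs * ket_block (1 + b) n =
      stack (walk_block b n (alternating_query k U) S p B) (walk_block b n (alternating_query k U) S A 0)"
    using qsvt_circuit_exists[OF k(2) AB(1,2), of 0 b] AB(3) by auto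
  have "block (1 + b) n (circuit_mat 1 b n U gs) = poly_mat p S"
    if hyp: "hermitian_mat n S" "block_encoding b n S U" for n S U
  proof -
    have S: "S \<in> carrier_mat n n" "mat_adjoint S = S" and U: "unitary_mat (2 ^ b * n) U" "block b n U = S"
      using that by (auto simp: hermitian_mat_def block_encoding_def)
    have dS [simp]: "dim_row S = n" "dim_col S = n" using S by auto
    define W where "W = alternating_query k U"
    have W: "unitary_mat (2 ^ b * n) W" "block b n W = S"
      using U S by (auto simp: W_def unitary_adjoint block_adjoint unitary_matD(1))
    note [simp] = unitary_matD(2,3)[OF circuit_mat_unitary[OF U(1) gs(1)]]
    have e: "mat_adjoint (ket0 1) * ket 0 = 1\<^sub>m 1" "mat_adjoint (ket0 1) * ket 1 = 0\<^sub>m 1 1"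
      by (rule eq_matI; simp add: index_mult_mat_sum ket0_def ket_def numeral_2_eq_2 del: index_mult_mat(1))+
    have "block (1 + b) n (circuit_mat 1 b n U gs) =
        mat_adjoint (ket_block (1 + b) n) * stack (walk_block b n W S p B) (walk_block b n W S A 0)"
      unfolding block_eq W_def gs(3)[OF hyp, symmetric] by (rule mult_mat_assoc) (simp_all del: One_nat_def)
    also have "\<dots> = mat_adjoint (ket_block b n) * walk_block b n W S p B"
      unfolding ket_block_add stack_def adjoint_kron
      using S by (simp add: mult_mat_distrib kron_mult e kron_zero_left add_zero_mat one_kron[folded One_nat_def] del: One_nat_def)
    also have "\<dots> = poly_mat p S"
      by (rule walk_block_projections[OF S(1) W])
    finally show ?thesis .
  qed
  with gs(1,2) k(1) show ?thesis by auto
qed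

section \<open>Coherent selection\<close>

text \<open>The new qubit is the most significant one, so being in branch \<open>v\<close> is an
  offset of v 2^a; the intersection with \<open>{..<2 ^ a}\<close> keeps the shifted set inside that
  branch. The complement then contains the whole other branch, where a controlled query does
  nothing.\<close>

lemma basis_proj_shift:
  fixes A :: "nat set" and a v :: nat
  assumes "v < 2"
  defines "B \<equiv> (\<lambda>x. v * 2 ^ a + x) ` (A \<inter> {..<2 ^ a})"
  shows "basis_proj (2 ^ (a + 1)) B = basis_proj 2 {v} \<otimes>\<^sub>m basis_proj (2 ^ a) A"
    and "basis_proj (2 ^ (a + 1)) (- B) =
      basis_proj 2 {v} \<otimes>\<^sub>m basis_proj (2 ^ a) (- A) + basis_proj 2 (- {v}) \<otimes>\<^sub>m 1\<^sub>m (2 ^ a)"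
proof -
  have B: "i \<in> B \<longleftrightarrow> i div 2 ^ a = v \<and> i mod 2 ^ a \<in> A" for i
  proof
    assume "i div 2 ^ a = v \<and> i mod 2 ^ a \<in> A"
    then show "i \<in> B"
      unfolding B_def by (intro image_eqI[of _ _ "i mod 2 ^ a"]) (auto simp: mult.commute)
  qed (auto simp: B_def)
  have entry: "basis_proj m X $$ (i, j) = (if i = j \<and> i \<in> X then 1 else 0)" if "i < m" "j < m" for m X i j
    using that by (simp add: basis_proj_def mat_diag_def)
  have eq: "i = j \<longleftrightarrow> i div 2 ^ a = j div 2 ^ a \<and> i mod 2 ^ a = j mod 2 ^ a" for i j :: nat
    by (metis div_mult_mod_eq)
  show "basis_proj (2 ^ (a + 1)) B = basis_proj 2 {v} \<otimes>\<^sub>m basis_proj (2 ^ a) A"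
  proof (rule eq_matI)
    fix i j assume "i < dim_row (basis_proj 2 {v} \<otimes>\<^sub>m basis_proj (2 ^ a) A)" "j < dim_col (basis_proj 2 {v} \<otimes>\<^sub>m basis_proj (2 ^ a) A)"
    then have ij: "i < 2 * 2 ^ a" "j < 2 * 2 ^ a" by simp_all
    then show "basis_proj (2 ^ (a + 1)) B $$ (i, j) = (basis_proj 2 {v} \<otimes>\<^sub>m basis_proj (2 ^ a) A) $$ (i, j)"
      using ij[THEN div_mod_less_mult(1)] ij[THEN div_mod_less_mult(2)] eq[of i j]
      by (cases "i div 2 ^ a = j div 2 ^ a"; cases "i mod 2 ^ a = j mod 2 ^ a"; cases "i = j") (auto simp: index_kron entry B)
  qed simp_all
  show "basis_proj (2 ^ (a + 1)) (- B) =
      basis_proj 2 {v} \<otimes>\<^sub>m basis_proj (2 ^ a) (- A) + basis_proj 2 (- {v}) \<otimes>\<^sub>m 1\<^sub>m (2 ^ a)" (is "_ = ?R")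
  proof (rule eq_matI)
    fix i j assume "i < dim_row ?R" "j < dim_col ?R"
    then have ij: "i < 2 * 2 ^ a" "j < 2 * 2 ^ a" by simp_all
    then show "basis_proj (2 ^ (a + 1)) (- B) $$ (i, j) = ?R $$ (i, j)"
      using ij[THEN div_mod_less_mult(1)] ij[THEN div_mod_less_mult(2)] eq[of i j]
      by (cases "i div 2 ^ a = j div 2 ^ a"; cases "i mod 2 ^ a = j mod 2 ^ a"; cases "i = j") (auto simp: index_kron entry B)
  qed simp_all
qed

lemma controlled_oracle_shift:
  assumes "v < 2" and U: "unitary_mat (2 ^ b * n) U"
  shows "controlled_oracle (a + 1) ((\<lambda>x. v * 2 ^ a + x) ` (A \<inter> {..<2 ^ a})) U =
    basis_proj 2 {v} \<otimes>\<^sub>m controlled_oracle a A U + basis_proj 2 (- {v}) \<otimes>\<^sub>m 1\<^sub>m (2 ^ (a + b) * n)"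
proof -
  note [simp] = unitary_matD(2,3)[OF U]
  have "1\<^sub>m (2 ^ (a + b) * n) = (1\<^sub>m (2 ^ a) \<otimes>\<^sub>m 1\<^sub>m (2 ^ b * n) :: complex mat)"
    by (simp add: kron_one power_add mult.assoc)
  then show ?thesis
    unfolding controlled_oracle_def basis_proj_shift[OF \<open>v < 2\<close>]
    by (simp add: kron_add_left kron_add_right kron_assoc) (rule eq_matI; simp)
qed

lemma gate_mat_control:
  assumes "v < 2" and U: "unitary_mat (2 ^ b * n) U"
    and G: "\<And>G. g = Local G \<Longrightarrow> unitary_mat (2 ^ (a + b)) G"
  shows "gate_mat (a + 1) n U (control_gate a b v g) =
    basis_proj 2 {v} \<otimes>\<^sub>m gate_mat a n U g + basis_proj 2 (- {v}) \<otimes>\<^sub>m 1\<^sub>m (2 ^ (a + b) * n)"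
proof (cases g)
  case (Local G')
  then show ?thesis
    using G[of G'] by (simp add: kron_add_left kron_assoc kron_one unitary_matD)
qed (use assms controlled_oracle_shift unitary_adjoint in simp_all)

text \<open>Operators controlled on the same qubit multiply branch by branch, so controlling each
  gate controls the whole circuit.\<close>

lemma circuit_mat_control:
  assumes v: "v < 2" and U: "unitary_mat (2 ^ b * n) U" and "valid_circuit a b gs"
  shows "circuit_mat (a + 1) b n U (map (control_gate a b v) gs) =
    basis_proj 2 {v} \<otimes>\<^sub>m circuit_mat a b n U gs + basis_proj 2 (- {v}) \<otimes>\<^sub>m 1\<^sub>m (2 ^ (a + b) * n)"
  using assms(3)
proof (induction gs)
  case Nil
  have "circuit_mat (a + 1) b n U (map (control_gate a b v) []) = (1\<^sub>m 2 :: complex mat) \<otimes>\<^sub>m 1\<^sub>m (2 ^ (a + b) * n)"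
    by (simp add: kron_one mult.assoc)
  also have "(1\<^sub>m 2 :: complex mat) = basis_proj 2 {v} + basis_proj 2 (- {v})"
    by (simp add: basis_proj_add)
  finally show ?case
    by (simp add: kron_add_left)
next
  case (Cons g gs)
  have g: "\<And>G. g = Local G \<Longrightarrow> unitary_mat (2 ^ (a + b)) G" and gs: "valid_circuit a b gs"
    using Cons.prems by simp_all
  have c: "gate_mat a n U g \<in> carrier_mat (2 ^ (a + b) * n) (2 ^ (a + b) * n)"
    "circuit_mat a b n U gs \<in> carrier_mat (2 ^ (a + b) * n) (2 ^ (a + b) * n)"
    "(1\<^sub>m (2 ^ (a + b) * n) :: complex mat) \<in> carrier_mat (2 ^ (a + b) * n) (2 ^ (a + b) * n)"
    using gate_mat_unitary[OF U g] circuit_mat_unitary[OF U gs] by (auto simp: unitary_matD)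
  show ?case
    using Cons.IH[OF gs] gate_mat_control[OF v U g] two_projections_mult[OF c(2,1,3,3), of 2 "{v}"]
    by simp
qed

lemma control_gate_valid:
  assumes "v < 2" "valid_circuit a b gs"
  shows "valid_circuit (a + 1) b (map (control_gate a b v) gs)"
proof -
  have "unitary_mat (2 ^ (a + 1 + b)) G" if g: "g \<in> set gs" "control_gate a b v g = Local G" for g G
  proof (cases g)
    case (Local G')
    then have "unitary_mat (2 ^ (a + b)) G'"
      using g assms(2) by (auto simp: valid_circuit_def)
    with Local g(2) show ?thesis
      using unitary_two_projections[of "2 ^ (a + b)" G' "1\<^sub>m (2 ^ (a + b))" 2 "{v}"] by auto
  qed (use g in auto)
  then show ?thesis
    unfolding valid_circuit_def by (auto simp: image_iff)
qed

lemma num_calls_control [simp]: "num_calls (map (control_gate a b v) gs) = num_calls gs"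
proof (induction gs)
  case (Cons g gs)
  then show ?case by (cases g) simp_all
qed simp

lemma dim_hadamard [simp]: "dim_row hadamard = 2" "dim_col hadamard = 2"
  by (simp_all add: hadamard_def)

lemma sqrt2_mult_sqrt2 [simp]: "complex_of_real (sqrt 2) * complex_of_real (sqrt 2) = 2"
  by (metis of_real_mult of_real_numeral real_sqrt_mult_self abs_numeral)

lemma sum_lessThan_2: "(\<Sum>k<2. f k) = f 0 + f (1::nat)"
  by (simp add: numeral_2_eq_2)

lemma hadamard_unitary: "unitary_mat 2 hadamard"
proof -
  have adj: "mat_adjoint hadamard = hadamard"
    by (rule eq_matI) (auto simp: hadamard_def)
  have "hadamard * hadamard = 1\<^sub>m 2"
    by (rule eq_matI) (auto simp: index_mult_mat_sum hadamard_def sum_lessThan_2 less_2_cases_iff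
        simp del: index_mult_mat(1))
  with adj show ?thesis
    unfolding unitary_mat_def by (auto intro!: carrier_matI)
qed

text \<open>A path through the state \<open>v\<close> uses the entries (0, v) and (v, 0) of
  \<open>hadamard\<close>, both equal to 1 / sqrt 2; the negative entry at (1, 1) is never
  met.\<close>

lemma hadamard_average:
  assumes "v < 2"
  shows "mat_adjoint (ket0 1) * (hadamard * (basis_proj 2 {v} * (hadamard * ket0 1))) = (1 / 2) \<cdot>\<^sub>m 1\<^sub>m 1"
  by (rule eq_matI) (use assms in \<open>auto simp: index_mult_mat_sum hadamard_def ket0_def basis_proj_def mat_diag_def
      sum_lessThan_2 less_2_cases_iff simp del: index_mult_mat(1)\<close>)

lemma hadamard_gate_valid: "unitary_mat (2 ^ (a + 1 + b)) (hadamard \<otimes>\<^sub>m 1\<^sub>m (2 ^ (a + b)))"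
  using unitary_kron[OF hadamard_unitary unitary_one] by simp

lemma coherent_select_valid:
  assumes "valid_circuit a b gs0" "valid_circuit a b gs1"
  shows "valid_circuit (a + 1) b (coherent_select a b gs0 gs1)"
  using assms hadamard_gate_valid control_gate_valid[of 0] control_gate_valid[of 1]
  by (simp add: coherent_select_def del: One_nat_def add.commute)

lemma num_calls_coherent_select: "num_calls (coherent_select a b gs0 gs1) = num_calls gs0 + num_calls gs1"
  by (simp add: coherent_select_def)

lemma block_coherent_select:
  assumes U: "unitary_mat (2 ^ b * n) U" and valid: "valid_circuit a b gs0" "valid_circuit a b gs1"
  shows "block (a + 1 + b) n (circuit_mat (a + 1) b n U (coherent_select a b gs0 gs1)) =
    (1 / 2) \<cdot>\<^sub>m (block (a + b) n (circuit_mat a b n U gs0) + block (a + b) n (circuit_mat a b n U gs1))"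
proof -
  define M where "M = 2 ^ (a + b) * n"
  define W0 where "W0 = circuit_mat a b n U gs0"
  define W1 where "W1 = circuit_mat a b n U gs1"
  define k where "k = ket_block (a + b) n"
  have W: "W0 \<in> carrier_mat M M" "W1 \<in> carrier_mat M M"
    using circuit_mat_unitary[OF U valid(1)] circuit_mat_unitary[OF U valid(2)]
    by (auto simp: W0_def W1_def M_def unitary_matD)
  have dW [simp]: "dim_row W0 = M" "dim_col W0 = M" "dim_row W1 = M" "dim_col W1 = M"
    using W by auto
  have dk [simp]: "dim_row k = M" "dim_col k = n" by (simp_all add: k_def M_def)
  let ?H = "hadamard \<otimes>\<^sub>m 1\<^sub>m M" and ?p = "basis_proj 2 {0}" and ?q = "basis_proj 2 {1}"
  let ?h = "[Local (hadamard \<otimes>\<^sub>m 1\<^sub>m (2 ^ (a + b)))]"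
  have compl: "basis_proj 2 (- {0}) = ?q" "basis_proj 2 (- {1}) = ?p"
    by (rule eq_matI; auto simp: basis_proj_def mat_diag_def)+
  have h: "circuit_mat (a + 1) b n U ?h = ?H"
    by (simp add: kron_assoc kron_one M_def left_mult_one_mat')
  have v: "valid_circuit (a + 1) b ?h" "valid_circuit (a + 1) b (map (control_gate a b 0) gs0)"
    "valid_circuit (a + 1) b (map (control_gate a b 1) gs1)"
    using hadamard_gate_valid valid control_gate_valid by (simp_all del: One_nat_def add.commute)
  have one: "(1\<^sub>m M :: complex mat) \<in> carrier_mat M M" by simp
  have "circuit_mat (a + 1) b n U (coherent_select a b gs0 gs1) =
      ?H * ((?p \<otimes>\<^sub>m 1\<^sub>m M + ?q \<otimes>\<^sub>m W1) * (?p \<otimes>\<^sub>m W0 + ?q \<otimes>\<^sub>m 1\<^sub>m M)) * ?H"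
  proof -
    have c0: "circuit_mat (a + 1) b n U (map (control_gate a b 0) gs0) = ?p \<otimes>\<^sub>m W0 + ?q \<otimes>\<^sub>m 1\<^sub>m M"
      using circuit_mat_control[OF _ U valid(1), of 0] by (simp add: compl W0_def M_def)
    have c1: "circuit_mat (a + 1) b n U (map (control_gate a b 1) gs1) = ?p \<otimes>\<^sub>m 1\<^sub>m M + ?q \<otimes>\<^sub>m W1"
      using circuit_mat_control[OF _ U valid(2), of 1] 
      unfolding compl W1_def M_def by (simp add: comm_add_mat[of _ "2 * (2 ^ (a + b) * n)" "2 * (2 ^ (a + b) * n)"] W[unfolded W1_def M_def])
    have "circuit_mat (a + 1) b n U (coherent_select a b gs0 gs1) =
      ((circuit_mat (a + 1) b n U ?h * circuit_mat (a + 1) b n U (map (control_gate a b 1) gs1))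
        * circuit_mat (a + 1) b n U (map (control_gate a b 0) gs0)) * circuit_mat (a + 1) b n U ?h"
      unfolding coherent_select_def
      using v by (simp only: circuit_mat_append[OF U] valid_circuit_simps(3))
    then show ?thesis
      unfolding h c0 c1 by (simp add: mult_mat_assoc)
  qed
  \<comment> \<open>The two controlled circuits act nontrivially on complementary branches only, so
    their product is the selection operator.\<close>
  also have "(?p \<otimes>\<^sub>m 1\<^sub>m M + ?q \<otimes>\<^sub>m W1) * (?p \<otimes>\<^sub>m W0 + ?q \<otimes>\<^sub>m 1\<^sub>m M) = ?p \<otimes>\<^sub>m W0 + ?q \<otimes>\<^sub>m W1"
    using two_projections_mult[OF one W(1) W(2) one, of 2 "{0}"] W unfolding compl by simp
  finally have C: "circuit_mat (a + 1) b n U (coherent_select a b gs0 gs1) = ?H * (?p \<otimes>\<^sub>m W0 + ?q \<otimes>\<^sub>m W1) * ?H" .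
  have kk: "ket_block (a + 1 + b) n = ket0 1 \<otimes>\<^sub>m k"
    using ket_block_add[of 1 "a + b" n] by (simp add: k_def add.commute add.left_commute)
  have "block (a + 1 + b) n (?H * (?p \<otimes>\<^sub>m W0 + ?q \<otimes>\<^sub>m W1) * ?H) =
    (mat_adjoint (ket0 1) * (hadamard * (?p * (hadamard * ket0 1)))) \<otimes>\<^sub>m (mat_adjoint k * (W0 * k)) +
    (mat_adjoint (ket0 1) * (hadamard * (?q * (hadamard * ket0 1)))) \<otimes>\<^sub>m (mat_adjoint k * (W1 * k))"
    unfolding block_eq kk adjoint_kron
    by (simp add: mult_mat_assoc mult_mat_distrib add_mat_distrib kron_mult left_mult_one_mat' right_mult_one_mat' del: One_nat_def)
  also have "\<dots> = (1 / 2) \<cdot>\<^sub>m (block (a + b) n W0 + block (a + b) n W1)"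
    by (simp add: hadamard_average kron_smult_left block_eq mult_mat_assoc one_kron[folded One_nat_def] del: One_nat_def flip: k_def)
      (rule eq_matI; simp add: algebra_simps del: index_mult_mat(1))
  finally show ?thesis
    unfolding C W0_def W1_def .
qed

section \<open>Spectral decomposition\<close>

definition diagonalized :: "complex mat \<Rightarrow> (nat \<Rightarrow> complex) \<Rightarrow> complex mat" where
  "diagonalized V f = V * mat_diag (dim_row V) f * mat_adjoint V"

lemma diagonalized_eq: "unitary_mat n V \<Longrightarrow> V * mat_diag n f * mat_adjoint V = diagonalized V f"
  by (simp add: diagonalized_def unitary_matD)

lemma dim_mat_diag [simp]: "dim_row (mat_diag n f) = n" "dim_col (mat_diag n f) = n"
  by (simp_all add: mat_diag_def)

lemma dim_diagonalized [simp]: "dim_row (diagonalized V f) = dim_row V" "dim_col (diagonalized V f) = dim_row V"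
  by (simp_all add: diagonalized_def)

lemma diagonalized_carrier: "unitary_mat n V \<Longrightarrow> diagonalized V f \<in> carrier_mat n n"
  by (intro carrier_matI) (simp_all add: unitary_matD)

lemma index_mult_diag:
  assumes "i < dim_row A" "j < n" "dim_col A = n"
  shows "(A * mat_diag n f) $$ (i, j) = A $$ (i, j) * f j"
proof -
  have "A * mat_diag n f = mat (dim_row A) n (\<lambda>(i, j). A $$ (i, j) * f j)"
    using assms(3) by (intro mat_diag_mult_right carrier_matI refl)
  then have "(A * mat_diag n f) $$ (i, j) = mat (dim_row A) n (\<lambda>(i, j). A $$ (i, j) * f j) $$ (i, j)"
    by (rule arg_cong)
  with assms show ?thesis by (simp del: index_mult_mat(1))
qed

lemma index_diagonalized:
  assumes "unitary_mat n V" "i < n" "j < n"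
  shows "diagonalized V f $$ (i, j) = (\<Sum>k<n. V $$ (i, k) * f k * cnj (V $$ (j, k)))"
proof -
  note [simp] = unitary_matD(2,3)[OF assms(1)]
  have "diagonalized V f $$ (i, j) = (\<Sum>k<n. (V * mat_diag n f) $$ (i, k) * mat_adjoint V $$ (k, j))"
    using assms by (simp add: diagonalized_def index_mult_mat_sum[of i "V * mat_diag n f"] del: index_mult_mat(1))
  then show ?thesis
    using assms by (simp add: index_mult_diag del: index_mult_mat(1))
qed

lemma diagonalized_one:
  assumes V: "unitary_mat n V"
  shows "diagonalized V (\<lambda>_. 1) = 1\<^sub>m n"
  using unitary_matD[OF V] by (simp add: diagonalized_def)

lemma diagonalized_diff:
  assumes V: "unitary_mat n V"
  shows "diagonalized V f - diagonalized V g = diagonalized V (\<lambda>k. f k - g k)"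
  by (rule eq_matI)
    (simp_all add: index_diagonalized[OF V] unitary_matD[OF V] algebra_simps sum_subtractf)

lemma diagonalized_smult:
  assumes V: "unitary_mat n V"
  shows "c \<cdot>\<^sub>m diagonalized V f = diagonalized V (\<lambda>k. c * f k)"
  by (rule eq_matI)
    (simp_all add: index_diagonalized[OF V] unitary_matD[OF V] sum_distrib_left mult_ac)

lemma diagonalized_mult:
  assumes V: "unitary_mat n V"
  shows "diagonalized V f * diagonalized V g = diagonalized V (\<lambda>k. f k * g k)"
proof -
  note [simp] = unitary_matD(2-)[OF V]
  have "mat_adjoint V * (V * X) = X" if "dim_row X = n" for X
    using that by (simp add: mult_mat_assoc[symmetric])
  then have "diagonalized V f * diagonalized V g = V * ((mat_diag n f * mat_diag n g) * mat_adjoint V)"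
    by (simp add: diagonalized_def mult_mat_assoc del: mat_diag_diag)
  then show ?thesis
    by (simp add: diagonalized_def mult_mat_assoc)
qed

lemma diagonalized_pow:
  assumes V: "unitary_mat n V"
  shows "diagonalized V f ^\<^sub>m k = diagonalized V (\<lambda>i. f i ^ k)"
proof (induction k)
  case 0
  then show ?case by (simp add: diagonalized_one[OF V] unitary_matD[OF V])
next
  case (Suc k)
  then show ?case by (simp add: diagonalized_mult[OF V] mult.commute)
qed

lemma poly_mat_diagonalized:
  assumes V: "unitary_mat n V"
  shows "poly_mat p (diagonalized V (\<lambda>i. complex_of_real (f i))) = diagonalized V (\<lambda>i. complex_of_real (poly p (f i)))"
proof (rule eq_matI)
  let ?D = "diagonalized V (\<lambda>i. complex_of_real (poly p (f i)))"
  fix i j assume "i < dim_row ?D" "j < dim_col ?D"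
  then have ij: "i < n" "j < n" by (simp_all add: unitary_matD[OF V])
  have "poly_mat p (diagonalized V (\<lambda>i. complex_of_real (f i))) $$ (i, j) =
      (\<Sum>m\<le>degree p. \<Sum>k<n. V $$ (i, k) * (complex_of_real (coeff p m) * complex_of_real (f k) ^ m) * cnj (V $$ (j, k)))"
    using ij by (simp add: poly_mat_def unitary_matD[OF V] diagonalized_pow[OF V] index_diagonalized[OF V] sum_distrib_left mult_ac)
  also have "\<dots> = (\<Sum>k<n. V $$ (i, k) * (\<Sum>m\<le>degree p. complex_of_real (coeff p m) * complex_of_real (f k) ^ m) * cnj (V $$ (j, k)))"
    by (subst sum.swap) (simp add: sum_distrib_left sum_distrib_right)
  also have "\<dots> = ?D $$ (i, j)"
    using ij by (simp add: index_diagonalized[OF V] poly_altdef)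
  finally show "poly_mat p (diagonalized V (\<lambda>i. complex_of_real (f i))) $$ (i, j) = ?D $$ (i, j)" .
qed simp_all

lemma mat_exp_diagonalized:
  assumes V: "unitary_mat n V"
  shows "mat_exp (diagonalized V f) = diagonalized V (\<lambda>i. exp (f i))"
proof (rule eq_matI)
  let ?D = "diagonalized V (\<lambda>i. exp (f i))"
  fix i j assume "i < dim_row ?D" "j < dim_col ?D"
  then have ij: "i < n" "j < n" by (simp_all add: unitary_matD[OF V])
  have "(\<lambda>m. \<Sum>k<n. V $$ (i, k) * (f k ^ m /\<^sub>R fact m) * cnj (V $$ (j, k))) sums
      (\<Sum>k<n. V $$ (i, k) * exp (f k) * cnj (V $$ (j, k)))"
    by (intro sums_sum sums_mult sums_mult2 exp_converges)
  moreover have "(\<Sum>k<n. V $$ (i, k) * (f k ^ m /\<^sub>R fact m) * cnj (V $$ (j, k))) =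
      (diagonalized V f ^\<^sub>m m) $$ (i, j) / fact m" for m
    using ij by (simp add: diagonalized_pow[OF V] index_diagonalized[OF V] sum_divide_distrib scaleR_conv_of_real divide_simps mult_ac)
  ultimately have "(\<lambda>m. (diagonalized V f ^\<^sub>m m) $$ (i, j) / fact m) sums ?D $$ (i, j)"
    using ij by (simp add: index_diagonalized[OF V])
  then show "mat_exp (diagonalized V f) $$ (i, j) = ?D $$ (i, j)"
    using ij by (simp add: mat_exp_def unitary_matD[OF V] sums_unique[symmetric])
qed (simp_all add: mat_exp_def)

text \<open>The change of basis M = (adjoint of W) V intertwines the two diagonals: M_ij (d_j - e_i)
  = 0. So M_ij can be nonzero only where d_j = e_i, and there f agrees as well. This makes the
  description in \<open>spectral_calculus\<close> unique.\<close>

lemma diagonalized_functional_calculus: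
  assumes V: "unitary_mat n V" and W: "unitary_mat n W"
    and eq: "diagonalized V (\<lambda>i. complex_of_real (d i)) = diagonalized W (\<lambda>i. complex_of_real (e i))"
  shows "diagonalized V (\<lambda>i. complex_of_real (f (d i))) = diagonalized W (\<lambda>i. complex_of_real (f (e i)))"
proof -
  note [simp] = unitary_matD(2-)[OF V] unitary_matD(2-)[OF W]
  define M where "M = mat_adjoint W * V"
  have [simp]: "dim_row M = n" "dim_col M = n" by (simp_all add: M_def)
  have cancel: "mat_adjoint V * (V * X) = X" "W * (mat_adjoint W * X) = X" "mat_adjoint W * (W * X) = X"
    "V * (mat_adjoint V * X) = X" if "dim_row X = n" for X
    using that by (simp_all add: mult_mat_assoc[symmetric])
  have "M * mat_diag n (\<lambda>i. complex_of_real (d i)) = mat_adjoint W * (diagonalized V (\<lambda>i. complex_of_real (d i)) * V)"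
    by (simp add: M_def diagonalized_def mult_mat_assoc right_mult_one_mat')
  also have "\<dots> = mat_diag n (\<lambda>i. complex_of_real (e i)) * M"
    unfolding eq by (simp add: M_def diagonalized_def mult_mat_assoc cancel)
  finally have comm: "M * mat_diag n (\<lambda>i. complex_of_real (d i)) = mat_diag n (\<lambda>i. complex_of_real (e i)) * M" .
  have M: "M \<in> carrier_mat n n" by (auto intro: carrier_matI)
  have "M * mat_diag n (\<lambda>i. complex_of_real (f (d i))) = mat_diag n (\<lambda>i. complex_of_real (f (e i))) * M"
  proof (rule eq_matI)
    fix i j assume ij: "i < dim_row (mat_diag n (\<lambda>i. complex_of_real (f (e i))) * M)"
      "j < dim_col (mat_diag n (\<lambda>i. complex_of_real (f (e i))) * M)"
    have "M $$ (i, j) * complex_of_real (d j) = complex_of_real (e i) * M $$ (i, j)"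
      using arg_cong[OF comm, of "\<lambda>X. X $$ (i, j)"] ij
      by (simp add: mat_diag_mult_left[OF M] mat_diag_mult_right[OF M])
    then have "M $$ (i, j) = 0 \<or> d j = e i"
      by (simp add: mult.commute)
    then show "(M * mat_diag n (\<lambda>i. complex_of_real (f (d i)))) $$ (i, j) = (mat_diag n (\<lambda>i. complex_of_real (f (e i))) * M) $$ (i, j)"
      using ij by (auto simp: mat_diag_mult_left[OF M] mat_diag_mult_right[OF M])
  qed simp_all
  then have "W * ((M * mat_diag n (\<lambda>i. complex_of_real (f (d i)))) * mat_adjoint V) =
      W * ((mat_diag n (\<lambda>i. complex_of_real (f (e i))) * M) * mat_adjoint V)"
    by simp
  then show ?thesis
    by (simp add: diagonalized_def M_def mult_mat_assoc cancel right_mult_one_mat')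
qed

lemma spectral_calculus_diagonalized:
  assumes V: "unitary_mat n V"
  shows "spectral_calculus f (diagonalized V (\<lambda>i. complex_of_real (e i))) = diagonalized V (\<lambda>i. complex_of_real (f (e i)))"
  unfolding spectral_calculus_def
proof (rule the_equality; (elim exE)?)
  show "\<exists>W ev. let n = dim_row (diagonalized V (\<lambda>i. complex_of_real (e i))) in unitary_mat n W \<and>
      diagonalized V (\<lambda>i. complex_of_real (e i)) = W * mat_diag n (\<lambda>i. complex_of_real (ev i)) * mat_adjoint W \<and>
      diagonalized V (\<lambda>i. complex_of_real (f (e i))) = W * mat_diag n (\<lambda>i. complex_of_real (f (ev i))) * mat_adjoint W"
    using V unitary_matD(2)[OF V] by (intro exI[of _ V] exI[of _ e]) (simp add: diagonalized_eq)
next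
  fix B W d
  assume "let n = dim_row (diagonalized V (\<lambda>i. complex_of_real (e i))) in unitary_mat n W \<and>
      diagonalized V (\<lambda>i. complex_of_real (e i)) = W * mat_diag n (\<lambda>i. complex_of_real (d i)) * mat_adjoint W \<and>
      B = W * mat_diag n (\<lambda>i. complex_of_real (f (d i))) * mat_adjoint W"
  then have W: "unitary_mat n W" and eq: "diagonalized V (\<lambda>i. complex_of_real (e i)) = diagonalized W (\<lambda>i. complex_of_real (d i))"
    and B: "B = diagonalized W (\<lambda>i. complex_of_real (f (d i)))"
    using unitary_matD(2)[OF V] by (auto simp: diagonalized_eq Let_def)
  show "B = diagonalized V (\<lambda>i. complex_of_real (f (e i)))"
    unfolding B using diagonalized_functional_calculus[OF V W eq] by simp
qed

section \<open>The operator norm\<close>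

lemma index_mult_mat_vec_sum:
  "i < dim_row A \<Longrightarrow> dim_col A = dim_vec v \<Longrightarrow> (A *\<^sub>v v) $ i = (\<Sum>j<dim_vec v. A $$ (i, j) * v $ j)"
  by (simp add: scalar_prod_def atLeast0LessThan)

lemma l2norm_nonneg: "0 \<le> l2norm v"
  by (simp add: l2norm_def sum_nonneg)

lemma l2norm_sq: "complex_of_real ((l2norm v)\<^sup>2) = (\<Sum>i<dim_vec v. v $ i * cnj (v $ i))"
proof -
  have "(l2norm v)\<^sup>2 = (\<Sum>i<dim_vec v. (cmod (v $ i))\<^sup>2)"
    by (simp add: l2norm_def sum_nonneg)
  then show ?thesis
    by (simp only: of_real_sum complex_norm_square)
qed

lemma l2norm_unitary:
  assumes U: "unitary_mat n U" and v: "v \<in> carrier_vec n"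
  shows "l2norm (U *\<^sub>v v) = l2norm v"
proof -
  note [simp] = unitary_matD(2,3)[OF U]
  have dv [simp]: "dim_vec v = n" using v by auto
  have orth: "(\<Sum>i<n. U $$ (i, j) * cnj (U $$ (i, k))) = (if j = k then 1 else 0)" if "j < n" "k < n" for j k
  proof -
    have "(mat_adjoint U * U) $$ (k, j) = (\<Sum>i<n. U $$ (i, j) * cnj (U $$ (i, k)))"
      using that by (simp add: index_mult_mat_sum mult.commute del: index_mult_mat(1))
    then show ?thesis using that unitary_matD(4)[OF U] by auto
  qed
  have "complex_of_real ((l2norm (U *\<^sub>v v))\<^sup>2) =
      (\<Sum>i<n. (\<Sum>j<n. U $$ (i, j) * v $ j) * (\<Sum>k<n. cnj (U $$ (i, k)) * cnj (v $ k)))"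
    unfolding l2norm_sq by (simp add: index_mult_mat_vec_sum del: index_mult_mat_vec)
  also have "\<dots> = (\<Sum>i<n. \<Sum>j<n. \<Sum>k<n. (v $ j * cnj (v $ k)) * (U $$ (i, j) * cnj (U $$ (i, k))))"
    by (simp add: sum_product mult_ac)
  also have "\<dots> = (\<Sum>j<n. \<Sum>i<n. \<Sum>k<n. (v $ j * cnj (v $ k)) * (U $$ (i, j) * cnj (U $$ (i, k))))"
    by (rule sum.swap)
  also have "\<dots> = (\<Sum>j<n. \<Sum>k<n. (v $ j * cnj (v $ k)) * (\<Sum>i<n. U $$ (i, j) * cnj (U $$ (i, k))))"
    unfolding sum_distrib_left by (intro sum.cong refl sum.swap)
  also have "\<dots> = (\<Sum>j<n. \<Sum>k<n. if j = k then v $ j * cnj (v $ k) else 0)"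
    by (intro sum.cong refl) (auto simp: orth)
  also have "\<dots> = complex_of_real ((l2norm v)\<^sup>2)"
    unfolding l2norm_sq by simp
  finally have "(l2norm (U *\<^sub>v v))\<^sup>2 = (l2norm v)\<^sup>2"
    unfolding of_real_eq_iff .
  then show ?thesis
    by (simp add: l2norm_nonneg power2_eq_iff_nonneg)
qed

lemma l2norm_diag_le:
  assumes v: "v \<in> carrier_vec n" and f: "\<And>k. k < n \<Longrightarrow> cmod (f k) \<le> M" and "0 \<le> M"
  shows "l2norm (mat_diag n f *\<^sub>v v) \<le> M * l2norm v"
proof -
  have dv [simp]: "dim_vec v = n" using v by auto
  have *: "(mat_diag n f *\<^sub>v v) $ i = f i * v $ i" if "i < n" for i
    using that by (simp add: index_mult_mat_vec_sum mat_diag_def if_distrib[of "\<lambda>x. x * _"] del: index_mult_mat_vec cong: if_cong)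
  have "l2norm (mat_diag n f *\<^sub>v v) \<le> sqrt (\<Sum>i<n. M\<^sup>2 * (cmod (v $ i))\<^sup>2)"
    unfolding l2norm_def
    by (intro real_sqrt_le_mono) (auto simp: * norm_mult power_mult_distrib intro!: sum_mono mult_right_mono power_mono f simp del: index_mult_mat_vec)
  also have "\<dots> = M * l2norm v"
    using \<open>0 \<le> M\<close> by (simp add: l2norm_def real_sqrt_mult flip: sum_distrib_left)
  finally show ?thesis .
qed

lemma l2norm_diagonalized_le:
  assumes V: "unitary_mat n V" and v: "v \<in> carrier_vec n"
    and f: "\<And>k. k < n \<Longrightarrow> cmod (f k) \<le> M" and "0 \<le> M"
  shows "l2norm (diagonalized V f *\<^sub>v v) \<le> M * l2norm v"
proof -
  have V': "V \<in> carrier_mat n n" "mat_adjoint V \<in> carrier_mat n n"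
    using unitary_matD(1)[OF V] by auto
  have w: "mat_adjoint V *\<^sub>v v \<in> carrier_vec n"
    using V'(2) v by (rule mult_mat_vec_carrier)
  have "diagonalized V f *\<^sub>v v = V *\<^sub>v (mat_diag n f *\<^sub>v (mat_adjoint V *\<^sub>v v))"
    using V' v w by (simp add: diagonalized_def unitary_matD(2)[OF V] assoc_mult_mat_vec[of _ n n _ n])
  then have "l2norm (diagonalized V f *\<^sub>v v) = l2norm (mat_diag n f *\<^sub>v (mat_adjoint V *\<^sub>v v))"
    using l2norm_unitary[OF V] w by (metis mat_diag_dim mult_mat_vec_carrier)
  also have "\<dots> \<le> M * l2norm (mat_adjoint V *\<^sub>v v)"
    using f \<open>0 \<le> M\<close> by (intro l2norm_diag_le w)
  also have "l2norm (mat_adjoint V *\<^sub>v v) = l2norm v"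
    by (rule l2norm_unitary[OF unitary_adjoint[OF V] v])
  finally show ?thesis .
qed

lemma opnorm_diagonalized_le:
  assumes V: "unitary_mat n V" and f: "\<And>k. k < n \<Longrightarrow> cmod (f k) \<le> M" and "0 \<le> M"
  shows "opnorm (diagonalized V f) \<le> M"
  unfolding opnorm_def
proof (rule cSup_least)
  have "l2norm (0\<^sub>v n) = 0" by (simp add: l2norm_def)
  then show "{l2norm (diagonalized V f *\<^sub>v v) |v. v \<in> carrier_vec (dim_col (diagonalized V f)) \<and> l2norm v \<le> 1} \<noteq> {}"
    using unitary_matD(2)[OF V] by (auto intro!: exI[of _ "0\<^sub>v n"])
next
  fix x assume "x \<in> {l2norm (diagonalized V f *\<^sub>v v) |v. v \<in> carrier_vec (dim_col (diagonalized V f)) \<and> l2norm v \<le> 1}"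
  then obtain v where "x = l2norm (diagonalized V f *\<^sub>v v)" "v \<in> carrier_vec n" "l2norm v \<le> 1"
    using unitary_matD(2)[OF V] by auto
  with l2norm_diagonalized_le[OF V, of v f M] assms(2,3) show "x \<le> M"
    by (smt (verit) mult_left_le)
qed

lemma diagonalized_col:
  assumes V: "unitary_mat n V" and "k < n"
  shows "diagonalized V f *\<^sub>v col V k = f k \<cdot>\<^sub>v col V k" "l2norm (col V k) = 1"
proof -
  note [simp] = unitary_matD(2-)[OF V]
  have DV: "diagonalized V f * V = V * mat_diag n f"
    by (simp add: diagonalized_def mult_mat_assoc right_mult_one_mat')
  have "diagonalized V f *\<^sub>v col V k = col (diagonalized V f * V) k"
    using \<open>k < n\<close> by (intro eq_vecI) auto
  also have "\<dots> = f k \<cdot>\<^sub>v col V k"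
    unfolding DV using \<open>k < n\<close> by (intro eq_vecI) (auto simp: index_mult_diag simp del: index_mult_mat(1))
  finally show "diagonalized V f *\<^sub>v col V k = f k \<cdot>\<^sub>v col V k" .
  have "(mat_adjoint V * V) $$ (k, k) = complex_of_real ((l2norm (col V k))\<^sup>2)"
    unfolding l2norm_sq using \<open>k < n\<close>
    by (simp add: index_mult_mat_sum mult.commute del: index_mult_mat(1) unitary_matD(4)[OF V])
  then have "(l2norm (col V k))\<^sup>2 = 1"
    using \<open>k < n\<close> by (metis index_one_mat(1) of_real_eq_1_iff unitary_matD(4)[OF V])
  then show "l2norm (col V k) = 1"
    using l2norm_nonneg[of "col V k"] by (simp add: power2_eq_1_iff)
qed

lemma l2norm_smult: "l2norm (c \<cdot>\<^sub>v v) = cmod c * l2norm v"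
  by (simp add: l2norm_def norm_mult power_mult_distrib real_sqrt_mult flip: sum_distrib_left)

text \<open>The bound is attained at the eigenvector in column \<open>k\<close> of
  \<open>V\<close>.\<close>

lemma opnorm_diagonalized_ge:
  assumes V: "unitary_mat n V" and "k < n"
  shows "cmod (f k) \<le> opnorm (diagonalized V f)"
  unfolding opnorm_def
proof (rule cSup_upper)
  have "col V k \<in> carrier_vec n"
    using unitary_matD(2)[OF V] by (simp add: carrier_vecI)
  moreover have "l2norm (diagonalized V f *\<^sub>v col V k) = cmod (f k)"
    using diagonalized_col[OF assms] by (simp add: l2norm_smult)
  ultimately show "cmod (f k) \<in> {l2norm (diagonalized V f *\<^sub>v v) |v. v \<in> carrier_vec (dim_col (diagonalized V f)) \<and> l2norm v \<le> 1}"
    using diagonalized_col(2)[OF assms] unitary_matD(2)[OF V]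
    by (intro CollectI exI[of _ "col V k"]) simp
  \<comment> \<open>A supremum of reals dominates its members only if the set is bounded; the sum of
    all moduli is a crude bound that suffices.\<close>
  define M where "M = (\<Sum>k<n. cmod (f k))"
  have M: "cmod (f k) \<le> M" if "k < n" for k
    unfolding M_def using that by (intro member_le_sum) auto
  have "0 \<le> M" by (simp add: M_def sum_nonneg)
  have "l2norm (diagonalized V f *\<^sub>v v) \<le> M" if "v \<in> carrier_vec n" "l2norm v \<le> 1" for v
    using M \<open>0 \<le> M\<close> mult_left_le[OF that(2) \<open>0 \<le> M\<close>]
    by (intro order_trans[OF l2norm_diagonalized_le[OF V that(1)]])
  then show "bdd_above {l2norm (diagonalized V f *\<^sub>v v) |v. v \<in> carrier_vec (dim_col (diagonalized V f)) \<and> l2norm v \<le> 1}"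
    using unitary_matD(2)[OF V] by (intro bdd_aboveI[of _ M]) auto
qed

section \<open>Diagonalization of Hermitian matrices\<close>

text \<open>Complete \<open>v\<close> to a basis and orthogonalize: Gram-Schmidt keeps the first
  vector. Its output is orthogonal but not normalized, so the columns are divided by their norms,
  whence c = 1 / norm of v.\<close>

lemma unitary_with_first_column:
  fixes v :: "complex vec"
  assumes v: "v \<in> carrier_vec n" "v \<noteq> 0\<^sub>v n" and "0 < n"
  obtains W c where "unitary_mat n W" "col W 0 = c \<cdot>\<^sub>v v"
proof -
  interpret cof_vec_space n "TYPE(complex)" .
  define b where "b = basis_completion v"
  define ws where "ws = gram_schmidt n b"
  note bc = basis_completion[OF v, folded b_def]
  define vs where "vs = tl b"
  have "b \<noteq> []" using bc(6) \<open>0 < n\<close> by auto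
  then have bv: "b = v # vs"
    unfolding vs_def bc(7)[symmetric] by (rule hd_Cons_tl[symmetric])
  have ws: "set ws \<subseteq> carrier_vec n" "corthogonal ws" "length ws = n"
    using gram_schmidt_result[OF bc(2,4,5) refl, folded ws_def] bc(6) by auto
  have "ws \<noteq> []" using ws(3) \<open>0 < n\<close> by auto
  then have hd: "ws ! 0 = v"
    using gram_schmidt_hd[OF v(1), of vs, folded bv ws_def] by (simp add: hd_conv_nth)
  have wsc: "ws ! j \<in> carrier_vec n" if "j < n" for j using ws that by auto
  define r where "r j = l2norm (ws ! j)" for j
  have inner: "(\<Sum>k<n. ws ! i $ k * cnj (ws ! j $ k)) = ws ! i \<bullet>c ws ! j" if "i < n" "j < n" for i j
    using wsc[OF that(2)] by (simp add: scalar_prod_def atLeast0LessThan)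
  have r: "r j \<noteq> 0" "complex_of_real (r j) * complex_of_real (r j) = ws ! j \<bullet>c ws ! j" if "j < n" for j
  proof -
    show *: "complex_of_real (r j) * complex_of_real (r j) = ws ! j \<bullet>c ws ! j"
      using l2norm_sq[of "ws ! j"] inner[OF that that] wsc[OF that] by (simp add: r_def power2_eq_square)
    have "ws ! j \<bullet>c ws ! j \<noteq> 0"
      using corthogonalD[OF ws(2), of j j] that ws(3) by simp
    with * show "r j \<noteq> 0" by auto
  qed
  define W where "W = mat n n (\<lambda>(k, j). ws ! j $ k / complex_of_real (r j))"
  have dW [simp]: "dim_row W = n" "dim_col W = n" by (simp_all add: W_def)
  have W: "W \<in> carrier_mat n n" by (simp add: W_def)
  have "mat_adjoint W * W = 1\<^sub>m n"
  proof (rule eq_matI)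
    fix i j assume "i < dim_row (1\<^sub>m n :: complex mat)" "j < dim_col (1\<^sub>m n :: complex mat)"
    then have ij: "i < n" "j < n" by simp_all
    then have "(mat_adjoint W * W) $$ (i, j) = (\<Sum>k<n. ws ! j $ k * cnj (ws ! i $ k) / (complex_of_real (r i) * complex_of_real (r j)))"
      by (simp add: index_mult_mat_sum W_def mult_ac del: index_mult_mat(1))
    also have "\<dots> = (ws ! j \<bullet>c ws ! i) / (complex_of_real (r i) * complex_of_real (r j))"
      unfolding inner[OF ij(2,1), symmetric] by (rule sum_divide_distrib[symmetric])
    also have "\<dots> = 1\<^sub>m n $$ (i, j)"
      using corthogonalD[OF ws(2), of j i] ij ws(3) r(1)[of i] by (cases "i = j") (auto simp: r(2))
    finally show "(mat_adjoint W * W) $$ (i, j) = 1\<^sub>m n $$ (i, j)" .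
  qed simp_all
  moreover from this have "W * mat_adjoint W = 1\<^sub>m n"
    using mat_mult_left_right_inverse[of "mat_adjoint W" n W] W by auto
  ultimately have "unitary_mat n W"
    using W by (simp add: unitary_mat_def)
  moreover have "col W 0 = (1 / complex_of_real (r 0)) \<cdot>\<^sub>v v"
    using \<open>0 < n\<close> v(1) hd by (intro eq_vecI) (auto simp: W_def)
  ultimately show ?thesis by (rule that)
qed

text \<open>The direct sum of the 1 x 1 matrix \<open>a\<close> and \<open>X\<close>, used to induct
  on the dimension.\<close>

definition bordered :: "'a::zero \<Rightarrow> 'a mat \<Rightarrow> 'a mat" where
  "bordered a X = mat (Suc (dim_row X)) (Suc (dim_col X))
     (\<lambda>(i, j). if i = 0 \<and> j = 0 then a else if i = 0 \<or> j = 0 then 0 else X $$ (i - 1, j - 1))"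

lemma dim_bordered [simp]: "dim_row (bordered a X) = Suc (dim_row X)" "dim_col (bordered a X) = Suc (dim_col X)"
  by (simp_all add: bordered_def)

lemma index_bordered [simp]:
  "bordered a X $$ (0, 0) = a"
  "j < dim_col X \<Longrightarrow> bordered a X $$ (0, Suc j) = 0"
  "i < dim_row X \<Longrightarrow> bordered a X $$ (Suc i, 0) = 0"
  "i < dim_row X \<Longrightarrow> j < dim_col X \<Longrightarrow> bordered a X $$ (Suc i, Suc j) = X $$ (i, j)"
  by (simp_all add: bordered_def)

lemma eq_mat_borderedI:
  assumes "dim_row X = Suc m" "dim_col X = Suc m" "dim_row Y = m" "dim_col Y = m"
    and "X $$ (0, 0) = a" "\<And>i. i < m \<Longrightarrow> X $$ (Suc i, 0) = 0" "\<And>i. i < m \<Longrightarrow> X $$ (0, Suc i) = 0"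
    "\<And>i j. i < m \<Longrightarrow> j < m \<Longrightarrow> X $$ (Suc i, Suc j) = Y $$ (i, j)"
  shows "X = bordered a Y"
proof (rule eq_matI)
  fix i j assume "i < dim_row (bordered a Y)" "j < dim_col (bordered a Y)"
  then show "X $$ (i, j) = bordered a Y $$ (i, j)"
    by (cases i; cases j) (simp_all add: assms)
qed (simp_all add: assms)

lemma bordered_mult:
  fixes X Y :: "complex mat"
  assumes "dim_row X = m" "dim_col X = m" "dim_row Y = m" "dim_col Y = m"
  shows "bordered a X * bordered c Y = bordered (a * c) (X * Y)"
  using assms by (intro eq_mat_borderedI[of _ m])
    (simp_all add: index_mult_mat_sum sum.lessThan_Suc_shift del: index_mult_mat(1) sum.lessThan_Suc)

lemma bordered_adjoint:
  assumes "dim_row X = m" "dim_col X = m"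
  shows "mat_adjoint (bordered a X) = bordered (cnj a) (mat_adjoint X)"
  using assms by (intro eq_mat_borderedI[of _ m]) simp_all

lemma bordered_one: "bordered 1 (1\<^sub>m m) = (1\<^sub>m (Suc m) :: complex mat)"
  by (rule eq_mat_borderedI[symmetric]) auto

lemma bordered_diag: "bordered a (mat_diag m f) = mat_diag (Suc m) (case_nat a f)"
  by (rule eq_mat_borderedI[symmetric]) (auto simp: mat_diag_def)

lemma hermitian_conjugate:
  assumes A: "hermitian_mat n A" and W: "unitary_mat n W"
  shows "hermitian_mat n (mat_adjoint W * A * W)"
proof -
  have d [simp]: "dim_row A = n" "dim_col A = n" "mat_adjoint A = A" using A by (auto simp: hermitian_mat_def)
  note [simp] = unitary_matD(2,3)[OF W]
  show ?thesis
    unfolding hermitian_mat_def by (auto intro!: carrier_matI simp: adjoint_mult mult_mat_assoc)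
qed

text \<open>Deflation: in an orthonormal basis that starts with an eigenvector, the first column
  vanishes below its top entry. Hermitian symmetry then clears the first row, makes the top entry
  real and passes to the remaining block, to which the induction hypothesis applies.\<close>

lemma hermitian_diagonalizable:
  "hermitian_mat n A \<Longrightarrow> \<exists>V e. unitary_mat n V \<and> A = diagonalized V (\<lambda>i. complex_of_real (e i))"
proof (induction n arbitrary: A)
  case 0
  then have "A \<in> carrier_mat 0 0" by (simp add: hermitian_mat_def)
  then have "A = diagonalized (1\<^sub>m 0) (\<lambda>i. complex_of_real 0)"
    by (intro eq_matI) simp_all
  then show ?case
    using unitary_one[of 0] by (intro exI[of _ "1\<^sub>m 0"] exI[of _ "\<lambda>_. 0"] conjI)
next
  case (Suc m)
  let ?n = "Suc m"
  have A: "A \<in> carrier_mat ?n ?n" and dA [simp]: "dim_row A = ?n" "dim_col A = ?n" "mat_adjoint A = A"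
    using Suc.prems by (auto simp: hermitian_mat_def)
  have "\<not> constant (poly (char_poly A))"
    using degree_monic_char_poly[OF A] by (simp add: constant_degree)
  then obtain a where "eigenvalue A a"
    using fundamental_theorem_of_algebra eigenvalue_root_char_poly[OF A] by blast
  then obtain v where v: "v \<in> carrier_vec ?n" "v \<noteq> 0\<^sub>v ?n" "A *\<^sub>v v = a \<cdot>\<^sub>v v"
    by (auto simp: eigenvalue_def eigenvector_def)
  obtain W c where W: "unitary_mat ?n W" "col W 0 = c \<cdot>\<^sub>v v"
    using unitary_with_first_column[OF v(1,2)] by auto
  note [simp] = unitary_matD(2,3)[OF W(1)]
  define A' where "A' = mat_adjoint W * A * W"
  have dA' [simp]: "dim_row A' = ?n" "dim_col A' = ?n" by (simp_all add: A'_def)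
  have A': "mat_adjoint A' = A'"
    using hermitian_conjugate[OF Suc.prems W(1)] by (simp add: hermitian_mat_def A'_def)
  have sym: "A' $$ (i, j) = cnj (A' $$ (j, i))" if "i < ?n" "j < ?n" for i j
    using index_adjoint[of i A' j] that unfolding A' by simp
  have AW: "(A * W) $$ (k, 0) = a * W $$ (k, 0)" if "k < ?n" for k
  proof -
    have "(A * W) $$ (k, 0) = (A *\<^sub>v (c \<cdot>\<^sub>v v)) $ k"
      using that by (simp flip: W(2))
    also have "A *\<^sub>v (c \<cdot>\<^sub>v v) = c \<cdot>\<^sub>v (A *\<^sub>v v)"
      using A v(1) by (rule mult_mat_vec)
    also have "\<dots> = a \<cdot>\<^sub>v col W 0"
      unfolding v(3) W(2) by (simp add: smult_smult_assoc mult.commute)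
    finally show ?thesis using that by simp
  qed
  have first: "A' $$ (i, 0) = (if i = 0 then a else 0)" if "i < ?n" for i
  proof -
    have "A' $$ (i, 0) = (\<Sum>k<?n. mat_adjoint W $$ (i, k) * (A * W) $$ (k, 0))"
      using that by (simp add: A'_def mult_mat_assoc index_mult_mat_sum[of i "mat_adjoint W"] del: index_mult_mat(1) sum.lessThan_Suc)
    also have "\<dots> = a * (\<Sum>k<?n. mat_adjoint W $$ (i, k) * W $$ (k, 0))"
      unfolding sum_distrib_left by (intro sum.cong refl) (simp add: AW mult_ac del: index_mult_mat(1))
    also have "(\<Sum>k<?n. mat_adjoint W $$ (i, k) * W $$ (k, 0)) = (mat_adjoint W * W) $$ (i, 0)"
      using that by (simp add: index_mult_mat_sum del: index_mult_mat(1) sum.lessThan_Suc)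
    finally show ?thesis
      using that unitary_matD(4)[OF W(1)] by simp
  qed
  define B where "B = mat m m (\<lambda>(i, j). A' $$ (Suc i, Suc j))"
  have bord: "A' = bordered (complex_of_real (Re a)) B"
  proof (rule eq_mat_borderedI)
    have "cnj a = a" using sym[of 0 0] first[of 0] by simp
    then show "A' $$ (0, 0) = complex_of_real (Re a)"
      using first[of 0] by (simp add: complex_eq_iff)
  qed (use first sym[of 0] in \<open>auto simp: B_def\<close>)
  have "hermitian_mat m B"
    unfolding hermitian_mat_def
    by (auto simp: B_def intro!: eq_matI sym[symmetric])
  then obtain V e where V: "unitary_mat m V" and B: "B = diagonalized V (\<lambda>i. complex_of_real (e i))"
    using Suc.IH by blast
  note [simp] = unitary_matD(2-)[OF V]
  define Z where "Z = bordered 1 V"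
  have dZ [simp]: "dim_row Z = ?n" "dim_col Z = ?n" by (simp_all add: Z_def)
  have Z: "unitary_mat ?n Z"
    unfolding unitary_mat_def
    by (auto intro!: carrier_matI simp: Z_def bordered_adjoint[of _ m] bordered_mult[of _ m] bordered_one)
  let ?e = "case_nat (Re a) e"
  have ce: "(\<lambda>i. complex_of_real (?e i)) = case_nat (complex_of_real (Re a)) (\<lambda>i. complex_of_real (e i))"
    by (auto split: nat.splits)
  have AZ: "A' = Z * mat_diag ?n (\<lambda>i. complex_of_real (?e i)) * mat_adjoint Z"
    unfolding bord B ce bordered_diag[symmetric] Z_def
    by (simp add: bordered_adjoint[of _ m] bordered_mult[of _ m] diagonalized_def)
  have cancel: "W * (mat_adjoint W * X) = X" if "dim_row X = ?n" for X
    using that unitary_matD(5)[OF W(1)] by (simp add: mult_mat_assoc[symmetric])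
  have "A = W * (A' * mat_adjoint W)"
    using unitary_matD(5)[OF W(1)] by (simp add: A'_def mult_mat_assoc cancel right_mult_one_mat')
  also have "\<dots> = diagonalized (W * Z) (\<lambda>i. complex_of_real (?e i))"
    unfolding AZ by (simp add: diagonalized_def adjoint_mult mult_mat_assoc)
  finally show ?case
    using unitary_mult[OF W(1) Z] by blast
qed

section \<open>Even and odd parts\<close>

lemma pcompose_neg_neg: "pcompose (pcompose p [:0, -1:]) [:0, -1:] = (p :: real poly)"
proof -
  have "pcompose [:0, -1:] [:0, -1:] = [:0, 1 :: real:]"
    by (simp add: pcompose_pCons)
  then show ?thesis
    by (simp add: pcompose_assoc[symmetric] pcompose_idR)
qed

lemma degree_pcompose_neg: "degree (pcompose p [:0, -1:]) = degree (p :: real poly)"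
  by (simp add: degree_pcompose)

lemma even_part_parity: "definite_parity (even_part p)"
  unfolding definite_parity_def even_part_def
  by (simp add: pcompose_smult pcompose_add pcompose_neg_neg add.commute)

lemma odd_part_parity: "definite_parity (odd_part p)"
proof -
  have "pcompose (odd_part p) [:0, -1:] = - odd_part p"
    unfolding odd_part_def pcompose_smult pcompose_diff pcompose_neg_neg
    by (simp flip: smult_minus_right)
  then show ?thesis
    by (simp add: definite_parity_def)
qed

lemma degree_even_part: "degree p \<le> d \<Longrightarrow> degree (even_part p) \<le> d"
  unfolding even_part_def
  by (intro order_trans[OF degree_smult_le] degree_add_le) (simp_all add: degree_pcompose_neg)

lemma degree_odd_part: "degree p \<le> d \<Longrightarrow> degree (odd_part p) \<le> d"
  unfolding odd_part_def
  by (intro order_trans[OF degree_smult_le] degree_diff_le) (simp_all add: degree_pcompose_neg)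

lemma even_part_add_odd_part: "even_part p + odd_part p = p"
proof -
  have "p + q + (p - q) = smult 2 p" for q
    by (rule poly_eqI) (simp only: coeff_add coeff_diff coeff_smult)
  then show ?thesis
    unfolding even_part_def odd_part_def smult_add_right[symmetric] by simp
qed

text \<open>The parts at x are averages of p(x) and p(-x) or -p(-x), and [-1, 1] is
  symmetric.\<close>

lemma parts_bound:
  assumes "\<And>x. x \<in> {-1..1} \<Longrightarrow> \<bar>poly p x\<bar> \<le> B" "x \<in> {-1..1}"
  shows "\<bar>poly (even_part p) x\<bar> \<le> B" "\<bar>poly (odd_part p) x\<bar> \<le> B"
proof -
  have "\<bar>poly p x\<bar> \<le> B" "\<bar>poly p (- x)\<bar> \<le> B"
    using assms(2) by (auto intro!: assms(1))
  then show "\<bar>poly (even_part p) x\<bar> \<le> B" "\<bar>poly (odd_part p) x\<bar> \<le> B"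
    unfolding even_part_def odd_part_def by (simp_all add: poly_pcompose abs_le_iff)
qed

text \<open>The circuit is built for p / \<kappa>. The bound 1/2 and \<kappa> \<ge> 1 give the
  strict inequality on which the complementary polynomials depend, while the specification itself
  allows modulus one.\<close>

lemma ordinary_qsvt_exists:
  assumes "1 \<le> \<kappa>" "definite_parity p" "degree p \<le> d" and bound: "\<And>x. x \<in> {-1..1} \<Longrightarrow> \<bar>poly p x\<bar> \<le> 1 / 2"
  shows "\<exists>gs. ordinary_qsvt \<kappa> d p 1 b gs"
proof -
  let ?p = "smult (1 / \<kappa>) p"
  have "definite_parity ?p"
    using assms(2) by (auto simp: definite_parity_def pcompose_smult)
  moreover have "degree ?p \<le> d"
    using assms(3) degree_smult_le order_trans by blast
  moreover have "\<bar>poly ?p x\<bar> < 1" if "x \<in> {-1..1}" for x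
  proof -
    have "\<bar>poly ?p x\<bar> = \<bar>poly p x\<bar> / \<kappa>"
      using \<open>1 \<le> \<kappa>\<close> by (simp add: abs_mult)
    also have "\<dots> \<le> \<bar>poly p x\<bar>"
      using \<open>1 \<le> \<kappa>\<close> by (simp add: divide_le_eq mult_le_cancel_left1)
    finally show ?thesis using bound[OF that] by linarith
  qed
  ultimately obtain gs where gs: "valid_circuit 1 b gs" "num_calls gs \<le> d"
    "\<And>n S U. hermitian_mat n S \<Longrightarrow> block_encoding b n S U \<Longrightarrow>
      block (1 + b) n (circuit_mat 1 b n U gs) = poly_mat ?p S"
    using qsvt_circuit[of ?p d b] by blast
  have "complex_of_real \<kappa> \<cdot>\<^sub>m poly_mat ?p S = poly_mat p S" for S
    unfolding poly_mat_smult[symmetric] using \<open>1 \<le> \<kappa>\<close> by simp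
  with gs assms(2,3) bound show ?thesis
    unfolding ordinary_qsvt_def by (intro exI[of _ gs]) (force dest: bound)
qed

section \<open>Halving the degree\<close>

text \<open>Eliminating the odd-indexed terms from the three-term recurrence gives T_(2n+4) = 2 (2
  y^2 - 1) T_(2n+2) - T_(2n), which is the recurrence of T_n at 2 y^2 - 1.\<close>

lemma poly_cheb_double: "poly (cheb_poly (2 * j)) y = poly (cheb_poly j) (2 * y\<^sup>2 - 1)"
proof (induction j rule: cheb_poly.induct)
  case (3 n)
  have rec: "poly (cheb_poly (Suc (Suc m))) x = 2 * x * poly (cheb_poly (Suc m)) x - poly (cheb_poly m) x" for m x
    by simp
  have "poly (cheb_poly (2 * Suc (Suc n))) y =
      2 * (2 * y\<^sup>2 - 1) * poly (cheb_poly (2 * Suc n)) y - poly (cheb_poly (2 * n)) y"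
  proof -
    define a b c where "a = poly (cheb_poly (2 * n)) y" and "b = poly (cheb_poly (Suc (2 * n))) y"
      and "c = poly (cheb_poly (Suc (Suc (2 * n)))) y"
    have "poly (cheb_poly (Suc (Suc (Suc (Suc (2 * n)))))) y = 2 * y * (2 * y * c - b) - c"
      unfolding rec[of "Suc (Suc (2 * n))" y] rec[of "Suc (2 * n)" y] a_def b_def c_def ..
    also have "\<dots> = 4 * y\<^sup>2 * c - 2 * y * b - c"
      by (simp add: power2_eq_square algebra_simps)
    also have "2 * y * b = c + a"
      unfolding a_def b_def c_def using rec[of "2 * n" y] by linarith
    finally have "poly (cheb_poly (Suc (Suc (Suc (Suc (2 * n)))))) y = 2 * (2 * y\<^sup>2 - 1) * c - a"
      by (simp add: algebra_simps del: cheb_poly.simps)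
    then show ?thesis
      by (simp add: a_def c_def del: cheb_poly.simps)
  qed
  then show ?case
    unfolding 3 rec[of n] .
qed (simp_all add: numeral_2_eq_2 power2_eq_square)

lemma degree_cheb_poly: "degree (cheb_poly j) \<le> j"
proof (induction j rule: cheb_poly.induct)
  case (3 n)
  have "degree ([:0, 2:] * cheb_poly (Suc n)) \<le> Suc (Suc n)"
    using degree_mult_le[of "[:0, 2 :: real:]" "cheb_poly (Suc n)"] 3(1) by simp
  then show ?case
    using 3(2) unfolding cheb_poly.simps by (intro degree_diff_le) simp_all
qed simp_all

lemma poisson_poly_halved:
  obtains q where "degree q \<le> d" "\<And>s. s \<ge> -1 \<Longrightarrow> poly (poisson_poly T \<nu> \<alpha> h N d) (sqrt ((1 + s) / 2)) = poly q s"
proof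
  let ?q = "[:h * Re (poisson_f T \<nu> \<alpha> 0):]
     + smult (2 * h) (\<Sum>k=1..N. smult (Re (poisson_f T \<nu> \<alpha> (real k * h)))
         ([:bessel_J 0 (2 * pi * real k * h):]
          + smult 2 (\<Sum>j=1..d. smult ((-1) ^ j * bessel_J (2 * j) (2 * pi * real k * h)) (cheb_poly j))))"
  show "degree ?q \<le> d"
    by (intro degree_add_le order_trans[OF degree_smult_le] degree_sum_le)
      (auto intro: order_trans[OF degree_cheb_poly])
  fix s :: real assume "s \<ge> -1"
  then have "2 * (sqrt ((1 + s) / 2))\<^sup>2 - 1 = s" by (simp add: field_simps)
  then show "poly (poisson_poly T \<nu> \<alpha> h N d) (sqrt ((1 + s) / 2)) = poly ?q s"
    unfolding poisson_poly_def by (simp add: poly_sum poly_cheb_double del: real_sqrt_pow2_iff real_sqrt_pow2)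
qed

lemma sqrt_powr_double:
  assumes "0 \<le> u"
  shows "sqrt u powr (2 * \<alpha>) = u powr \<alpha>"
  using assms by (simp add: powr_half_sqrt[symmetric] powr_powr)

section \<open>The block encoding of the propagator\<close>

lemma hermitian_diagonalized:
  assumes V: "unitary_mat n V"
  shows "hermitian_mat n (diagonalized V (\<lambda>i. complex_of_real (e i)))"
  unfolding hermitian_mat_def
proof
  show "mat_adjoint (diagonalized V (\<lambda>i. complex_of_real (e i))) = diagonalized V (\<lambda>i. complex_of_real (e i))"
    by (rule eq_matI) (simp_all add: index_diagonalized[OF V] unitary_matD(2)[OF V] mult_ac)
qed (rule diagonalized_carrier[OF V])

text \<open>Each eigenvalue is the value of the quadratic form at a unit eigenvector.\<close>

lemma psd_eigenvalues_nonneg: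
  assumes V: "unitary_mat n V" and psd: "psd_mat n (diagonalized V (\<lambda>i. complex_of_real (e i)))" and "k < n"
  shows "0 \<le> e k"
proof -
  let ?v = "col V k"
  have v: "?v \<in> carrier_vec n"
    using unitary_matD(2)[OF V] by (simp add: carrier_vecI)
  have "?v \<bullet>c ?v = complex_of_real ((l2norm ?v)\<^sup>2)"
    unfolding l2norm_sq by (simp add: scalar_prod_def atLeast0LessThan)
  then have "?v \<bullet>c ?v = 1"
    using diagonalized_col(2)[OF V \<open>k < n\<close>] by simp
  then have "(diagonalized V (\<lambda>i. complex_of_real (e i)) *\<^sub>v ?v) \<bullet>c ?v = complex_of_real (e k)"
    unfolding diagonalized_col(1)[OF V \<open>k < n\<close>] using v by simp
  with psd v show ?thesis
    unfolding psd_mat_def by (metis Re_complex_of_real)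
qed

text \<open>The approximation costs \<epsilon> / 2, and rescaling the target costs at most t
  \<epsilon> / 2, where t \<le> 1. Thus the factor 1 + \<epsilon> / 2 goes into the error and the
  normalization constant stays independent of \<epsilon>.\<close>

lemma normalized_error:
  fixes p t \<epsilon> :: real
  assumes "\<bar>p - t\<bar> \<le> \<epsilon> / 2" "0 \<le> t" "t \<le> 1" "0 < \<epsilon>"
  shows "\<bar>p / (1 + \<epsilon> / 2) - t\<bar> \<le> \<epsilon>"
proof -
  have "p / (1 + \<epsilon> / 2) - t = (p - t - t * (\<epsilon> / 2)) / (1 + \<epsilon> / 2)"
    using \<open>0 < \<epsilon>\<close> by (simp add: field_simps)
  moreover have "\<bar>p - t - t * (\<epsilon> / 2)\<bar> \<le> \<epsilon>"
  proof -
    have "0 \<le> t * (\<epsilon> / 2)" "t * (\<epsilon> / 2) \<le> \<epsilon> / 2"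
      using assms by (auto intro: mult_left_le_one_le)
    with assms(1) show ?thesis by linarith
  qed
  ultimately have "\<bar>p / (1 + \<epsilon> / 2) - t\<bar> \<le> \<epsilon> / (1 + \<epsilon> / 2)"
    using \<open>0 < \<epsilon>\<close> by (simp add: divide_right_mono)
  also have "\<dots> \<le> \<epsilon>"
    using \<open>0 < \<epsilon>\<close> by (simp add: divide_le_eq)
  finally show ?thesis .
qed

text \<open>All matrices involved are functions of \<open>H\<close>, hence diagonal in one
  eigenbasis, and the operator norm of the difference is bounded by the scalar error at the
  eigenvalues.\<close>

lemma propagator_error:
  assumes H: "psd_mat n H" "H \<noteq> 0\<^sub>m n n" and "0 < T" "0 < \<epsilon>"
    and approx: "\<And>s. s \<in> {-1..1} \<Longrightarrow> \<bar>poly q s - exp (- T * opnorm H powr \<alpha> * ((1 + s) / 2) powr \<alpha>)\<bar> \<le> \<epsilon> / 2"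
  defines "S \<equiv> complex_of_real (2 / opnorm H) \<cdot>\<^sub>m H - 1\<^sub>m n"
  shows "hermitian_mat n S"
    and "opnorm (poly_mat (smult (1 / (1 + \<epsilon> / 2)) q) S - mat_exp (complex_of_real (- T) \<cdot>\<^sub>m mat_powr H \<alpha>)) \<le> \<epsilon>"
proof -
  obtain V e where V: "unitary_mat n V" and He: "H = diagonalized V (\<lambda>i. complex_of_real (e i))"
    using hermitian_diagonalizable H(1) unfolding psd_mat_def by blast
  define \<nu> where "\<nu> = opnorm H"
  have e: "0 \<le> e k" "e k \<le> \<nu>" if "k < n" for k
  proof -
    show *: "0 \<le> e k"
      using psd_eigenvalues_nonneg[OF V _ that] H(1) He by simp
    show "e k \<le> \<nu>"
      using opnorm_diagonalized_ge[OF V that, of "\<lambda>i. complex_of_real (e i)"] * by (simp add: \<nu>_def He)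
  qed
  \<comment> \<open>Otherwise all eigenvalues, being between 0 and \<nu>, would vanish.\<close>
  have "\<nu> > 0"
  proof (rule ccontr)
    assume "\<not> \<nu> > 0"
    then have "e k = 0" if "k < n" for k using e[OF that] by linarith
    then have "H = 0\<^sub>m n n"
      unfolding He by (intro eq_matI) (simp_all add: index_diagonalized[OF V] unitary_matD(2)[OF V])
    with H(2) show False ..
  qed
  define s where "s k = 2 / \<nu> * e k - 1" for k
  have s: "s k \<in> {-1..1}" "(1 + s k) / 2 = e k / \<nu>" if "k < n" for k
    using e[OF that] \<open>\<nu> > 0\<close> by (auto simp: s_def field_simps)
  have S: "S = diagonalized V (\<lambda>k. complex_of_real (s k))"
    unfolding S_def \<nu>_def[symmetric] diagonalized_one[OF V, symmetric]
    by (simp add: He diagonalized_smult[OF V] diagonalized_diff[OF V] s_def)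
  show "hermitian_mat n S"
    unfolding S by (rule hermitian_diagonalized[OF V])
  have X: "mat_exp (complex_of_real (- T) \<cdot>\<^sub>m mat_powr H \<alpha>) = diagonalized V (\<lambda>k. complex_of_real (exp (- T * e k powr \<alpha>)))"
    unfolding mat_powr_def He spectral_calculus_diagonalized[OF V] diagonalized_smult[OF V] mat_exp_diagonalized[OF V]
    by (simp flip: exp_of_real)
  have "\<bar>poly q (s k) / (1 + \<epsilon> / 2) - exp (- T * e k powr \<alpha>)\<bar> \<le> \<epsilon>" if "k < n" for k
  proof (rule normalized_error)
    have "\<nu> powr \<alpha> * ((1 + s k) / 2) powr \<alpha> = e k powr \<alpha>"
      unfolding s(2)[OF that] using e[OF that] \<open>\<nu> > 0\<close> by (simp flip: powr_mult)
    then show "\<bar>poly q (s k) - exp (- T * e k powr \<alpha>)\<bar> \<le> \<epsilon> / 2"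
      using approx[OF s(1)[OF that]] by (simp add: \<nu>_def mult.assoc)
  qed (use \<open>0 < T\<close> \<open>0 < \<epsilon>\<close> in auto)
  then show "opnorm (poly_mat (smult (1 / (1 + \<epsilon> / 2)) q) S - mat_exp (complex_of_real (- T) \<cdot>\<^sub>m mat_powr H \<alpha>)) \<le> \<epsilon>"
    unfolding X S poly_mat_diagonalized[OF V] diagonalized_diff[OF V] of_real_diff[symmetric]
    using \<open>0 < \<epsilon>\<close> by (intro opnorm_diagonalized_le[OF V]) (simp_all only: norm_of_real, simp_all)
qed

lemma scaled_block_coherent_select:
  assumes S: "hermitian_mat n S" and enc: "block_encoding b n S U"
    and C0: "ordinary_qsvt \<kappa> d (even_part r) a b C0" and C1: "ordinary_qsvt \<kappa> d (odd_part r) a b C1"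
  shows "complex_of_real (2 * \<kappa>) \<cdot>\<^sub>m block (a + 1 + b) n (circuit_mat (a + 1) b n U (coherent_select a b C0 C1)) = poly_mat r S"
proof -
  have U: "unitary_mat (2 ^ b * n) U" using enc by (simp add: block_encoding_def)
  have v: "valid_circuit a b C0" "valid_circuit a b C1"
    using C0 C1 by (simp_all add: ordinary_qsvt_def)
  have Sc: "S \<in> carrier_mat n n" using S by (simp add: hermitian_mat_def)
  define B0 where "B0 = block (a + b) n (circuit_mat a b n U C0)"
  define B1 where "B1 = block (a + b) n (circuit_mat a b n U C1)"
  have [simp]: "dim_row B0 = n" "dim_col B0 = n" "dim_row B1 = n" "dim_col B1 = n"
    by (simp_all add: B0_def B1_def block_eq)
  have "complex_of_real \<kappa> \<cdot>\<^sub>m B0 = poly_mat (even_part r) S" "complex_of_real \<kappa> \<cdot>\<^sub>m B1 = poly_mat (odd_part r) S"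
    using C0 C1 S enc by (simp_all add: ordinary_qsvt_def B0_def B1_def)
  then have "complex_of_real \<kappa> \<cdot>\<^sub>m B0 + complex_of_real \<kappa> \<cdot>\<^sub>m B1 = poly_mat r S"
    using poly_mat_add[OF Sc, of "even_part r" "odd_part r"] by (simp add: even_part_add_odd_part)
  moreover have "complex_of_real (2 * \<kappa>) \<cdot>\<^sub>m ((1 / 2) \<cdot>\<^sub>m (B0 + B1)) = complex_of_real \<kappa> \<cdot>\<^sub>m B0 + complex_of_real \<kappa> \<cdot>\<^sub>m B1"
    by (rule eq_matI) (simp_all add: algebra_simps)
  ultimately show ?thesis
    unfolding block_coherent_select[OF U v] B0_def[symmetric] B1_def[symmetric] by simp
qed

theorem mainTheorem2:
  fixes \<kappa> :: real
  assumes "\<kappa> \<ge> 1"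
  shows "\<exists>c>0. \<exists>K::nat.
    \<forall>(n::nat) (H::complex mat) (\<alpha>::real) (T::real) (\<epsilon>::real) (h::real) (N::nat) (d::nat).
      psd_mat n H \<longrightarrow> H \<noteq> 0\<^sub>m n n \<longrightarrow> \<alpha> > 0 \<longrightarrow> T > 0 \<longrightarrow> 0 < \<epsilon> \<longrightarrow> \<epsilon> < 1/4 \<longrightarrow> h > 0 \<longrightarrow> d > 0 \<longrightarrow>
      (\<forall>y\<in>{-1..1}. \<bar>poly (poisson_poly T (opnorm H) \<alpha> h N d) y
                      - exp (- T * opnorm H powr \<alpha> * \<bar>y\<bar> powr (2 * \<alpha>))\<bar> \<le> \<epsilon> / 2) \<longrightarrow>
      (let P = poisson_poly T (opnorm H) \<alpha> h N d;
           S = complex_of_real (2 / opnorm H) \<cdot>\<^sub>m H - 1\<^sub>m n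
       in \<exists>q :: real poly.
            degree q \<le> d \<and>
            (\<forall>s\<ge>-1. poly P (sqrt ((1 + s) / 2)) = poly q s) \<and>
            (\<forall>s\<in>{-1..1}. \<bar>poly P (sqrt ((1 + s) / 2))
                            - exp (- T * opnorm H powr \<alpha> * ((1 + s) / 2) powr \<alpha>)\<bar> \<le> \<epsilon> / 2) \<and>
            (let r = smult (1 / (2 * (1 + \<epsilon> / 2))) q
             in \<forall>b::nat.
                  (\<exists>a C0 C1. ordinary_qsvt \<kappa> d (even_part r) a b C0 \<and>
                             ordinary_qsvt \<kappa> d (odd_part r) a b C1) \<and>
                  (\<forall>a C0 C1. ordinary_qsvt \<kappa> d (even_part r) a b C0 \<longrightarrow>
                             ordinary_qsvt \<kappa> d (odd_part r) a b C1 \<longrightarrow>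
                     valid_circuit (a + 1) b (coherent_select a b C0 C1) \<and>
                     num_calls (coherent_select a b C0 C1) \<le> K * d \<and>
                     (\<forall>U. block_encoding b n S U \<longrightarrow>
                        scaled_block_encoding c (a + 1 + b) n
                          (mat_exp (complex_of_real (- T) \<cdot>\<^sub>m mat_powr H \<alpha>)) \<epsilon>
                          (circuit_mat (a + 1) b n U (coherent_select a b C0 C1))))))"
  \<comment> \<open>The circuits encode the two parts divided by \<open>\<kappa>\<close>, the selection halves their sum, and the scaling
    of \<open>q\<close> contributes another factor \<open>2\<close>; the remaining \<open>1 + \<epsilon> / 2\<close> is absorbed by the error.\<close>
proof (intro exI[of _ "4 * \<kappa>"] conjI exI[of _ "2::nat"] allI impI)
  show "0 < 4 * \<kappa>" using assms by simp
  fix n :: nat and H :: "complex mat" and \<alpha> T \<epsilon> h :: real and N d :: nat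
  assume H: "psd_mat n H" "H \<noteq> 0\<^sub>m n n" and pos: "0 < \<alpha>" "0 < T" "0 < \<epsilon>" "\<epsilon> < 1 / 4" "0 < h" "0 < d"
    and approx: "\<forall>y\<in>{-1..1}. \<bar>poly (poisson_poly T (opnorm H) \<alpha> h N d) y
                      - exp (- T * opnorm H powr \<alpha> * \<bar>y\<bar> powr (2 * \<alpha>))\<bar> \<le> \<epsilon> / 2"
  define P where "P = poisson_poly T (opnorm H) \<alpha> h N d"
  define S where "S = complex_of_real (2 / opnorm H) \<cdot>\<^sub>m H - 1\<^sub>m n"
  define X where "X = mat_exp (complex_of_real (- T) \<cdot>\<^sub>m mat_powr H \<alpha>)"
  define t where "t s = exp (- T * opnorm H powr \<alpha> * ((1 + s) / 2) powr \<alpha>)" for s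
  obtain q where deg: "degree q \<le> d" and q: "\<And>s. s \<ge> -1 \<Longrightarrow> poly P (sqrt ((1 + s) / 2)) = poly q s"
    unfolding P_def by (rule poisson_poly_halved[of d T "opnorm H" \<alpha> h N]) blast
  have P_err: "\<bar>poly P (sqrt ((1 + s) / 2)) - t s\<bar> \<le> \<epsilon> / 2" if "s \<in> {-1..1}" for s
  proof -
    have "sqrt ((1 + s) / 2) \<in> {-1..1}" "0 \<le> (1 + s) / 2"
      using that by (auto intro: order_trans[of _ 0])
    then show ?thesis
      using approx[rule_format, of "sqrt ((1 + s) / 2)"] sqrt_powr_double[of "(1 + s) / 2" \<alpha>]
      by (simp add: P_def t_def)
  qed
  have q_err: "\<bar>poly q s - t s\<bar> \<le> \<epsilon> / 2" if "s \<in> {-1..1}" for s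
    using P_err[OF that] q[of s] that by simp
  define r where "r = smult (1 / (2 * (1 + \<epsilon> / 2))) q"
  have r: "\<bar>poly r s\<bar> \<le> 1 / 2" if "s \<in> {-1..1}" for s
  proof -
    \<comment> \<open>The target lies in [0, 1], so q is bounded by 1 + \<epsilon> / 2, the number
      by which r divides besides the factor 2.\<close>
    have "0 \<le> t s" "t s \<le> 1" using pos by (simp_all add: t_def)
    then have "\<bar>poly q s\<bar> \<le> 1 + \<epsilon> / 2" using q_err[OF that] by linarith
    then show ?thesis
      using pos by (simp add: r_def abs_mult field_simps)
  qed
  have deg_r: "degree r \<le> d"
    unfolding r_def using deg degree_smult_le order_trans by blast
  \<comment> \<open>Both circuits use one work qubit, so they share the work register that the
    selection expects.\<close>
  have ex: "\<exists>a C0 C1. ordinary_qsvt \<kappa> d (even_part r) a b C0 \<and> ordinary_qsvt \<kappa> d (odd_part r) a b C1" for b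
    using ordinary_qsvt_exists[OF assms even_part_parity degree_even_part[OF deg_r] parts_bound(1)[OF r]]
      ordinary_qsvt_exists[OF assms odd_part_parity degree_odd_part[OF deg_r] parts_bound(2)[OF r]]
    by blast
  note err = propagator_error[OF H pos(2,3) q_err[unfolded t_def], folded S_def X_def]
  have sel: "valid_circuit (a + 1) b (coherent_select a b C0 C1) \<and>
      num_calls (coherent_select a b C0 C1) \<le> 2 * d \<and>
      (\<forall>U. block_encoding b n S U \<longrightarrow>
        scaled_block_encoding (4 * \<kappa>) (a + 1 + b) n X \<epsilon> (circuit_mat (a + 1) b n U (coherent_select a b C0 C1)))"
    if C: "ordinary_qsvt \<kappa> d (even_part r) a b C0" "ordinary_qsvt \<kappa> d (odd_part r) a b C1" for a b C0 C1
  proof (intro conjI allI impI)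
    show valid: "valid_circuit (a + 1) b (coherent_select a b C0 C1)"
      using C by (intro coherent_select_valid) (simp_all add: ordinary_qsvt_def)
    \<comment> \<open>Each circuit makes at most \<open>d\<close> calls; control turns a call into
      one call, and the Hadamard gates make none.\<close>
    show "num_calls (coherent_select a b C0 C1) \<le> 2 * d"
      using C by (simp add: num_calls_coherent_select ordinary_qsvt_def)
    fix U assume U: "block_encoding b n S U"
    let ?W = "circuit_mat (a + 1) b n U (coherent_select a b C0 C1)"
    have "complex_of_real (4 * \<kappa>) \<cdot>\<^sub>m block (a + 1 + b) n ?W = complex_of_real 2 \<cdot>\<^sub>m (complex_of_real (2 * \<kappa>) \<cdot>\<^sub>m block (a + 1 + b) n ?W)"
      by (rule eq_matI) simp_all
    also have "\<dots> = poly_mat (smult 2 r) S"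
      by (simp only: scaled_block_coherent_select[OF err(1) U C] poly_mat_smult)
    also have "smult 2 r = smult (1 / (1 + \<epsilon> / 2)) q"
    proof -
      have "2 * (1 / (2 * x)) = 1 / x" for x :: real by simp
      then show ?thesis by (simp only: r_def smult_smult)
    qed
    finally have "opnorm (complex_of_real (4 * \<kappa>) \<cdot>\<^sub>m block (a + 1 + b) n ?W - X) \<le> \<epsilon>"
      using err(2) by simp
    moreover have "unitary_mat (2 ^ (a + 1 + b) * n) ?W"
      using U valid by (intro circuit_mat_unitary) (simp_all add: block_encoding_def)
    ultimately show "scaled_block_encoding (4 * \<kappa>) (a + 1 + b) n X \<epsilon> ?W"
      by (simp add: scaled_block_encoding_def)
  qed
  show "let P = poisson_poly T (opnorm H) \<alpha> h N d;
           S = complex_of_real (2 / opnorm H) \<cdot>\<^sub>m H - 1\<^sub>m n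
       in \<exists>q :: real poly.
            degree q \<le> d \<and>
            (\<forall>s\<ge>-1. poly P (sqrt ((1 + s) / 2)) = poly q s) \<and>
            (\<forall>s\<in>{-1..1}. \<bar>poly P (sqrt ((1 + s) / 2))
                            - exp (- T * opnorm H powr \<alpha> * ((1 + s) / 2) powr \<alpha>)\<bar> \<le> \<epsilon> / 2) \<and>
            (let r = smult (1 / (2 * (1 + \<epsilon> / 2))) q
             in \<forall>b::nat.
                  (\<exists>a C0 C1. ordinary_qsvt \<kappa> d (even_part r) a b C0 \<and>
                             ordinary_qsvt \<kappa> d (odd_part r) a b C1) \<and>
                  (\<forall>a C0 C1. ordinary_qsvt \<kappa> d (even_part r) a b C0 \<longrightarrow>
                             ordinary_qsvt \<kappa> d (odd_part r) a b C1 \<longrightarrow>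
                     valid_circuit (a + 1) b (coherent_select a b C0 C1) \<and>
                     num_calls (coherent_select a b C0 C1) \<le> 2 * d \<and>
                     (\<forall>U. block_encoding b n S U \<longrightarrow>
                        scaled_block_encoding (4 * \<kappa>) (a + 1 + b) n
                          (mat_exp (complex_of_real (- T) \<cdot>\<^sub>m mat_powr H \<alpha>)) \<epsilon>
                          (circuit_mat (a + 1) b n U (coherent_select a b C0 C1)))))"
    unfolding Let_def
    using deg q P_err[unfolded t_def] ex sel unfolding P_def S_def X_def r_def
    by (intro exI[of _ q]) blast
qed

end
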